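(* Let $G$ be a finite abelian group, $\rho\colon G\to GL(V)$ a faithful representation on a finite-dimensional complex vector space $V$ not containing the trivial representation, $\mathcal K$ its set of closed subgroups and $\mathcal H=\mathcal K\setminus\{G\}$. Then, as formal power series, \[\tilde\Gamma(s,(t_H)_{H\in\mathcal H})=\prod_{H\in\mathcal H}e^{s_H\lambda_H(t_H)},\qquad \overline\Gamma(s,t,(t_H)_{H\in\mathcal H})=e^{st}\big(\tilde\Gamma-1\big),\] where $s_H=s+\sum_{K\in\mathcal H,\,H\subsetneq K}\frac{\partial}{\partial t_K}$ and the product is interpreted as follows: choose an enumeration $H_1,\dots,H_m$ of $\mathcal H$ with $H_a\subsetneq H_b\Rightarrow a<b$; each $e^{s_H\lambda_H(t_H)}=\sum_{q\ge0}\frac{\lambda_H(t_H)^q s_H^q}{q!}$ is an operator on formal power series (multiplication by $\lambda_H(t_H)$ commutes with $s_H$), and the product means $e^{s_{H_1}\lambda_{H_1}(t_{H_1})}\circ\cdots\circ e^{s_{H_m}\lambda_{H_m}(t_{H_m})}$ applied to $1$.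
   Context: Write $\mathrm{Fix}(K)=\{v\in V:\rho(k)v=v\ \forall k\in K\}$; for a subgroup $H$ let $\phi(H)$ be the maximal subgroup with $\mathrm{Fix}(\phi(H))=\mathrm{Fix}(H)$; $H$ is closed if $\phi(H)=H$. Both $G$ and $\{e\}$ are closed. Forests. $\mathcal F(n,G,V)$ is the set of forests built as follows: the set $\{1,\dots,n\}$ is partitioned into blocks $M_1,\dots,M_k$; for each block a rooted tree (edges oriented away from the root) is chosen whose leaves are exactly labelled by the elements of the block (a block may be a single leaf with no other vertex, called a fallen leaf); each non-leaf (internal) vertex is labelled by a closed subgroup and each edge by a coset of the subgroup labelling its upper endpoint, subject to: (1) if an internal vertex labelled $P$ descends from one labelled $Q$ then $P\subseteq Q$; (2) if an internal vertex labelled $P$ is the only child of a vertex labelled $Q$ then $P\subsetneq Q$, and if a leaf is the only child of a vertex, that vertex's label is not $\{e\}$; (3) the label $G$ appears in at most one tree, and a vertex labelled $G$ has at most one child labelled $G$; (4) for each internal vertex labelled $K$, the edge leading to the subtree containing the smallest leaf below it is labelled $eK$; moreover the forest has at least one internal vertex. $\mathcal F'(n,G,V)\subseteq\mathcal F(n,G,V)$ consists of the forests with no vertex labelled $G$, and $\mathcal F''(n,G,V)\subseteq \mathcal F'(n,G,V)$ of those that moreover have no fallen leaves. $H$-trees. For $H\in\mathcal H$, an $H$-tree with $i\ge1$ leaves is a rooted tree whose leaves are labelled by $\{1,\dots,i\}$, whose internal vertices are all labelled $H$, whose edges are labelled by cosets of $H$ in $G$ such that at each internal vertex the edge towards the subtree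 containing the smallest leaf is labelled $eH$, and in which every internal vertex has at least one child and a vertex with exactly one child has a leaf as that child; if $H=\{e\}$, every internal vertex must have at least two children. (These are exactly the connected components obtained from a forest of $\mathcal F'(n,G,V)$ by keeping the vertices labelled $H$ and their outgoing edges, the lower endpoints not labelled $H$ becoming leaves.) Let $\lambda_{H,i}$ be the number of $H$-trees with $i$ leaves and $\lambda_H(t_H)=\sum_{i\ge1}\lambda_{H,i}t_H^i/i!$. Series. For a forest in $\mathcal F'(n,G,V)$ and $H\in\mathcal H$, let $a_H$ be the number of its (non-fallen) leaves whose parent is labelled $H$. Let $\gamma''(j,(a_H)_H)$ be the number of forests in $\mathcal F''(n,G,V)$, $n=\sum_H a_H$, with $j$ trees and these numbers $a_H$; let $\gamma'(h,j,(a_H)_H)$ be the number of forests in $\mathcal F'(n,G,V)$, $n=h+\sum_Ha_H$, with $h$ fallen leaves, $j>h$ trees (connected components, counting fallen leaves) and these numbers $a_H$. Define \[\tilde\Gamma=1+\sum_{j,(a_H):\sum a_H\ge1}\gamma''(j,(a_H))\,s^j\frac{\prod_H t_H^{a_H}}{(\sum_Ha_H)!},\quad \overline\Gamma=\sum_{j>h\ge0,\ \sum a_H\ge1}\gamma'(h,j,(a_H))\,s^j\frac{t^h\prod_Ht_H^{a_H}}{(h+\sum_Ha_H)!}.\] *)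

theory Defs
  imports Complex_Main "HOL-Library.Poly_Mapping" "HOL-Library.Multiset" "HOL-Library.FuncSet"
    "HOL-Library.Disjoint_Sets" "HOL-Algebra.Coset"
begin

section \<open>Multivariate formal power series\<close>

text \<open>A monomial in variables of type \<open>'x\<close> is a finitely supported exponent vector.\<close>

typedef ('x, 'a) mfps = "UNIV :: (('x \<Rightarrow>\<^sub>0 nat) \<Rightarrow> 'a) set"
  morphisms mfps_coeff Abs_mfps ..

lemmas mfps_coeff_Abs [simp] = Abs_mfps_inverse [OF UNIV_I]

lemma mfps_eqI: "(\<And>m. mfps_coeff f m = mfps_coeff g m) \<Longrightarrow> f = g"
  by (metis ext mfps_coeff_inject)

lemma finite_monomial_splits: "finite {(a, b). a + b = (m :: 'x \<Rightarrow>\<^sub>0 nat)}"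
proof -
  define B where "B = Pi\<^sub>E (Poly_Mapping.keys m) (\<lambda>x. {..Poly_Mapping.lookup m x})"
  define r where "r = (\<lambda>p :: ('x \<Rightarrow>\<^sub>0 nat) \<times> ('x \<Rightarrow>\<^sub>0 nat).
    (restrict (Poly_Mapping.lookup (fst p)) (Poly_Mapping.keys m), restrict (Poly_Mapping.lookup (snd p)) (Poly_Mapping.keys m)))"
  have le: "Poly_Mapping.lookup a x + Poly_Mapping.lookup b x = Poly_Mapping.lookup m x" if "a + b = m" for a b x
    using that by (auto simp: lookup_add)
  have "r ` {(a, b). a + b = m} \<subseteq> B \<times> B"
    unfolding r_def B_def
    by (auto simp: PiE_iff) (metis le le_add1, metis le le_add2)
  moreover have "finite (B \<times> B)" by (simp add: B_def finite_PiE)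
  moreover have "inj_on r {(a, b). a + b = m}"
  proof (rule inj_onI, clarsimp simp: r_def)
    fix a b a' b'
    assume m: "m = a + b" and s: "a' + b' = a + b"
      and ra: "restrict (Poly_Mapping.lookup a) (Poly_Mapping.keys (a + b)) = restrict (Poly_Mapping.lookup a') (Poly_Mapping.keys (a + b))"
      and rb: "restrict (Poly_Mapping.lookup b) (Poly_Mapping.keys (a + b)) = restrict (Poly_Mapping.lookup b') (Poly_Mapping.keys (a + b))"
    have "Poly_Mapping.lookup a x = Poly_Mapping.lookup a' x \<and> Poly_Mapping.lookup b x = Poly_Mapping.lookup b' x" for x
    proof (cases "x \<in> Poly_Mapping.keys (a + b)")
      case True
      then show ?thesis using fun_cong[OF ra, of x] fun_cong[OF rb, of x] by simp
    next
      case False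
      then have "Poly_Mapping.lookup m x = 0" by (simp add: m in_keys_iff)
      then show ?thesis using le[of a b x] le[of a' b' x] m s by simp
    qed
    then show "a = a' \<and> b = b'" by (simp add: poly_mapping_eq_iff fun_eq_iff)
  qed
  ultimately show ?thesis by (meson finite_imageD finite_subset)
qed

instantiation mfps :: (type, comm_ring_1) comm_ring_1
begin

definition zero_mfps where "0 = Abs_mfps (\<lambda>_. 0)"
definition one_mfps where "1 = Abs_mfps (\<lambda>m. if m = 0 then 1 else 0)"
definition plus_mfps where "f + g = Abs_mfps (\<lambda>m. mfps_coeff f m + mfps_coeff g m)"
definition minus_mfps where "f - g = Abs_mfps (\<lambda>m. mfps_coeff f m - mfps_coeff g m)"
definition uminus_mfps where "- f = Abs_mfps (\<lambda>m. - mfps_coeff f m)"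
definition times_mfps where
  "f * g = Abs_mfps (\<lambda>m. \<Sum>(a, b) \<in> {(a, b). a + b = m}. mfps_coeff f a * mfps_coeff g b)"

instance
proof
  fix f g h :: "('a, 'b) mfps"
  show "f * g * h = f * (g * h)"
  proof (rule mfps_eqI)
    fix m :: "'a \<Rightarrow>\<^sub>0 nat"
    have fin: "finite {p :: ('a \<Rightarrow>\<^sub>0 nat) \<times> ('a \<Rightarrow>\<^sub>0 nat). fst p + snd p = m}" for m
      using finite_monomial_splits[of m] by (simp add: case_prod_unfold)
    let ?S = "\<lambda>m :: 'a \<Rightarrow>\<^sub>0 nat. {(a, b). a + b = m}"
    have "mfps_coeff (f * g * h) m =
        (\<Sum>(p, c) \<in> ?S m. \<Sum>(a, b) \<in> ?S p. mfps_coeff f a * mfps_coeff g b * mfps_coeff h c)"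
      by (simp add: times_mfps_def sum_distrib_right case_prod_unfold)
    also have "\<dots> = (\<Sum>z \<in> Sigma (?S m) (\<lambda>u. ?S (fst u)).
        mfps_coeff f (fst (snd z)) * mfps_coeff g (snd (snd z)) * mfps_coeff h (snd (fst z)))"
      by (simp add: sum.Sigma fin case_prod_unfold)
    also have "\<dots> = (\<Sum>z \<in> Sigma (?S m) (\<lambda>u. ?S (snd u)).
        mfps_coeff f (fst (fst z)) * mfps_coeff g (fst (snd z)) * mfps_coeff h (snd (snd z)))"
      by (rule sum.reindex_bij_witness
          [where j = "\<lambda>((p, c), (a, b)). ((a, b + c), (b, c))"
            and i = "\<lambda>((a, q), (b, c)). ((a + b, c), (a, b))"])
        (auto simp: add.assoc)
    also have "\<dots> = (\<Sum>(a, q) \<in> ?S m. \<Sum>(b, c) \<in> ?S q.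
        mfps_coeff f a * mfps_coeff g b * mfps_coeff h c)"
      by (simp add: sum.Sigma fin case_prod_unfold)
    also have "\<dots> = mfps_coeff (f * (g * h)) m"
      by (simp add: times_mfps_def sum_distrib_left case_prod_unfold mult.assoc)
    finally show "mfps_coeff (f * g * h) m = mfps_coeff (f * (g * h)) m" .
  qed
  show "f * g = g * f"
  proof (rule mfps_eqI)
    fix m :: "'a \<Rightarrow>\<^sub>0 nat"
    show "mfps_coeff (f * g) m = mfps_coeff (g * f) m"
      unfolding times_mfps_def mfps_coeff_Abs
      by (rule sum.reindex_bij_witness [where i = prod.swap and j = prod.swap])
        (auto simp: add.commute mult.commute)
  qed
  show "1 * f = f"
  proof (rule mfps_eqI)
    fix m :: "'a \<Rightarrow>\<^sub>0 nat"
    have "mfps_coeff (1 * f) m =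
        (\<Sum>(a, b) \<in> {(a, b). a + b = m}. (if a = 0 then 1 else 0) * mfps_coeff f b)"
      by (simp add: times_mfps_def one_mfps_def)
    also have "\<dots> = (\<Sum>(a, b) \<in> {(0 :: 'a \<Rightarrow>\<^sub>0 nat, m)}. (if a = 0 then 1 else 0) * mfps_coeff f b)"
    proof (rule sum.mono_neutral_right)
      show "finite {(a, b). a + b = m}" by (rule finite_monomial_splits)
      show "{(0, m)} \<subseteq> {(a, b). a + b = m}" by simp
      show "\<forall>p \<in> {(a, b). a + b = m} - {(0, m)}.
          (case p of (a, b) \<Rightarrow> (if a = 0 then 1 else 0) * mfps_coeff f b) = 0"
      proof
        fix p assume "p \<in> {(a, b). a + b = m} - {(0, m)}"
        then have "fst p \<noteq> 0" by (cases p) auto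
        then show "(case p of (a, b) \<Rightarrow> (if a = 0 then 1 else 0) * mfps_coeff f b) = 0"
          by (simp add: case_prod_unfold)
      qed
    qed
    also have "\<dots> = mfps_coeff f m" by simp
    finally show "mfps_coeff (1 * f) m = mfps_coeff f m" .
  qed
  show "(f + g) * h = f * h + g * h"
    by (rule mfps_eqI)
      (simp add: times_mfps_def plus_mfps_def case_prod_unfold distrib_right sum.distrib)
  show "f + g + h = f + (g + h)"
    by (simp add: plus_mfps_def add.assoc)
  show "f + g = g + f"
    by (simp add: plus_mfps_def add.commute)
  show "0 + f = f"
    by (simp add: plus_mfps_def zero_mfps_def mfps_coeff_inverse)
  show "- f + f = 0"
    by (simp add: plus_mfps_def zero_mfps_def uminus_mfps_def)
  show "f - g = f + - g"
    by (simp add: plus_mfps_def minus_mfps_def uminus_mfps_def)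
  show "(0 :: ('a, 'b) mfps) \<noteq> 1"
  proof
    assume "(0 :: ('a, 'b) mfps) = 1"
    then have "mfps_coeff (0 :: ('a, 'b) mfps) 0 = mfps_coeff (1 :: ('a, 'b) mfps) 0" by simp
    then show False by (simp add: zero_mfps_def one_mfps_def)
  qed
qed

end

definition mfps_const :: "'a::zero \<Rightarrow> ('x, 'a) mfps" where
  "mfps_const c = Abs_mfps (\<lambda>m. if m = 0 then c else 0)"

definition mfps_var :: "'x \<Rightarrow> ('x, 'a::zero_neq_one) mfps" where
  "mfps_var x = Abs_mfps (\<lambda>m. if m = Poly_Mapping.single x 1 then 1 else 0)"

definition mfps_deriv :: "'x \<Rightarrow> ('x, 'a::semiring_1) mfps \<Rightarrow> ('x, 'a) mfps" where
  "mfps_deriv x f =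
     Abs_mfps (\<lambda>m. of_nat (Poly_Mapping.lookup m x + 1) * mfps_coeff f (m + Poly_Mapping.single x 1))"

text \<open>Coefficientwise sum of a possibly infinite family of series. Only meaningful for families in
  which each monomial occurs with nonzero coefficient in just finitely many members.\<close>

definition mfps_sum :: "('i \<Rightarrow> ('x, 'a::comm_monoid_add) mfps) \<Rightarrow> 'i set \<Rightarrow> ('x, 'a) mfps" where
  "mfps_sum f I = Abs_mfps (\<lambda>m. \<Sum>i \<in> {i \<in> I. mfps_coeff (f i) m \<noteq> 0}. mfps_coeff (f i) m)"

text \<open>Meaningful for series with zero constant term.\<close>

definition mfps_exp :: "('x, 'a::field_char_0) mfps \<Rightarrow> ('x, 'a) mfps" where
  "mfps_exp f = mfps_sum (\<lambda>q. mfps_const (1 / fact q) * f ^ q) UNIV"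


section \<open>Representations and closed subgroups\<close>

definition GL :: "(complex \<Rightarrow> 'v \<Rightarrow> 'v) \<Rightarrow> ('v::ab_group_add \<Rightarrow> 'v) monoid" where
  "GL scale = \<lparr>carrier = {f. Vector_Spaces.linear scale scale f \<and> bij f}, mult = (\<circ>), one = id\<rparr>"

definition contains_trivial_rep ::
  "(complex \<Rightarrow> 'v \<Rightarrow> 'v::ab_group_add) \<Rightarrow> ('g, 'm) monoid_scheme \<Rightarrow> ('g \<Rightarrow> 'v \<Rightarrow> 'v) \<Rightarrow> bool" where
  "contains_trivial_rep scale G \<rho> \<longleftrightarrow>
     (\<exists>W. module.subspace scale W \<and> vector_space.dim scale W = 1 \<and>
          (\<forall>g \<in> carrier G. \<forall>w \<in> W. \<rho> g w = w))"

definition Fix :: "('g \<Rightarrow> 'v \<Rightarrow> 'v) \<Rightarrow> 'g set \<Rightarrow> 'v set" where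
  "Fix \<rho> K = {v. \<forall>k \<in> K. \<rho> k v = v}"

definition phi ::
  "('g, 'm) monoid_scheme \<Rightarrow> ('g \<Rightarrow> 'v \<Rightarrow> 'v) \<Rightarrow> 'g set \<Rightarrow> 'g set" where
  "phi G \<rho> H = (GREATEST P. subgroup P G \<and> Fix \<rho> P = Fix \<rho> H)"

definition closed_subgroups :: "('g, 'm) monoid_scheme \<Rightarrow> ('g \<Rightarrow> 'v \<Rightarrow> 'v) \<Rightarrow> 'g set set" where
  "closed_subgroups G \<rho> = {H. subgroup H G \<and> phi G \<rho> H = H}"

definition proper_closed :: "('g, 'm) monoid_scheme \<Rightarrow> ('g \<Rightarrow> 'v \<Rightarrow> 'v) \<Rightarrow> 'g set set" where
  "proper_closed G \<rho> = closed_subgroups G \<rho> - {carrier G}"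


section \<open>Labelled rooted trees\<close>

text \<open>\<open>Node K C\<close> is a root labelled \<open>K\<close> together with the multiset \<open>C\<close> of its children, each child
  being given as a pair of the label of the edge leading to it and the subtree hanging there. Values
  of this type are thus isomorphism classes of labelled rooted trees with unordered children. As the
  leaf labels of the trees below are distinct and each internal vertex has a leaf below it, different
  vertices carry different subtrees, and we identify a vertex with the subtree hanging at it.\<close>

datatype 'l ltree = Leaf nat | Node 'l "('l \<times> 'l ltree) multiset"

primrec leaves :: "'l ltree \<Rightarrow> nat multiset" where
  "leaves (Leaf i) = {#i#}"
| "leaves (Node K C) = \<Sum>\<^sub># (image_mset snd (image_mset (map_prod id leaves) C))"

abbreviation leaf_set :: "'l ltree \<Rightarrow> nat set" where
  "leaf_set T \<equiv> set_mset (leaves T)"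

definition has_child :: "'l ltree \<Rightarrow> 'l ltree \<Rightarrow> bool" where
  "has_child T u \<longleftrightarrow> (\<exists>K C c. T = Node K C \<and> (c, u) \<in># C)"

definition vertices :: "'l ltree \<Rightarrow> 'l ltree set" where
  "vertices T = {v. has_child\<^sup>*\<^sup>* T v}"

text \<open>A childless \<open>Node\<close> would be a leaf without a leaf label, hence its exclusion.\<close>

definition tree_on :: "nat set \<Rightarrow> 'l ltree \<Rightarrow> bool" where
  "tree_on M T \<longleftrightarrow> leaves T = mset_set M \<and> (\<forall>K C. Node K C \<in> vertices T \<longrightarrow> C \<noteq> {#})"

text \<open>Edges are labelled by cosets of the label of their upper endpoint, the one towards the smallest
  leaf by the trivial coset. The groups are abelian, so left and right cosets agree.\<close>

definition coset_edges :: "('g, 'm) monoid_scheme \<Rightarrow> 'g set ltree \<Rightarrow> bool" where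
  "coset_edges G T \<longleftrightarrow>
     (\<forall>K C. Node K C \<in> vertices T \<longrightarrow>
        (\<forall>(c, u) \<in># C. c \<in> rcosets\<^bsub>G\<^esub> K \<and>
           (Min (leaf_set (Node K C)) \<in> leaf_set u \<longrightarrow> c = K #>\<^bsub>G\<^esub> \<one>\<^bsub>G\<^esub>)))"


section \<open>Forests\<close>

definition forests :: "('g, 'm) monoid_scheme \<Rightarrow> ('g \<Rightarrow> 'v \<Rightarrow> 'v) \<Rightarrow> nat \<Rightarrow> 'g set ltree set set" where
  "forests G \<rho> n = {F.
     partition_on {1..n} (leaf_set ` F) \<and> inj_on leaf_set F \<and>
     (\<forall>T \<in> F. tree_on (leaf_set T) T) \<and>
     (\<forall>T \<in> F. \<forall>K C. Node K C \<in> vertices T \<longrightarrow> K \<in> closed_subgroups G \<rho>) \<and>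
     (\<forall>T \<in> F. \<forall>Q C P D. Node Q C \<in> vertices T \<and> has_child\<^sup>+\<^sup>+ (Node Q C) (Node P D) \<longrightarrow> P \<subseteq> Q) \<and>
     (\<forall>T \<in> F. \<forall>Q c P D. Node Q {#(c, Node P D)#} \<in> vertices T \<longrightarrow> P \<subset> Q) \<and>
     (\<forall>T \<in> F. \<forall>Q c i. Node Q {#(c, Leaf i)#} \<in> vertices T \<longrightarrow> Q \<noteq> {\<one>\<^bsub>G\<^esub>}) \<and>
     (\<forall>T \<in> F. \<forall>T' \<in> F. \<forall>C C'. Node (carrier G) C \<in> vertices T \<and> Node (carrier G) C' \<in> vertices T' \<longrightarrow> T = T') \<and>
     (\<forall>T \<in> F. \<forall>C. Node (carrier G) C \<in> vertices T \<longrightarrow>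
        size (filter_mset (\<lambda>(c, u). \<exists>D. u = Node (carrier G) D) C) \<le> 1) \<and>
     (\<forall>T \<in> F. coset_edges G T) \<and>
     (\<exists>T \<in> F. \<exists>K C. Node K C \<in> vertices T)}"

definition forests' :: "('g, 'm) monoid_scheme \<Rightarrow> ('g \<Rightarrow> 'v \<Rightarrow> 'v) \<Rightarrow> nat \<Rightarrow> 'g set ltree set set" where
  "forests' G \<rho> n = {F \<in> forests G \<rho> n. \<forall>T \<in> F. \<forall>C. Node (carrier G) C \<notin> vertices T}"

definition fallen_leaves :: "'l ltree set \<Rightarrow> 'l ltree set" where
  "fallen_leaves F = {T \<in> F. \<exists>i. T = Leaf i}"

definition forests'' :: "('g, 'm) monoid_scheme \<Rightarrow> ('g \<Rightarrow> 'v \<Rightarrow> 'v) \<Rightarrow> nat \<Rightarrow> 'g set ltree set set" where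
  "forests'' G \<rho> n = {F \<in> forests' G \<rho> n. fallen_leaves F = {}}"

definition leaves_below :: "'l ltree set \<Rightarrow> 'l \<Rightarrow> nat set" where
  "leaves_below F H = {i. \<exists>T \<in> F. \<exists>C c. Node H C \<in> vertices T \<and> (c, Leaf i) \<in># C}"

definition gamma'' ::
  "('g, 'm) monoid_scheme \<Rightarrow> ('g \<Rightarrow> 'v \<Rightarrow> 'v) \<Rightarrow> nat \<Rightarrow> ('g set \<Rightarrow> nat) \<Rightarrow> nat" where
  "gamma'' G \<rho> j a = card {F \<in> forests'' G \<rho> (\<Sum>H \<in> proper_closed G \<rho>. a H).
     card F = j \<and> (\<forall>H \<in> proper_closed G \<rho>. card (leaves_below F H) = a H)}"

definition gamma' ::
  "('g, 'm) monoid_scheme \<Rightarrow> ('g \<Rightarrow> 'v \<Rightarrow> 'v) \<Rightarrow> nat \<Rightarrow> nat \<Rightarrow> ('g set \<Rightarrow> nat) \<Rightarrow> nat" where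
  "gamma' G \<rho> h j a = card {F \<in> forests' G \<rho> (h + (\<Sum>H \<in> proper_closed G \<rho>. a H)).
     card (fallen_leaves F) = h \<and> card F = j \<and>
     (\<forall>H \<in> proper_closed G \<rho>. card (leaves_below F H) = a H)}"


section \<open>H-trees\<close>

text \<open>A single leaf is not an \<open>H\<close>-tree: as components of what remains of a forest when keeping the
  vertices labelled \<open>H\<close> and their outgoing edges, \<open>H\<close>-trees have a vertex labelled \<open>H\<close>.\<close>

definition H_trees :: "('g, 'm) monoid_scheme \<Rightarrow> 'g set \<Rightarrow> nat \<Rightarrow> 'g set ltree set" where
  "H_trees G H i = {T.
     tree_on {1..i} T \<and> (\<exists>K C. Node K C \<in> vertices T) \<and>
     (\<forall>K C. Node K C \<in> vertices T \<longrightarrow> K = H) \<and>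
     coset_edges G T \<and>
     (\<forall>K c u. Node K {#(c, u)#} \<in> vertices T \<longrightarrow> (\<exists>l. u = Leaf l)) \<and>
     (H = {\<one>\<^bsub>G\<^esub>} \<longrightarrow> (\<forall>K C. Node K C \<in> vertices T \<longrightarrow> size C \<ge> 2))}"


section \<open>Generating series\<close>

text \<open>The variables \<open>s\<close>, \<open>t\<close> and \<open>t\<^sub>H\<close>; only the \<open>t\<^sub>H\<close> with \<open>H\<close> closed and proper occur.\<close>

datatype 'h series_var = s_var | t_var | tH_var 'h

type_synonym 'h series = "('h series_var, rat) mfps"

definition lambda_series :: "('g, 'm) monoid_scheme \<Rightarrow> 'g set \<Rightarrow> 'g set series" where
  "lambda_series G H =
     mfps_sum (\<lambda>i. mfps_const (of_nat (card (H_trees G H i)) / fact i) * mfps_var (tH_var H) ^ i) {1..}"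

definition Gamma_tilde :: "('g, 'm) monoid_scheme \<Rightarrow> ('g \<Rightarrow> 'v \<Rightarrow> 'v) \<Rightarrow> 'g set series" where
  "Gamma_tilde G \<rho> = (let \<H> = proper_closed G \<rho> in
     1 + mfps_sum
       (\<lambda>(j, a). mfps_const (of_nat (gamma'' G \<rho> j a) / fact (\<Sum>H \<in> \<H>. a H)) *
          mfps_var s_var ^ j * (\<Prod>H \<in> \<H>. mfps_var (tH_var H) ^ a H))
       {(j, a). a \<in> \<H> \<rightarrow>\<^sub>E UNIV \<and> (\<Sum>H \<in> \<H>. a H) \<ge> 1})"

definition Gamma_bar :: "('g, 'm) monoid_scheme \<Rightarrow> ('g \<Rightarrow> 'v \<Rightarrow> 'v) \<Rightarrow> 'g set series" where
  "Gamma_bar G \<rho> = (let \<H> = proper_closed G \<rho> in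
     mfps_sum
       (\<lambda>(j, h, a). mfps_const (of_nat (gamma' G \<rho> h j a) / fact (h + (\<Sum>H \<in> \<H>. a H))) *
          mfps_var s_var ^ j * (mfps_var t_var ^ h * (\<Prod>H \<in> \<H>. mfps_var (tH_var H) ^ a H)))
       {(j, h, a). j > h \<and> a \<in> \<H> \<rightarrow>\<^sub>E UNIV \<and> (\<Sum>H \<in> \<H>. a H) \<ge> 1})"

text \<open>The differential operator \<open>s\<^sub>H\<close> and the operator
  \<open>\<Sum>\<^sub>q \<lambda>\<^sub>H(t\<^sub>H)\<^sup>q s\<^sub>H\<^sup>q / q!\<close>. The sum is locally finite because \<open>\<lambda>\<^sub>H(t\<^sub>H)\<close> has no constant term.\<close>

definition s_op ::
  "('g, 'm) monoid_scheme \<Rightarrow> ('g \<Rightarrow> 'v \<Rightarrow> 'v) \<Rightarrow> 'g set \<Rightarrow> 'g set series \<Rightarrow> 'g set series" where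
  "s_op G \<rho> H f = mfps_var s_var * f + (\<Sum>K \<in> {K \<in> proper_closed G \<rho>. H \<subset> K}. mfps_deriv (tH_var K) f)"

definition exp_op ::
  "('g, 'm) monoid_scheme \<Rightarrow> ('g \<Rightarrow> 'v \<Rightarrow> 'v) \<Rightarrow> 'g set \<Rightarrow> 'g set series \<Rightarrow> 'g set series" where
  "exp_op G \<rho> H f =
     mfps_sum (\<lambda>q. mfps_const (1 / fact q) * (lambda_series G H ^ q * (s_op G \<rho> H ^^ q) f)) UNIV"

definition increasing_enumeration :: "'g set set \<Rightarrow> 'g set list \<Rightarrow> bool" where
  "increasing_enumeration \<H> Hs \<longleftrightarrow> distinct Hs \<and> set Hs = \<H> \<and>
     (\<forall>a < length Hs. \<forall>b < length Hs. Hs ! a \<subset> Hs ! b \<longrightarrow> a < b)"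

end

theory Submission
  imports Defs
begin

text \<open>
  Removing the root of a tree with root label \<open>H\<close> and index \<open>g = |G : H|\<close> leaves a set of subtrees of which
  the one containing the smallest leaf carries no coset. By the exponential formula, the series
  \<open>T\<^sub>H\<close> of such trees therefore satisfy the system \<open>exp (g X\<^sub>H) - 1 = g (2 T\<^sub>H + [H = 1] t\<^sub>H)\<close> with
  \<open>X\<^sub>H = t\<^sub>H + \<Sum> T\<^sub>P\<close>, summed over the labels \<open>P \<subseteq> H\<close>; one of the two copies
  of \<open>T\<^sub>H\<close> and the term \<open>[H = 1] t\<^sub>H\<close> account for the forbidden only children. The system has exactly one
  solution, and \<open>\<lambda>\<^sub>H\<close> solves it for the label set \<open>{H}\<close>. Since \<open>s\<^sub>H\<close> is the sum of a multiplication
  and a derivation, \<open>exp (s\<^sub>H \<lambda>\<^sub>H)\<close> is the multiplication by \<open>exp (s \<lambda>\<^sub>H)\<close> after the substitution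
  \<open>t\<^sub>K \<mapsto> t\<^sub>K + \<lambda>\<^sub>H\<close> for \<open>K \<supset> H\<close>. This substitution turns the solution for a label set into the one
  for the label set enlarged by \<open>H\<close>, so that the operator product equals \<open>exp (s \<Sum> T\<^sub>H)\<close>, which
  is the series of the forests.
\<close>

section \<open>Order of vanishing and exponential sums\<close>

text \<open>The statement suggests cutting a forest into its maximal one-label pieces and grafting
  them back. Counting such graftings directly is awkward, because labels, cosets and forbidden only
  children interact. An implicit system with a unique solution replaces that bijection, so that root
  removal is the only decomposition of trees that is needed. The factor \<open>g\<close> has this
  origin: each edge below a vertex labelled \<open>H\<close> admits \<open>g\<close> cosets except
  the one towards the smallest leaf, so \<open>exp (g X) - 1\<close> overcounts the nonempty sets of
  children exactly \<open>g\<close> times. An only child always sits on the exceptional edge, which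
  is why the forbidden ones enter without a coset factor. The enumeration shapes the induction: the
  operators of larger labels act first, so a newly added \<open>H\<close> has no label strictly
  below it among those present. Its own equation then involves one label only, and it changes
  exactly the equations of the \<open>K \<supset> H\<close>. There \<open>t_K\<close> marks a place
  below a vertex labelled \<open>K\<close>, and \<open>t_K + \<lambda>_H\<close> lets this place
  hold either a leaf or a tree whose internal vertices are all labelled \<open>H\<close>.\<close>

lemma mfps_coeff_simps [simp]:
  "mfps_coeff 0 m = 0"
  "mfps_coeff (f + g) m = mfps_coeff f m + mfps_coeff g m"
  "mfps_coeff (f - g) m = mfps_coeff f m - mfps_coeff g m"
  "mfps_coeff (- f) m = - mfps_coeff f m"
  by (simp_all add: zero_mfps_def plus_mfps_def minus_mfps_def uminus_mfps_def)

lemma mfps_coeff_one: "mfps_coeff 1 m = (if m = 0 then 1 else 0)"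
  by (simp add: one_mfps_def)

lemma mfps_coeff_const: "mfps_coeff (mfps_const c) m = (if m = 0 then c else 0)"
  by (simp add: mfps_const_def)

lemma mfps_coeff_sum [simp]: "mfps_coeff (sum f A) m = (\<Sum>x\<in>A. mfps_coeff (f x) m)"
  by (induction A rule: infinite_finite_induct) auto

lemma mfps_coeff_mult:
  "mfps_coeff (f * g) m = (\<Sum>(a, b) \<in> {(a, b). a + b = m}. mfps_coeff f a * mfps_coeff g b)"
  by (simp add: times_mfps_def)

section \<open>Monomials and the coefficients of their products\<close>

definition mfps_monom :: "'a::zero \<Rightarrow> ('x \<Rightarrow>\<^sub>0 nat) \<Rightarrow> ('x, 'a) mfps" where
  "mfps_monom c k = Abs_mfps (\<lambda>m. if m = k then c else 0)"

lemma mfps_coeff_monom [simp]: "mfps_coeff (mfps_monom c k) m = (if m = k then c else 0)"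
  by (simp add: mfps_monom_def)

lemma mfps_coeff_monom_mult:
  fixes f :: "('x, 'a::comm_ring_1) mfps"
  shows "mfps_coeff (mfps_monom c k * f) (k + m) = c * mfps_coeff f m"
proof -
  have "mfps_coeff (mfps_monom c k * f) (k + m) = (\<Sum>(a, b) \<in> {(k, m)}. mfps_coeff (mfps_monom c k) a * mfps_coeff f b)"
    unfolding mfps_coeff_mult
    by (rule sum.mono_neutral_right) (auto simp: finite_monomial_splits split: if_splits)
  then show ?thesis by simp
qed

lemma mfps_coeff_monom_mult_0:
  fixes f :: "('x, 'a::comm_ring_1) mfps"
  assumes "\<nexists>m'. m = k + m'"
  shows "mfps_coeff (mfps_monom c k * f) m = 0"
  unfolding mfps_coeff_mult
  by (rule sum.neutral) (use assms in auto)

lemma mfps_const_eq_monom: "mfps_const c = mfps_monom c 0"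
  by (simp add: mfps_const_def mfps_monom_def)

lemma mfps_var_eq_monom: "mfps_var x = mfps_monom 1 (Poly_Mapping.single x 1)"
  by (simp add: mfps_var_def mfps_monom_def)

lemma one_eq_monom: "1 = mfps_monom 1 0"
  by (simp add: one_mfps_def mfps_monom_def)

lemma mfps_coeff_const_mult [simp]:
  fixes f :: "('x, 'a::comm_ring_1) mfps"
  shows "mfps_coeff (mfps_const c * f) m = c * mfps_coeff f m"
  using mfps_coeff_monom_mult[of c 0 f m] by (simp add: mfps_const_eq_monom)

lemma mfps_monom_mult:
  fixes c d :: "'a::comm_ring_1"
  shows "mfps_monom c k * mfps_monom d l = mfps_monom (c * d) (k + l)"
proof (rule mfps_eqI)
  fix m
  show "mfps_coeff (mfps_monom c k * mfps_monom d l) m = mfps_coeff (mfps_monom (c * d) (k + l)) m"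
  proof (cases "\<exists>m'. m = k + m'")
    case True
    then show ?thesis by (auto simp: mfps_coeff_monom_mult)
  next
    case False
    then show ?thesis by (auto simp: mfps_coeff_monom_mult_0)
  qed
qed

lemma mfps_var_power: "(mfps_var x :: ('x, 'a::comm_ring_1) mfps) ^ n = mfps_monom 1 (Poly_Mapping.single x n)"
  by (induction n) (auto simp: mfps_monom_mult one_eq_monom mfps_var_eq_monom simp flip: single_add)

lemma mfps_const_mult:
  "mfps_const (c * d) = mfps_const c * mfps_const (d :: 'a::comm_ring_1)"
  by (simp add: mfps_const_eq_monom mfps_monom_mult)

lemma mfps_const_add: "mfps_const (c + d) = mfps_const c + mfps_const (d :: 'a::comm_ring_1)"
  by (rule mfps_eqI) (simp add: mfps_coeff_const)

lemma mfps_const_1 [simp]: "mfps_const 1 = 1"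
  by (simp add: one_mfps_def mfps_const_def)

lemma mfps_const_0 [simp]: "mfps_const 0 = 0"
  by (rule mfps_eqI) (simp add: mfps_coeff_const)

lemma mfps_const_of_nat: "mfps_const (of_nat n) = (of_nat n :: ('x, 'a::comm_ring_1) mfps)"
  by (induction n) (auto simp: mfps_const_add)

lemma mfps_coeff_mult_0 [simp]:
  "mfps_coeff (f * g) 0 = mfps_coeff f 0 * mfps_coeff (g :: ('x, 'a::comm_ring_1) mfps) 0"
proof -
  have "mfps_coeff (f * g) 0 = (\<Sum>(a, b) \<in> {(0, 0)}. mfps_coeff f a * mfps_coeff g b)"
  proof -
    have "{(a, b). a + b = (0 :: 'x \<Rightarrow>\<^sub>0 nat)} = {(0, 0)}"
      by (auto simp: poly_mapping_eq_iff fun_eq_iff lookup_add)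
    then show ?thesis by (simp add: mfps_coeff_mult)
  qed
  then show ?thesis by simp
qed

text \<open>Distinct exponents cannot interfere, so each coefficient of the possibly infinite sum
  has at most one contribution. All series that are given by their coefficients, namely
  \<open>lambda_series\<close>, \<open>Gamma_tilde\<close> and \<open>Gamma_bar\<close>, are read
  off in this way.\<close>

lemma mfps_coeff_sum_monom:
  assumes "inj_on \<mu> I"
  shows "i \<in> I \<Longrightarrow> mfps_coeff (mfps_sum (\<lambda>i. mfps_monom (c i) (\<mu> i)) I) (\<mu> i) = c i"
    and "m \<notin> \<mu> ` I \<Longrightarrow> mfps_coeff (mfps_sum (\<lambda>i. mfps_monom (c i) (\<mu> i)) I) m = 0"
proof -
  assume i: "i \<in> I"
  have "{k \<in> I. mfps_coeff (mfps_monom (c k) (\<mu> k)) (\<mu> i) \<noteq> 0} = {k. k = i \<and> c i \<noteq> 0}"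
  proof (rule Collect_cong)
    fix k
    show "(k \<in> I \<and> mfps_coeff (mfps_monom (c k) (\<mu> k)) (\<mu> i) \<noteq> 0) = (k = i \<and> c i \<noteq> 0)"
      using i inj_on_eq_iff[OF assms, of k i] by auto
  qed
  then have "mfps_coeff (mfps_sum (\<lambda>i. mfps_monom (c i) (\<mu> i)) I) (\<mu> i) =
      (\<Sum>k\<in>{k. k = i \<and> c i \<noteq> 0}. mfps_coeff (mfps_monom (c k) (\<mu> k)) (\<mu> i))"
    by (simp only: mfps_sum_def mfps_coeff_Abs)
  also have "\<dots> = c i" by (cases "c i = 0") simp_all
  finally show "mfps_coeff (mfps_sum (\<lambda>i. mfps_monom (c i) (\<mu> i)) I) (\<mu> i) = c i" .
next
  assume m: "m \<notin> \<mu> ` I"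
  then have "{k \<in> I. mfps_coeff (mfps_monom (c k) (\<mu> k)) m \<noteq> 0} = {}" by auto
  then show "mfps_coeff (mfps_sum (\<lambda>i. mfps_monom (c i) (\<mu> i)) I) m = 0"
    by (simp only: mfps_sum_def mfps_coeff_Abs sum.empty)
qed

lemma mfps_coeff_var_0 [simp]: "mfps_coeff (mfps_var x) 0 = 0"
proof -
  have "0 \<noteq> Poly_Mapping.single x (Suc 0)"
    by (metis lookup_single_eq lookup_zero nat.distinct(1))
  then show ?thesis by (simp add: mfps_var_eq_monom)
qed

section \<open>The filtration by total degree\<close>

definition mdeg :: "'x set \<Rightarrow> ('x \<Rightarrow>\<^sub>0 nat) \<Rightarrow> nat" where
  "mdeg A m = (\<Sum>x \<in> Poly_Mapping.keys m \<inter> A. Poly_Mapping.lookup m x)"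

lemma mdeg_eq_sum:
  assumes "finite Z" "Poly_Mapping.keys m \<subseteq> Z"
  shows "mdeg A m = (\<Sum>x \<in> Z \<inter> A. Poly_Mapping.lookup m x)"
  unfolding mdeg_def
  by (rule sum.mono_neutral_left) (use assms in \<open>auto simp: in_keys_iff\<close>)

lemma mdeg_add: "mdeg A (a + b) = mdeg A a + mdeg A b"
proof -
  let ?Z = "Poly_Mapping.keys a \<union> Poly_Mapping.keys b"
  have "mdeg A (a + b) = (\<Sum>x \<in> ?Z \<inter> A. Poly_Mapping.lookup (a + b) x)"
    by (rule mdeg_eq_sum) (auto simp: keys_add)
  also have "\<dots> = mdeg A a + mdeg A b"
    by (subst (1 2) mdeg_eq_sum[where Z = ?Z]) (auto simp: lookup_add sum.distrib)
  finally show ?thesis .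
qed

lemma mdeg_0 [simp]: "mdeg A 0 = 0"
  by (simp add: mdeg_def)

lemma mdeg_single [simp]: "mdeg A (Poly_Mapping.single x n) = (if x \<in> A then n else 0)"
  by (subst mdeg_eq_sum[where Z = "{x}"]) auto

lemma mdeg_sum: "mdeg A (sum f I) = (\<Sum>i\<in>I. mdeg A (f i))"
  by (induction I rule: infinite_finite_induct) (auto simp: mdeg_add)

lemma mdeg_UNIV_eq_0 [simp]: "mdeg UNIV m = 0 \<longleftrightarrow> m = 0"
  by (auto simp: mdeg_def in_keys_iff poly_mapping_eq_iff fun_eq_iff)

text \<open>Vanishing below total degree \<open>k\<close> stands in for a topology: infinite sums
  are compared modulo each order, and by \<open>mfps_eqI_ord\<close> agreement to every order is
  equality. As a predicate it needs no special value for the order of the zero series.\<close>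

definition ord_ge :: "nat \<Rightarrow> ('x, 'a::zero) mfps \<Rightarrow> bool" where
  "ord_ge k f \<longleftrightarrow> (\<forall>m. mdeg UNIV m < k \<longrightarrow> mfps_coeff f m = 0)"

lemma ord_ge_0 [simp]: "ord_ge 0 f" by (simp add: ord_ge_def)
lemma ord_ge_zero [simp]: "ord_ge k (0 :: ('x, 'a::comm_ring_1) mfps)" by (simp add: ord_ge_def)
lemma ord_ge_1: "ord_ge (Suc 0) f \<longleftrightarrow> mfps_coeff f 0 = 0" by (simp add: ord_ge_def)
lemma ord_ge_mono: "ord_ge k f \<Longrightarrow> l \<le> k \<Longrightarrow> ord_ge l f" by (simp add: ord_ge_def)
lemma ord_ge_add: "ord_ge k f \<Longrightarrow> ord_ge k g \<Longrightarrow> ord_ge k (f + g :: ('x, 'a::comm_ring_1) mfps)"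
  by (simp add: ord_ge_def)
lemma ord_ge_diff: "ord_ge k f \<Longrightarrow> ord_ge k g \<Longrightarrow> ord_ge k (f - g :: ('x, 'a::comm_ring_1) mfps)"
  by (simp add: ord_ge_def)
lemma ord_ge_sum: "(\<And>x. x \<in> A \<Longrightarrow> ord_ge k (f x)) \<Longrightarrow> ord_ge k (sum f A :: ('x, 'a::comm_ring_1) mfps)"
  by (simp add: ord_ge_def)

lemma ord_ge_mult:
  fixes f g :: "('x, 'a::comm_ring_1) mfps"
  assumes "ord_ge k f" "ord_ge l g" "n \<le> k + l"
  shows "ord_ge n (f * g)"
  unfolding ord_ge_def mfps_coeff_mult
proof safe
  fix m :: "'x \<Rightarrow>\<^sub>0 nat" assume m: "mdeg UNIV m < n"
  show "(\<Sum>(a, b) | a + b = m. mfps_coeff f a * mfps_coeff g b) = 0"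
  proof (rule sum.neutral, safe)
    fix a b assume "m = a + b"
    with m assms(3) have "mdeg UNIV a < k \<or> mdeg UNIV b < l" by (auto simp: mdeg_add)
    then show "mfps_coeff f a * mfps_coeff g b = 0" using assms by (auto simp: ord_ge_def)
  qed
qed

lemma ord_ge_mult_left: "ord_ge k f \<Longrightarrow> ord_ge k (g * f :: ('x, 'a::comm_ring_1) mfps)"
  by (rule ord_ge_mult[of 0 _ k]) auto

lemma ord_ge_power:
  fixes f :: "('x, 'a::comm_ring_1) mfps"
  assumes "ord_ge k f" shows "ord_ge (q * k) (f ^ q)"
  by (induction q) (auto intro: ord_ge_mult[OF assms])

lemma ord_ge_power1:
  fixes f :: "('x, 'a::comm_ring_1) mfps"
  assumes "mfps_coeff f 0 = 0" shows "ord_ge q (f ^ q)"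
  using ord_ge_power[of "Suc 0" f q] assms by (simp add: ord_ge_1)

lemma mfps_eqI_ord:
  fixes f g :: "('x, 'a::comm_ring_1) mfps"
  assumes "\<And>n. ord_ge n (f - g)" shows "f = g"
proof (rule mfps_eqI)
  fix m
  show "mfps_coeff f m = mfps_coeff g m"
    using assms[of "Suc (mdeg UNIV m)"] by (auto simp: ord_ge_def)
qed

text \<open>An arbitrary sequence takes the place of the powers in the exponential series, so that
  one notion covers \<open>mfps_exp\<close>, the substitution \<open>shift\<close> and the operator
  \<open>exp_op\<close>. The usual side condition \<open>ord_ge q (a q)\<close> makes every
  coefficient a finite sum.\<close>

definition exp_sum :: "(nat \<Rightarrow> ('x, 'a::field_char_0) mfps) \<Rightarrow> ('x, 'a) mfps" where
  "exp_sum a = mfps_sum (\<lambda>q. mfps_const (1 / fact q) * a q) UNIV"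

lemma mfps_coeff_exp_sum:
  fixes a :: "nat \<Rightarrow> ('x, 'a::field_char_0) mfps"
  assumes "\<And>q. ord_ge q (a q)" "mdeg UNIV m < n"
  shows "mfps_coeff (exp_sum a) m = (\<Sum>q<n. mfps_coeff (a q) m / fact q)"
proof -
  have "mfps_coeff (exp_sum a) m = (\<Sum>q | mfps_coeff (a q) m \<noteq> 0. mfps_coeff (a q) m / fact q)"
    by (simp add: exp_sum_def mfps_sum_def)
  also have "\<dots> = (\<Sum>q<n. mfps_coeff (a q) m / fact q)"
  proof (rule sum.mono_neutral_left)
    show "{q. mfps_coeff (a q) m \<noteq> 0} \<subseteq> {..<n}"
    proof safe
      fix q assume "mfps_coeff (a q) m \<noteq> 0"
      then have "\<not> mdeg UNIV m < q" using assms(1)[of q] by (auto simp: ord_ge_def)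
      then show "q < n" using assms(2) by simp
    qed
  qed auto
  finally show ?thesis .
qed

lemma exp_sum_approx:
  fixes a :: "nat \<Rightarrow> ('x, 'a::field_char_0) mfps"
  assumes "\<And>q. ord_ge q (a q)"
  shows "ord_ge n (exp_sum a - (\<Sum>q<n. mfps_const (1 / fact q) * a q))"
  by (auto simp: ord_ge_def mfps_coeff_exp_sum[OF assms])

lemma ord_ge_exp_sum:
  fixes a :: "nat \<Rightarrow> ('x, 'a::field_char_0) mfps"
  assumes "\<And>q. ord_ge q (a q)" "\<And>q. ord_ge k (a q)"
  shows "ord_ge k (exp_sum a)"
  using assms(2) by (auto simp: ord_ge_def mfps_coeff_exp_sum[OF assms(1), of _ k])

lemma exp_sum_add:
  fixes a b :: "nat \<Rightarrow> ('x, 'a::field_char_0) mfps"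
  assumes "\<And>q. ord_ge q (a q)" "\<And>q. ord_ge q (b q)"
  shows "exp_sum (\<lambda>q. a q + b q) = exp_sum a + exp_sum b"
  by (rule mfps_eqI)
    (simp add: mfps_coeff_exp_sum[OF _ lessI] assms ord_ge_add sum.distrib add_divide_distrib del: sum.lessThan_Suc)

lemma exp_sum_diff:
  fixes a b :: "nat \<Rightarrow> ('x, 'a::field_char_0) mfps"
  assumes "\<And>q. ord_ge q (a q)" "\<And>q. ord_ge q (b q)"
  shows "exp_sum (\<lambda>q. a q - b q) = exp_sum a - exp_sum b"
  by (rule mfps_eqI)
    (simp add: mfps_coeff_exp_sum[OF _ lessI] assms ord_ge_diff sum_subtractf diff_divide_distrib del: sum.lessThan_Suc)

lemma exp_sum_only_0:
  fixes a :: "nat \<Rightarrow> ('x, 'a::field_char_0) mfps"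
  assumes "\<And>q. q > 0 \<Longrightarrow> a q = 0"
  shows "exp_sum a = a 0"
proof (rule mfps_eqI)
  fix m
  have "mfps_coeff (exp_sum a) m = (\<Sum>q<Suc (mdeg UNIV m). mfps_coeff (a q) m / fact q)"
  proof (rule mfps_coeff_exp_sum)
    fix q show "ord_ge q (a q)" using assms[of q] by (cases q) auto
  qed simp
  also have "\<dots> = (\<Sum>q\<in>{0}. mfps_coeff (a q) m / fact q)"
    by (rule sum.mono_neutral_right) (auto simp: assms)
  finally show "mfps_coeff (exp_sum a) m = mfps_coeff (a 0) m" by simp
qed

lemma exp_sum_affine:
  fixes a :: "nat \<Rightarrow> ('x, 'a::field_char_0) mfps"
  assumes "ord_ge 1 (a 1)" "\<And>q. q \<ge> 2 \<Longrightarrow> a q = 0"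
  shows "exp_sum a = a 0 + a 1"
proof (rule mfps_eqI)
  fix m
  have "ord_ge q (a q)" for q
  proof -
    consider "q = 0" | "q = 1" | "q \<ge> 2" by linarith
    then show ?thesis using assms(1) assms(2)[of q] by cases simp_all
  qed
  then have "mfps_coeff (exp_sum a) m = (\<Sum>q<Suc (Suc (mdeg UNIV m)). mfps_coeff (a q) m / fact q)"
    by (rule mfps_coeff_exp_sum) simp
  also have "\<dots> = (\<Sum>q\<in>{0,1}. mfps_coeff (a q) m / fact q)"
  proof (rule sum.mono_neutral_right)
    show "\<forall>q\<in>{..<Suc (Suc (mdeg UNIV m))} - {0, 1}. mfps_coeff (a q) m / fact q = 0"
    proof
      fix q assume "q \<in> {..<Suc (Suc (mdeg UNIV m))} - {0, 1}"
      then have "q \<ge> 2" by auto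
      then show "mfps_coeff (a q) m / fact q = 0" by (simp add: assms(2))
    qed
  qed auto
  finally show "mfps_coeff (exp_sum a) m = mfps_coeff (a 0 + a 1) m" by simp
qed

lemma ord_ge_binomial_conv:
  fixes a b :: "nat \<Rightarrow> ('x, 'a::comm_ring_1) mfps"
  assumes "\<And>q. ord_ge q (a q)" "\<And>q. ord_ge q (b q)"
  shows "ord_ge q (\<Sum>i\<le>q. of_nat (q choose i) * (a i * b (q - i)))"
proof (rule ord_ge_sum)
  fix i assume "i \<in> {..q}"
  then show "ord_ge q (of_nat (q choose i) * (a i * b (q - i)))"
    by (intro ord_ge_mult_left ord_ge_mult[OF assms(1) assms(2)]) auto
qed

text \<open>Cauchy product: modulo order \<open>n\<close> both factors may be truncated, and the
  index pairs with \<open>i + j \<ge> n\<close> that the product of the truncations has in excess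
  contribute nothing below order \<open>n\<close>.\<close>

lemma exp_sum_mult:
  fixes a b :: "nat \<Rightarrow> ('x, 'a::field_char_0) mfps"
  assumes a: "\<And>q. ord_ge q (a q)" and b: "\<And>q. ord_ge q (b q)"
  shows "exp_sum a * exp_sum b = exp_sum (\<lambda>q. \<Sum>i\<le>q. of_nat (q choose i) * (a i * b (q - i)))"
    (is "_ = exp_sum ?c")
proof (rule mfps_eqI_ord)
  fix n
  let ?A = "\<lambda>q. mfps_const (1 / fact q) * a q" and ?B = "\<lambda>q. mfps_const (1 / fact q) * b q"
  have c: "mfps_const (1 / fact q) * ?c q = (\<Sum>i\<le>q. ?A i * ?B (q - i))" for q
    unfolding sum_distrib_left
  proof (rule sum.cong)
    fix i assume i: "i \<in> {..q}"
    have "mfps_const (1 / fact q) * of_nat (q choose i) =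
        mfps_const (1 / fact i) * (mfps_const (1 / fact (q - i)) :: ('x, 'a) mfps)"
      using i by (simp add: mfps_const_of_nat[symmetric] mfps_const_mult[symmetric] binomial_fact)
    then show "mfps_const (1 / fact q) * (of_nat (q choose i) * (a i * b (q - i))) = ?A i * ?B (q - i)"
      by (simp add: mult_ac)  (metis mult.assoc mult.commute)
  qed auto
  have "exp_sum a * exp_sum b - (\<Sum>q<n. ?A q) * (\<Sum>q<n. ?B q) =
      (exp_sum a - (\<Sum>q<n. ?A q)) * exp_sum b + (\<Sum>q<n. ?A q) * (exp_sum b - (\<Sum>q<n. ?B q))"
    by (simp add: algebra_simps)
  also have "ord_ge n \<dots>"
    by (intro ord_ge_add ord_ge_mult_left exp_sum_approx b
        ord_ge_mult[of n _ 0, OF exp_sum_approx]) (auto simp: a)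
  finally have 1: "ord_ge n (exp_sum a * exp_sum b - (\<Sum>q<n. ?A q) * (\<Sum>q<n. ?B q))" .
  have "(\<Sum>q<n. ?A q) * (\<Sum>q<n. ?B q) = (\<Sum>p\<in>{..<n}\<times>{..<n}. ?A (fst p) * ?B (snd p))"
    by (simp add: sum_product sum.cartesian_product case_prod_unfold)
  also have "\<dots> = (\<Sum>p\<in>{(i,j). i + j < n}. ?A (fst p) * ?B (snd p)) +
       (\<Sum>p\<in>{..<n}\<times>{..<n} - {(i,j). i + j < n}. ?A (fst p) * ?B (snd p))"
    by (subst add.commute, rule sum.subset_diff) auto
  also have "(\<Sum>p\<in>{(i,j). i + j < n}. ?A (fst p) * ?B (snd p)) = (\<Sum>q<n. mfps_const (1 / fact q) * ?c q)"
    unfolding c sum.triangle_reindex[of "\<lambda>i j. ?A i * ?B j" n, symmetric] by (simp add: case_prod_unfold)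
  finally have "(\<Sum>q<n. ?A q) * (\<Sum>q<n. ?B q) - (\<Sum>q<n. mfps_const (1 / fact q) * ?c q) =
     (\<Sum>p\<in>{..<n}\<times>{..<n} - {(i,j). i + j < n}. ?A (fst p) * ?B (snd p))" by simp
  also have "ord_ge n \<dots>"
  proof (rule ord_ge_sum)
    fix p assume "p \<in> {..<n}\<times>{..<n} - {(i,j). i + j < n}"
    then show "ord_ge n (?A (fst p) * ?B (snd p))"
      by (intro ord_ge_mult[of "fst p" _ "snd p"] ord_ge_mult_left a b) auto
  qed
  finally have 2: "ord_ge n ((\<Sum>q<n. ?A q) * (\<Sum>q<n. ?B q) - (\<Sum>q<n. mfps_const (1 / fact q) * ?c q))" .
  have "ord_ge n ((\<Sum>q<n. mfps_const (1 / fact q) * ?c q) - exp_sum ?c)"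
    using exp_sum_approx[of ?c n] ord_ge_binomial_conv[OF a b]
    by (simp add: ord_ge_def)
  from ord_ge_add[OF ord_ge_add[OF 1 2] this]
  show "ord_ge n (exp_sum a * exp_sum b - exp_sum ?c)" by simp
qed

section \<open>The exponential series\<close>

lemma mfps_exp_eq: "mfps_exp f = exp_sum (\<lambda>q. f ^ q)"
  by (simp add: mfps_exp_def exp_sum_def)

lemma mfps_exp_0 [simp]: "mfps_exp 0 = 1"
  unfolding mfps_exp_eq by (subst exp_sum_only_0) (auto simp: power_0_left)

lemma mfps_exp_add:
  fixes f g :: "('x, 'a::field_char_0) mfps"
  assumes "mfps_coeff f 0 = 0" "mfps_coeff g 0 = 0"
  shows "mfps_exp (f + g) = mfps_exp f * mfps_exp g"
  unfolding mfps_exp_eq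
  by (subst exp_sum_mult) (simp_all add: ord_ge_power1 assms binomial_ring[abs_def] mult.assoc)

lemma mfps_exp_coeff_0:
  fixes f :: "('x, 'a::field_char_0) mfps"
  assumes "mfps_coeff f 0 = 0" shows "mfps_coeff (mfps_exp f) 0 = 1"
  unfolding mfps_exp_eq
  by (subst mfps_coeff_exp_sum[of _ _ 1]) (auto simp: ord_ge_power1 assms mfps_coeff_one)

text \<open>Only the powers \<open>q \<ge> 2\<close> survive in the difference, and each of them
  vanishes to order \<open>2 * k\<close>. The uniqueness of solutions of the tree equation rests on
  this quadratic remainder.\<close>

lemma mfps_exp_approx_linear:
  fixes f :: "('x, 'a::field_char_0) mfps"
  assumes "mfps_coeff f 0 = 0" "ord_ge k f"
  shows "ord_ge (2 * k) (mfps_exp f - (1 + f))"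
proof -
  \<comment> \<open>The power sequence cut after the linear term, so that the remainder is again an
    \<open>exp_sum\<close>.\<close>
  let ?b = "\<lambda>q. if q \<le> 1 then f ^ q else 0"
  have b: "ord_ge q (?b q)" for q by (simp add: ord_ge_power1 assms)
  have "exp_sum ?b = 1 + f"
    by (subst exp_sum_affine) (simp_all add: ord_ge_1 assms)
  then have "mfps_exp f - (1 + f) = exp_sum (\<lambda>q. f ^ q - ?b q)"
    unfolding mfps_exp_eq by (subst exp_sum_diff) (auto simp: ord_ge_power1 assms)
  also have "ord_ge (2 * k) \<dots>"
  proof (rule ord_ge_exp_sum)
    fix q
    show "ord_ge q (f ^ q - ?b q)" by (rule ord_ge_diff[OF _ b]) (simp add: ord_ge_power1 assms)
    show "ord_ge (2 * k) (f ^ q - ?b q)"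
      using ord_ge_mono[OF ord_ge_power[OF assms(2), of q], of "2 * k"] by auto
  qed
  finally show ?thesis .
qed

text \<open>The induction gains one order per step because the exponential is the identity to first order
  while the two sides of the equation carry the different factors \<open>1\<close> and \<open>2\<close>.\<close>

lemma tree_equation_unique:
  fixes c Y T T' :: "('x, 'a::field_char_0) mfps"
  assumes "g \<noteq> 0" "mfps_coeff Y 0 = 0" "mfps_coeff T 0 = 0" "mfps_coeff T' 0 = 0"
    and "mfps_exp (mfps_const g * (Y + T)) - 1 = mfps_const g * (2 * T + c)"
    and "mfps_exp (mfps_const g * (Y + T')) - 1 = mfps_const g * (2 * T' + c)"
  shows "T = T'"
proof (rule mfps_eqI_ord)
  fix n
  define e where "e = mfps_exp (mfps_const g * (Y + T'))"
  define d where "d = mfps_const g * (T - T')"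
  have "mfps_const g * (Y + T) = mfps_const g * (Y + T') + d" by (simp add: d_def algebra_simps)
  then have "mfps_exp (mfps_const g * (Y + T)) = e * mfps_exp d"
    unfolding e_def by (simp add: mfps_exp_add assms(2-4) d_def)
  then have eq: "e * mfps_exp d - e = 2 * d"
    using assms(5,6) unfolding e_def[symmetric] d_def by (simp add: algebra_simps)
  have d0: "mfps_coeff d 0 = 0" by (simp add: d_def assms(3,4))
  have "ord_ge n d"
  proof (induction n)
    case (Suc n)
    show ?case
    proof (cases n)
      \<comment> \<open>Doubling the order gains nothing at order 0; the vanishing constant terms
        supply the first order.\<close>
      case 0
      then show ?thesis by (simp add: ord_ge_1 d0)
    next
      case (Suc k)
      \<comment> \<open>This is \<open>e * mfps_exp d - e = 2 * d\<close> with one \<open>d\<close>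
        moved over. Both summands on the left vanish to one order more than \<open>d\<close> is
        known to: the first by the quadratic remainder, the second because \<open>e\<close> has
        constant term 1.\<close>
      have "e * (mfps_exp d - (1 + d)) + (e - 1) * d = d"
        using eq by (simp add: algebra_simps)
      moreover have "ord_ge (Suc n) (e * (mfps_exp d - (1 + d)))"
        by (rule ord_ge_mult_left, rule ord_ge_mono[OF mfps_exp_approx_linear[OF d0 Suc.IH]])
          (simp add: Suc)
      moreover have "ord_ge (Suc n) ((e - 1) * d)"
        by (rule ord_ge_mult[OF _ Suc.IH, of "Suc 0"])
          (auto simp: ord_ge_1 e_def mfps_exp_coeff_0 assms(2-4) mfps_coeff_one)
      ultimately show ?thesis using ord_ge_add by metis
    qed
  qed auto
  moreover have "T - T' = mfps_const (1 / g) * d"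
    using assms(1) by (simp add: d_def mult.assoc[symmetric] mfps_const_mult[symmetric])
  ultimately show "ord_ge n (T - T')" by (simp add: ord_ge_mult_left)
qed

section \<open>Derivations\<close>

text \<open>Any additive weight of exponents gives a derivation that is diagonal on monomials. With
  the exponent of one variable as weight it is that variable times the partial derivative; with the
  number of labels as weight it is the tool for the exponential formula.\<close>

definition euler :: "(('x \<Rightarrow>\<^sub>0 nat) \<Rightarrow> nat) \<Rightarrow> ('x, 'a::comm_ring_1) mfps \<Rightarrow> ('x, 'a) mfps" where
  "euler l f = Abs_mfps (\<lambda>m. of_nat (l m) * mfps_coeff f m)"

lemma mfps_coeff_euler [simp]: "mfps_coeff (euler l f) m = of_nat (l m) * mfps_coeff f m"
  by (simp add: euler_def)

lemma euler_mult:
  assumes "\<And>a b. l (a + b) = l a + l b"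
  shows "euler l (f * g) = euler l f * g + f * euler l g"
proof (rule mfps_eqI)
  fix m
  show "mfps_coeff (euler l (f * g)) m = mfps_coeff (euler l f * g + f * euler l g) m"
    unfolding mfps_coeff_simps mfps_coeff_euler mfps_coeff_mult sum_distrib_left sum.distrib[symmetric]
    by (rule sum.cong) (auto simp: assms algebra_simps)
qed

lemma euler_power:
  assumes "\<And>a b. l (a + b) = l a + l b"
  shows "euler l (f ^ Suc q) = of_nat (Suc q) * (euler l f * f ^ q)"
proof (induction q)
  case (Suc q)
  have "euler l (f ^ Suc (Suc q)) = euler l f * f ^ Suc q + f * euler l (f ^ Suc q)"
    by (subst power_Suc) (rule euler_mult[OF assms])
  then show ?case unfolding Suc by (simp add: algebra_simps)
qed simp

lemma euler_exp:
  fixes f :: "('x, 'a::field_char_0) mfps"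
  assumes l: "\<And>a b. l (a + b) = l a + l b" and f: "mfps_coeff f 0 = 0"
  shows "euler l (mfps_exp f) = euler l f * mfps_exp f"
proof (rule mfps_eqI_ord)
  fix n
  let ?e = "\<lambda>n. \<Sum>q<n. mfps_const (1 / fact q) * f ^ q"
  have ap: "ord_ge n (mfps_exp f - ?e n)" for n
    unfolding mfps_exp_eq by (rule exp_sum_approx) (rule ord_ge_power1[OF f])
  \<comment> \<open>Differentiation shortens a truncated exponential by one term, hence length
    \<open>Suc n\<close> on the left and \<open>n\<close> on the right.\<close>
  have "euler l (?e (Suc n)) = euler l f * ?e n"
  proof -
    have "euler l (?e (Suc n)) = (\<Sum>q<Suc n. mfps_const (1 / fact q) * euler l (f ^ q))"
      by (rule mfps_eqI) (simp add: sum_distrib_left distrib_left)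
    also have "\<dots> = (\<Sum>q<n. mfps_const (1 / fact (Suc q)) * euler l (f ^ Suc q))"
    proof -
      have "l 0 = 0" using l[of 0 0] by simp
      then have "euler l (1 :: ('x, 'a) mfps) = 0" by (intro mfps_eqI) (simp add: mfps_coeff_one)
      then show ?thesis by (simp add: sum.lessThan_Suc_shift del: sum.lessThan_Suc)
    qed
    also have "\<dots> = (\<Sum>q<n. euler l f * (mfps_const (1 / fact q) * f ^ q))"
    proof (rule sum.cong)
      fix q
      have "mfps_const (1 / fact (Suc q)) * of_nat (Suc q) = (mfps_const (1 / fact q) :: ('x, 'a) mfps)"
        by (simp add: mfps_const_of_nat[symmetric] mfps_const_mult[symmetric] field_simps
            del: of_nat_Suc)
      then show "mfps_const (1 / fact (Suc q)) * euler l (f ^ Suc q) = euler l f * (mfps_const (1 / fact q) * f ^ q)"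
        unfolding euler_power[OF l] mult.assoc[symmetric] by (simp add: mult_ac)
    qed auto
    finally show ?thesis by (simp add: sum_distrib_left)
  qed
  moreover have "ord_ge n (euler l (mfps_exp f) - euler l (?e (Suc n)))"
    using ap[of "Suc n"] by (auto simp: ord_ge_def right_diff_distrib[symmetric])
  moreover have "ord_ge n (euler l f * ?e n - euler l f * mfps_exp f)"
    using ord_ge_mult_left[OF ap, of n "- euler l f"] by (simp add: algebra_simps)
  ultimately show "ord_ge n (euler l (mfps_exp f) - euler l f * mfps_exp f)"
    using ord_ge_add by fastforce
qed

section \<open>Partial derivatives as derivations\<close>

lemma mfps_coeff_deriv: "mfps_coeff (mfps_deriv x f) m =
    of_nat (Poly_Mapping.lookup m x + 1) * mfps_coeff f (m + Poly_Mapping.single x 1)"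
  by (simp add: mfps_deriv_def)

text \<open>Multiplication by the variable makes the partial derivative diagonal. Since the variable
  can be cancelled, the product rule for derivatives is inherited from the Euler operator, without
  any reindexing of convolutions.\<close>

lemma var_mult_deriv:
  fixes f :: "('x, 'a::comm_ring_1) mfps"
  shows "mfps_var x * mfps_deriv x f = euler (\<lambda>m. Poly_Mapping.lookup m x) f"
proof (rule mfps_eqI)
  fix m
  show "mfps_coeff (mfps_var x * mfps_deriv x f) m = mfps_coeff (euler (\<lambda>m. Poly_Mapping.lookup m x) f) m"
  proof (cases "\<exists>m'. m = Poly_Mapping.single x 1 + m'")
    case True
    then obtain m' where m: "m = Poly_Mapping.single x 1 + m'" by blast
    show ?thesis unfolding m
      unfolding mfps_var_eq_monom mfps_coeff_monom_mult mfps_coeff_euler mfps_coeff_deriv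
      by (simp add: lookup_add add.commute)
  next
    case False
    have "Poly_Mapping.lookup m x = 0"
    proof (rule ccontr)
      assume "Poly_Mapping.lookup m x \<noteq> 0"
      then have "m = Poly_Mapping.single x 1 + (m - Poly_Mapping.single x 1)"
        by (auto simp: poly_mapping_eq_iff fun_eq_iff lookup_add lookup_minus lookup_single when_def)
      with False show False by blast
    qed
    with False show ?thesis by (simp add: mfps_var_eq_monom mfps_coeff_monom_mult_0)
  qed
qed

lemma var_mult_cancel:
  fixes f :: "('x, 'a::comm_ring_1) mfps"
  assumes "mfps_var x * f = mfps_var x * g" shows "f = g"
  by (rule mfps_eqI)
    (metis assms mfps_coeff_monom_mult mfps_var_eq_monom mult_1)

lemma mfps_deriv_add: "mfps_deriv x (f + g) = mfps_deriv x f + mfps_deriv x (g :: ('x, 'a::comm_ring_1) mfps)"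
  by (rule mfps_eqI) (simp add: mfps_coeff_deriv algebra_simps)

lemma mfps_deriv_mult:
  fixes f :: "('x, 'a::comm_ring_1) mfps"
  shows "mfps_deriv x (f * g) = mfps_deriv x f * g + f * mfps_deriv x g"
proof (rule var_mult_cancel[of x])
  have "mfps_var x * mfps_deriv x (f * g) =
      (mfps_var x * mfps_deriv x f) * g + f * (mfps_var x * mfps_deriv x g)"
    unfolding var_mult_deriv by (rule euler_mult) (simp add: lookup_add)
  then show "mfps_var x * mfps_deriv x (f * g) = mfps_var x * (mfps_deriv x f * g + f * mfps_deriv x g)"
    by (simp add: algebra_simps)
qed

lemma mfps_deriv_var: "mfps_deriv x (mfps_var y :: ('x, 'a::comm_ring_1) mfps) = (if x = y then 1 else 0)"
proof (rule mfps_eqI)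
  fix m
  have "m + Poly_Mapping.single x (Suc 0) = Poly_Mapping.single y (Suc 0) \<longleftrightarrow> x = y \<and> m = 0"
  proof
    assume *: "m + Poly_Mapping.single x (Suc 0) = Poly_Mapping.single y (Suc 0)"
    have "x = y"
    proof (rule ccontr)
      assume "x \<noteq> y"
      with arg_cong[OF *, of "\<lambda>p. Poly_Mapping.lookup p x"] show False
        by (simp add: lookup_add lookup_single)
    qed
    with * show "x = y \<and> m = 0" by simp
  qed simp
  then show "mfps_coeff (mfps_deriv x (mfps_var y :: ('x, 'a) mfps)) m = mfps_coeff (if x = y then 1 else 0) m"
    by (simp add: mfps_coeff_deriv mfps_var_eq_monom mfps_coeff_one)
qed

text \<open>The last clause is continuity: at most one order is lost. Hence multiplying
  \<open>(d ^^ q) f\<close> by \<open>l ^ q\<close>, with \<open>l\<close> free of constant term,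
  never ends below the order of \<open>f\<close>, and identities pass from truncations to infinite
  series.\<close>

definition is_derivation :: "(('x, 'a::comm_ring_1) mfps \<Rightarrow> ('x, 'a) mfps) \<Rightarrow> bool" where
  "is_derivation d \<longleftrightarrow> (\<forall>f g. d (f + g) = d f + d g) \<and> (\<forall>f g. d (f * g) = d f * g + f * d g) \<and>
     (\<forall>c. d (mfps_const c) = 0) \<and> (\<forall>k f. ord_ge k f \<longrightarrow> ord_ge (k - 1) (d f))"

lemma is_derivation_mfps_deriv: "is_derivation (mfps_deriv x :: ('x, 'a::comm_ring_1) mfps \<Rightarrow> _)"
proof -
  have "mfps_deriv x (mfps_const c :: ('x, 'a) mfps) = 0" for c
  proof (rule mfps_eqI)
    fix m
    have "m + Poly_Mapping.single x (Suc 0) \<noteq> 0"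
      by (auto simp: poly_mapping_eq_iff fun_eq_iff lookup_add intro!: exI[of _ x])
    then show "mfps_coeff (mfps_deriv x (mfps_const c :: ('x, 'a) mfps)) m = mfps_coeff 0 m"
      by (simp add: mfps_coeff_deriv mfps_coeff_const)
  qed
  moreover have "ord_ge (k - 1) (mfps_deriv x f)" if "ord_ge k f" for k and f :: "('x, 'a) mfps"
    using that by (auto simp: ord_ge_def mfps_coeff_deriv mdeg_add)
  ultimately show ?thesis by (simp add: is_derivation_def mfps_deriv_add mfps_deriv_mult)
qed

lemma is_derivation_sum:
  assumes "\<And>i. i \<in> I \<Longrightarrow> is_derivation (d i)"
  shows "is_derivation (\<lambda>f. \<Sum>i\<in>I. d i f)"
  using assms unfolding is_derivation_def
  by (auto simp: sum.distrib sum_distrib_left sum_distrib_right intro!: ord_ge_sum)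

section \<open>Iterates of a derivation and binomial expansions\<close>

lemma additive_sum:
  fixes d :: "'a::comm_ring_1 \<Rightarrow> 'a"
  assumes "\<And>f g. d (f + g) = d f + d g"
  shows "d (sum f A) = (\<Sum>x\<in>A. d (f x))"
proof -
  have "d 0 = 0" using assms[of 0 0] by simp
  then show ?thesis by (induction A rule: infinite_finite_induct) (auto simp: assms)
qed

text \<open>Pascal's rule for an operation that raises one of two indices. The Leibniz formula and
  the expansion of \<open>s + d\<close> are both instances.\<close>

lemma binomial_conv_step:
  fixes u :: "nat \<Rightarrow> nat \<Rightarrow> 'a::comm_ring_1"
  shows "(\<Sum>i\<le>q. of_nat (q choose i) * (u (Suc i) (q - i) + u i (Suc (q - i)))) =
    (\<Sum>i\<le>Suc q. of_nat (Suc q choose i) * u i (Suc q - i))"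
proof -
  have A: "(\<Sum>i\<le>q. of_nat (q choose i) * u i (Suc (q - i))) =
      u 0 (Suc q) + (\<Sum>i\<le>q. of_nat (q choose Suc i) * u (Suc i) (q - i))"
  proof -
    have "(\<Sum>i\<le>q. of_nat (q choose i) * u i (Suc (q - i))) =
        (\<Sum>i\<le>Suc q. of_nat (q choose i) * u i (Suc q - i))"
      by (simp add: Suc_diff_le binomial_eq_0)
    also have "\<dots> = u 0 (Suc q) + (\<Sum>i\<le>q. of_nat (q choose Suc i) * u (Suc i) (q - i))"
      unfolding sum.atMost_Suc_shift by simp
    finally show ?thesis .
  qed
  show ?thesis
    by (subst sum.atMost_Suc_shift) (simp add: distrib_left sum.distrib A algebra_simps)
qed

lemma leibniz_iter:
  fixes d :: "'a::comm_ring_1 \<Rightarrow> 'a"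
  assumes add: "\<And>f g. d (f + g) = d f + d g" and mult: "\<And>f g. d (f * g) = d f * g + f * d g"
  shows "(d ^^ q) (f * g) = (\<Sum>i\<le>q. of_nat (q choose i) * ((d ^^ i) f * (d ^^ (q - i)) g))"
proof (induction q)
  case (Suc q)
  have d0: "d 0 = 0" using add[of 0 0] by simp
  have d1: "d 1 = 0" using mult[of 1 1] by simp
  have "d (of_nat n) = 0" for n by (induction n) (auto simp: d0 d1 add)
  then have "(d ^^ Suc q) (f * g) = (\<Sum>i\<le>q. of_nat (q choose i) *
      ((d ^^ Suc i) f * (d ^^ (q - i)) g + (d ^^ i) f * (d ^^ Suc (q - i)) g))"
    by (simp add: Suc additive_sum[of d, OF add] mult)
  also have "\<dots> = (\<Sum>i\<le>Suc q. of_nat (Suc q choose i) * ((d ^^ i) f * (d ^^ (Suc q - i)) g))"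
    by (rule binomial_conv_step)
  finally show ?case .
qed simp

text \<open>Multiplication by \<open>s\<close> commutes with \<open>d\<close> because
  \<open>d s = 0\<close>, so their sum obeys the binomial theorem.\<close>

lemma shifted_derivation_iter:
  fixes d :: "'a::comm_ring_1 \<Rightarrow> 'a"
  assumes add: "\<And>f g. d (f + g) = d f + d g" and mult: "\<And>f g. d (f * g) = d f * g + f * d g"
    and "d s = 0"
  shows "((\<lambda>f. s * f + d f) ^^ q) f = (\<Sum>i\<le>q. of_nat (q choose i) * (s ^ i * (d ^^ (q - i)) f))"
proof (induction q)
  case (Suc q)
  have d0: "d 0 = 0" using add[of 0 0] by simp
  have d1: "d 1 = 0" using mult[of 1 1] by simp
  have dn: "d (of_nat n) = 0" for n by (induction n) (auto simp: d0 d1 add)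
  have ds: "d (s ^ i) = 0" for i by (induction i) (auto simp: d1 mult assms(3))
  have "((\<lambda>f. s * f + d f) ^^ Suc q) f = (\<Sum>i\<le>q. of_nat (q choose i) *
      (s ^ Suc i * (d ^^ (q - i)) f + s ^ i * (d ^^ Suc (q - i)) f))"
    unfolding funpow.simps o_apply Suc additive_sum[of d, OF add]
    by (simp add: mult dn ds sum_distrib_left sum.distrib[symmetric] algebra_simps)
  also have "\<dots> = (\<Sum>i\<le>Suc q. of_nat (Suc q choose i) * (s ^ i * (d ^^ (Suc q - i)) f))"
    by (rule binomial_conv_step)
  finally show ?case .
qed simp

text \<open>The exponential of the derivation \<open>l d\<close> is the substitution homomorphism in Taylor's formula.\<close>

locale taylor_shift =
  fixes d :: "('x, 'a::field_char_0) mfps \<Rightarrow> ('x, 'a) mfps" and l :: "('x, 'a) mfps"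
  assumes deriv: "is_derivation d" and l0: "mfps_coeff l 0 = 0" and dl: "d l = 0"
begin

lemma d_add: "d (f + g) = d f + d g" and d_mult: "d (f * g) = d f * g + f * d g"
  and d_const: "d (mfps_const c) = 0" and d_ord: "ord_ge k f \<Longrightarrow> ord_ge (k - 1) (d f)"
  using deriv by (auto simp: is_derivation_def)

text \<open>Because \<open>d l = 0\<close>, the iterates of \<open>\<lambda>f. l * d f\<close> are
  \<open>\<lambda>f. l ^ q * (d ^^ q) f\<close>: this is the Taylor series with increment
  \<open>l\<close>.\<close>

definition shift :: "('x, 'a) mfps \<Rightarrow> ('x, 'a) mfps" where
  "shift f = exp_sum (\<lambda>q. l ^ q * (d ^^ q) f)"

lemma shift_ord: "ord_ge q (l ^ q * (d ^^ q) f)"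
  using ord_ge_mult_left[OF ord_ge_power1[OF l0], of q "(d ^^ q) f"] by (simp add: mult.commute)

lemma d_iter_add: "(d ^^ q) (f + g) = (d ^^ q) f + (d ^^ q) g"
  by (induction q) (auto simp: d_add)

lemma d_iter_ord: "ord_ge k f \<Longrightarrow> ord_ge (k - q) ((d ^^ q) f)"
proof (induction q)
  case (Suc q)
  then show ?case using d_ord[of "k - q" "(d ^^ q) f"] by simp
qed simp

lemma d_0: "d 0 = 0" using d_add[of 0 0] by simp

lemma d_iter_0: "d f = 0 \<Longrightarrow> 0 < q \<Longrightarrow> (d ^^ q) f = 0"
  by (cases q) (auto simp: funpow_Suc_right d_0 simp del: funpow.simps, induct_tac nat, auto simp: d_0)

lemma shift_add: "shift (f + g) = shift f + shift g"
  unfolding shift_def d_iter_add distrib_left by (rule exp_sum_add[OF shift_ord shift_ord])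

lemma shift_fixed: "d f = 0 \<Longrightarrow> shift f = f"
  unfolding shift_def by (subst exp_sum_only_0) (auto simp: d_iter_0)

lemma shift_diff: "shift (f - g) = shift f - shift g"
  using shift_add[of "f - g" g] by simp

lemma shift_sum: "shift (sum f A) = (\<Sum>i\<in>A. shift (f i))"
  using shift_add by (rule additive_sum)

lemma shift_const: "shift (mfps_const c) = mfps_const c"
  by (rule shift_fixed[OF d_const])

lemma shift_1: "shift 1 = 1"
  using shift_const[of 1] by simp

text \<open>The Leibniz formula for \<open>d ^^ q\<close> is precisely the binomial convolution that
  arises when exponential sums are multiplied.\<close>

lemma shift_mult: "shift (f * g) = shift f * shift g"
proof -
  have "l ^ q * (d ^^ q) (f * g) = (\<Sum>i\<le>q. of_nat (q choose i) *
      ((l ^ i * (d ^^ i) f) * (l ^ (q - i) * (d ^^ (q - i)) g)))" for q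
  proof -
    have "l ^ q = l ^ i * l ^ (q - i)" if "i \<le> q" for i
      using that by (simp add: power_add[symmetric])
    then show ?thesis
      unfolding leibniz_iter[OF d_add d_mult] sum_distrib_left
      by (intro sum.cong refl) (simp add: mult_ac)
  qed
  then show ?thesis unfolding shift_def by (simp add: exp_sum_mult[OF shift_ord shift_ord])
qed

lemma shift_power: "shift (f ^ n) = shift f ^ n"
  by (induction n) (auto simp: shift_1 shift_mult)

text \<open>The factor \<open>l ^ q\<close> restores the at most \<open>q\<close> orders that
  \<open>d ^^ q\<close> loses.\<close>

lemma shift_ord_ge: "ord_ge k f \<Longrightarrow> ord_ge k (shift f)"
  unfolding shift_def
  by (rule ord_ge_exp_sum[OF shift_ord], rule ord_ge_mult[OF ord_ge_power1[OF l0] d_iter_ord]) auto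

lemma shift_coeff_0: "mfps_coeff f 0 = 0 \<Longrightarrow> mfps_coeff (shift f) 0 = 0"
  using shift_ord_ge[of "Suc 0" f] by (simp add: ord_ge_1)

text \<open>A continuous ring homomorphism commutes with the exponential: it does so on truncations,
  and \<open>shift_ord_ge\<close> controls the remainders.\<close>

lemma shift_exp:
  assumes "mfps_coeff f 0 = 0"
  shows "shift (mfps_exp f) = mfps_exp (shift f)"
proof (rule mfps_eqI_ord)
  fix n
  let ?e = "\<lambda>f. \<Sum>q<n. mfps_const (1 / fact q) * f ^ q"
  have ap: "ord_ge n (mfps_exp f - ?e f)" if "mfps_coeff f 0 = 0" for f :: "('x, 'a) mfps"
    unfolding mfps_exp_eq by (rule exp_sum_approx) (rule ord_ge_power1[OF that])
  have "shift (?e f) = ?e (shift f)"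
    by (simp add: shift_sum shift_mult shift_const shift_power)
  moreover have "ord_ge n (shift (mfps_exp f) - shift (?e f))"
    using shift_ord_ge[OF ap[OF assms]] by (simp add: shift_diff)
  moreover have "ord_ge n (?e (shift f) - mfps_exp (shift f))"
    using ap[OF shift_coeff_0[OF assms]] by (simp add: ord_ge_def)
  ultimately show "ord_ge n (shift (mfps_exp f) - mfps_exp (shift f))"
    using ord_ge_add by fastforce
qed

text \<open>The Taylor series stops after the linear term. For a variable \<open>t_K\<close> this
  makes the substitution explicit.\<close>

lemma shift_var:
  assumes "d f = 1" shows "shift f = f + l"
proof -
  have "(d ^^ q) f = 0" if "q \<ge> 2" for q
  proof -
    obtain r where "q = 2 + r" using le_Suc_ex[OF \<open>q \<ge> 2\<close>] by blast
    then have q: "q = Suc (Suc r)" by simp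
    have "d 1 = 0" using d_const[of 1] by (simp only: mfps_const_1)
    then have "(d ^^ Suc r) (d f) = 0" unfolding assms by (rule d_iter_0) simp
    then show ?thesis unfolding q by (subst funpow_Suc_right) (simp only: o_apply)
  qed
  then show ?thesis
    unfolding shift_def by (subst exp_sum_affine) (simp_all add: assms l0 ord_ge_1)
qed

text \<open>The exponential of a sum of commuting operators factors into the multiplication by
  \<open>mfps_exp (s * l)\<close> and the substitution. Through this identity \<open>exp_op\<close>
  becomes pure algebra.\<close>

lemma exp_shifted_derivation:
  assumes ds: "d s = 0"
  shows "exp_sum (\<lambda>q. l ^ q * ((\<lambda>f. s * f + d f) ^^ q) f) = mfps_exp (s * l) * shift f"
proof -
  have "l ^ q * ((\<lambda>f. s * f + d f) ^^ q) f = (\<Sum>i\<le>q. of_nat (q choose i) *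
      ((s * l) ^ i * (l ^ (q - i) * (d ^^ (q - i)) f)))" for q
  proof -
    have "l ^ q = l ^ i * l ^ (q - i)" if "i \<le> q" for i
      using that by (simp add: power_add[symmetric])
    then show ?thesis
      unfolding shifted_derivation_iter[OF d_add d_mult ds] sum_distrib_left
      by (intro sum.cong refl) (simp add: power_mult_distrib mult_ac)
  qed
  then show ?thesis unfolding shift_def mfps_exp_eq
    by (subst exp_sum_mult[OF _ shift_ord]) (auto intro: ord_ge_power1 simp: l0)
qed

end

section \<open>The exponential formula\<close>

definition num :: "('x \<Rightarrow> nat set) \<Rightarrow> ('x \<Rightarrow> 'w) \<Rightarrow> 'x set \<Rightarrow> nat set \<Rightarrow> 'w \<Rightarrow> nat" where
  "num supp wt X M m = card {x \<in> X. supp x = M \<and> wt x = m}"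

text \<open>A weak form of a combinatorial species: of transport along bijections only its
  consequence for counting is kept, namely that the number of structures of given weight depends on
  the size of the support alone. The map \<open>l\<close> reads the number of labels off the weight,
  so the factorial in \<open>egf\<close> is determined by the monomial and no further variable is
  needed.\<close>

definition labelled ::
  "('w \<Rightarrow> nat) \<Rightarrow> ('x \<Rightarrow> nat set) \<Rightarrow> ('x \<Rightarrow> 'w) \<Rightarrow> 'x set \<Rightarrow> bool" where
  "labelled l supp wt X \<longleftrightarrow> (\<forall>x\<in>X. finite (supp x) \<and> l (wt x) = card (supp x)) \<and>
     (\<forall>M. finite M \<longrightarrow> finite {x \<in> X. supp x = M}) \<and>
     (\<forall>M M' m. finite M \<longrightarrow> finite M' \<longrightarrow> card M = card M' \<longrightarrow> num supp wt X M m = num supp wt X M' m)"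

definition egf :: "(('v \<Rightarrow>\<^sub>0 nat) \<Rightarrow> nat) \<Rightarrow> ('x \<Rightarrow> nat set) \<Rightarrow> ('x \<Rightarrow> ('v \<Rightarrow>\<^sub>0 nat)) \<Rightarrow> 'x set \<Rightarrow>
    ('v, 'a::field_char_0) mfps" where
  "egf l supp wt X = Abs_mfps (\<lambda>m. of_nat (num supp wt X {1..l m} m) / fact (l m))"

definition configs :: "('x \<Rightarrow> nat set) \<Rightarrow> 'x set \<Rightarrow> 'x set set" where
  "configs supp X = {F. F \<subseteq> X \<and> finite F \<and> disjoint_family_on supp F}"

definition csupp :: "('x \<Rightarrow> nat set) \<Rightarrow> 'x set \<Rightarrow> nat set" where
  "csupp supp F = \<Union>(supp ` F)"

text \<open>Modelled on the children of a vertex: there \<open>X\<close> consists of all pairs of a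
  coset and a subtree, and \<open>X0\<close> of the pairs with the trivial coset, which is
  prescribed for the subtree containing the smallest leaf.\<close>

definition rooted :: "('x \<Rightarrow> nat set) \<Rightarrow> 'x set \<Rightarrow> 'x set \<Rightarrow> 'x set set" where
  "rooted supp X0 X = {F \<in> configs supp X. \<exists>x\<in>F. x \<in> X0 \<and> Min (csupp supp F) \<in> supp x}"

section \<open>Counting structures by support and weight\<close>

lemma mfps_coeff_egf:
  "mfps_coeff (egf l supp wt X) m = of_nat (num supp wt X {1..l m} m) / fact (l m)"
  by (simp add: egf_def)

lemma labelledI:
  assumes "\<And>x. x \<in> X \<Longrightarrow> finite (supp x)" "\<And>x. x \<in> X \<Longrightarrow> l (wt x) = card (supp x)"
    and "\<And>M. finite M \<Longrightarrow> finite {x \<in> X. supp x = M}"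
    and "\<And>M M' m. finite M \<Longrightarrow> finite M' \<Longrightarrow> card M = card M' \<Longrightarrow> num supp wt X M m = num supp wt X M' m"
  shows "labelled l supp wt X"
  unfolding labelled_def using assms by blast

lemma labelled_supp: "labelled l supp wt X \<Longrightarrow> x \<in> X \<Longrightarrow> finite (supp x)"
  and labelled_wt: "labelled l supp wt X \<Longrightarrow> x \<in> X \<Longrightarrow> l (wt x) = card (supp x)"
  and labelled_fin: "labelled l supp wt X \<Longrightarrow> finite M \<Longrightarrow> finite {x \<in> X. supp x = M}"
  and labelled_card: "labelled l supp wt X \<Longrightarrow> finite M \<Longrightarrow> finite M' \<Longrightarrow> card M = card M' \<Longrightarrow>
    num supp wt X M m = num supp wt X M' m"
  unfolding labelled_def by blast+

lemma labelled_finite: "labelled l supp wt X \<Longrightarrow> finite M \<Longrightarrow> finite {x \<in> X. supp x = M \<and> P x}"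
  by (rule finite_subset[OF _ labelled_fin]) auto

lemma labelled_num:
  assumes "labelled l supp wt X" "finite M"
  shows "num supp wt X M m = (if card M = l m then num supp wt X {1..l m} m else 0)"
proof (cases "card M = l m")
  case True
  then have "card M = card {1..l m}" by simp
  then have "num supp wt X M m = num supp wt X {1..l m} m"
    by (intro labelled_card[OF assms]) auto
  then show ?thesis using True by simp
next
  case False
  then have "{x \<in> X. supp x = M \<and> wt x = m} = {}" using labelled_wt[OF assms(1)] by auto
  then show ?thesis using False unfolding num_def by (simp only: card.empty if_False)
qed

lemma num_Un:
  assumes "labelled l supp wt X" "labelled l supp wt Y" "X \<inter> Y = {}" "finite M"
  shows "num supp wt (X \<union> Y) M m = num supp wt X M m + num supp wt Y M m"
proof -
  have "{x \<in> X \<union> Y. supp x = M \<and> wt x = m} =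
      {x \<in> X. supp x = M \<and> wt x = m} \<union> {x \<in> Y. supp x = M \<and> wt x = m}" by auto
  then show ?thesis unfolding num_def
    by (simp, subst card_Un_disjoint) (use assms in \<open>auto intro: labelled_finite\<close>)
qed

lemma labelled_Un:
  assumes "labelled l supp wt X" "labelled l supp wt Y" "X \<inter> Y = {}"
  shows "labelled l supp wt (X \<union> Y)"
proof (rule labelledI)
  fix M :: "nat set" assume M: "finite M"
  have "{x \<in> X \<union> Y. supp x = M} = {x \<in> X. supp x = M} \<union> {x \<in> Y. supp x = M}" by auto
  with labelled_fin[OF assms(1) M] labelled_fin[OF assms(2) M]
  show "finite {x \<in> X \<union> Y. supp x = M}" by simp
next
  fix M M' :: "nat set" and m assume M: "finite M" "finite M'" "card M = card M'"
  show "num supp wt (X \<union> Y) M m = num supp wt (X \<union> Y) M' m"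
    unfolding num_Un[OF assms M(1)] num_Un[OF assms M(2)]
      labelled_card[OF assms(1) M] labelled_card[OF assms(2) M] ..
qed (use assms in \<open>auto dest: labelled_supp labelled_wt\<close>)

lemma egf_Un:
  assumes "labelled l supp wt X" "labelled l supp wt Y" "X \<inter> Y = {}"
  shows "egf l supp wt (X \<union> Y) = egf l supp wt X + egf l supp wt Y"
  by (rule mfps_eqI) (simp add: mfps_coeff_egf num_Un[OF assms] add_divide_distrib)

lemma labelled_empty: "labelled l supp wt {}"
  by (simp add: labelled_def num_def)

lemma egf_empty: "egf l supp wt {} = 0"
  by (rule mfps_eqI) (simp add: mfps_coeff_egf num_def)

lemma labelled_UN:
  assumes "finite I" "\<And>i. i \<in> I \<Longrightarrow> labelled l supp wt (X i)" "disjoint_family_on X I"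
  shows "labelled l supp wt (\<Union>i\<in>I. X i)"
  using assms
proof (induction I rule: finite_induct)
  case (insert i I)
  have "X i \<inter> (\<Union>i\<in>I. X i) = {}"
    using insert.hyps insert.prems(2) by (fastforce simp: disjoint_family_on_def)
  moreover have "disjoint_family_on X I" using insert.prems(2) by (simp add: disjoint_family_on_def)
  ultimately show ?case unfolding UN_insert by (intro labelled_Un insert.IH insert.prems(1)) simp_all
qed (simp add: labelled_empty)

lemma egf_UN:
  assumes "finite I" "\<And>i. i \<in> I \<Longrightarrow> labelled l supp wt (X i)" "disjoint_family_on X I"
  shows "egf l supp wt (\<Union>i\<in>I. X i) = (\<Sum>i\<in>I. egf l supp wt (X i))"
  using assms
proof (induction I rule: finite_induct)
  case (insert i I)
  have 1: "X i \<inter> (\<Union>i\<in>I. X i) = {}"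
    using insert.hyps insert.prems(2) by (fastforce simp: disjoint_family_on_def)
  have 2: "disjoint_family_on X I" using insert.prems(2) by (simp add: disjoint_family_on_def)
  have 3: "labelled l supp wt (X i)" by (rule insert.prems(1)) simp
  have 4: "labelled l supp wt (\<Union>i\<in>I. X i)"
    by (rule labelled_UN[OF insert.hyps(1) insert.prems(1) 2]) simp
  show ?case unfolding UN_insert egf_Un[OF 3 4 1] using insert.hyps insert.IH[OF insert.prems(1) 2] by simp
qed (simp add: egf_empty)

lemma num_bij:
  assumes "bij_betw h X Y" "\<And>x. x \<in> X \<Longrightarrow> supp' (h x) = supp x" "\<And>x. x \<in> X \<Longrightarrow> wt' (h x) = wt x"
  shows "num supp' wt' Y M m = num supp wt X M m"
proof -
  have Y: "Y = h ` X" and inj: "inj_on h X" using assms(1) by (simp_all add: bij_betw_def)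
  have "{x \<in> Y. supp' x = M \<and> wt' x = m} = h ` {x \<in> X. supp x = M \<and> wt x = m}"
    unfolding Y using assms(2,3) by auto
  moreover have "inj_on h {x \<in> X. supp x = M \<and> wt x = m}" by (rule inj_on_subset[OF inj]) auto
  ultimately show ?thesis unfolding num_def by (simp add: card_image)
qed

lemma egf_bij:
  assumes "bij_betw h X Y" "\<And>x. x \<in> X \<Longrightarrow> supp' (h x) = supp x" "\<And>x. x \<in> X \<Longrightarrow> wt' (h x) = wt x"
  shows "egf l supp' wt' Y = egf l supp wt X"
proof -
  have "num supp' wt' Y M m = num supp wt X M m" for M m using assms by (rule num_bij)
  then show ?thesis by (simp add: egf_def)
qed

lemma labelled_bij:
  assumes X: "labelled l supp wt X" and bij: "bij_betw h X Y"
    and supp: "\<And>x. x \<in> X \<Longrightarrow> supp' (h x) = supp x" and wt: "\<And>x. x \<in> X \<Longrightarrow> wt' (h x) = wt x"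
  shows "labelled l supp' wt' Y"
proof (rule labelledI)
  have Y: "Y = h ` X" using bij by (simp add: bij_betw_def)
  fix y assume "y \<in> Y"
  then obtain x where x: "x \<in> X" "y = h x" using Y by blast
  then show "finite (supp' y)" "l (wt' y) = card (supp' y)"
    using labelled_supp[OF X x(1)] labelled_wt[OF X x(1)] supp[OF x(1)] wt[OF x(1)] by simp_all
next
  fix M :: "nat set" assume M: "finite M"
  have "{y \<in> Y. supp' y = M} = h ` {x \<in> X. supp x = M}"
    using bij supp by (auto simp: bij_betw_def)
  then show "finite {y \<in> Y. supp' y = M}" using labelled_fin[OF X M] by simp
next
  fix M M' :: "nat set" and m assume M: "finite M" "finite M'" "card M = card M'"
  have n: "num supp' wt' Y M m = num supp wt X M m" for M m
    using bij supp wt by (rule num_bij)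
  show "num supp' wt' Y M m = num supp' wt' Y M' m"
    unfolding n by (rule labelled_card[OF X M])
qed

text \<open>A variable of weight \<open>0\<close> only marks the structures and does not count labels.\<close>

lemma egf_shift_weight:
  assumes l: "\<And>a b. l (a + b) = l a + l b" and "l k = 0"
  shows "egf l supp (\<lambda>x. k + wt x) X = mfps_monom 1 k * egf l supp wt X"
proof (rule mfps_eqI)
  fix m
  show "mfps_coeff (egf l supp (\<lambda>x. k + wt x) X) m = mfps_coeff (mfps_monom 1 k * egf l supp wt X) m"
  proof (cases "\<exists>m'. m = k + m'")
    case True
    then show ?thesis using assms by (auto simp: mfps_coeff_egf mfps_coeff_monom_mult num_def)
  next
    case False
    then have "{x \<in> X. supp x = {1..l m} \<and> k + wt x = m} = {}" by auto
    then have "num supp (\<lambda>x. k + wt x) X {1..l m} m = 0" by (simp only: num_def card.empty)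
    then show ?thesis using False unfolding mfps_coeff_egf by (simp add: mfps_coeff_monom_mult_0)
  qed
qed

lemma labelled_shift_weight:
  assumes l: "\<And>a b. l (a + b) = l a + l (b :: 'v \<Rightarrow>\<^sub>0 nat)" and "l k = 0" and X: "labelled l supp wt X"
  shows "labelled l supp (\<lambda>x. k + wt x) X"
proof (rule labelledI)
  fix M M' :: "nat set" and m assume M: "finite M" "finite M'" "card M = card M'"
  show "num supp (\<lambda>x. k + wt x) X M m = num supp (\<lambda>x. k + wt x) X M' m"
  proof (cases "\<exists>m'. m = k + m'")
    case True
    then obtain m' where m: "m = k + m'" by blast
    have "num supp (\<lambda>x. k + wt x) X M m = num supp wt X M m'" for M by (simp add: num_def m)
    then show ?thesis using labelled_card[OF X M] by simp
  next
    case False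
    then have "{x \<in> X. supp x = M \<and> k + wt x = m} = {}" for M by auto
    then show ?thesis unfolding num_def by (simp only: card.empty)
  qed
next
  fix x assume "x \<in> X"
  then show "l (k + wt x) = card (supp x)" using labelled_wt[OF X] by (simp add: l assms(2))
qed (rule labelled_supp[OF X] labelled_fin[OF X]; assumption)+

lemma card_subsets_containing:
  assumes "finite M" "p \<in> M" "k > 0"
  shows "card {B. B \<subseteq> M \<and> p \<in> B \<and> card B = k} = (card M - 1) choose (k - 1)"
proof -
  have "bij_betw (insert p) {B. B \<subseteq> M - {p} \<and> card B = k - 1} {B. B \<subseteq> M \<and> p \<in> B \<and> card B = k}"
  proof (rule bij_betw_byWitness[where f' = "\<lambda>B. B - {p}"])
    show "insert p ` {B. B \<subseteq> M - {p} \<and> card B = k - 1} \<subseteq> {B. B \<subseteq> M \<and> p \<in> B \<and> card B = k}"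
    proof (rule image_subsetI)
      fix B assume "B \<in> {B. B \<subseteq> M - {p} \<and> card B = k - 1}"
      then have B: "B \<subseteq> M - {p}" "card B = k - 1" by auto
      have "finite B" by (rule finite_subset[OF B(1)]) (simp add: assms)
      moreover have "p \<notin> B" using B by auto
      ultimately have "card (insert p B) = k" using assms(3) B(2) by simp
      then show "insert p B \<in> {B. B \<subseteq> M \<and> p \<in> B \<and> card B = k}"
        using B(1) assms(2) by blast
    qed
    show "(\<lambda>B. B - {p}) ` {B. B \<subseteq> M \<and> p \<in> B \<and> card B = k} \<subseteq> {B. B \<subseteq> M - {p} \<and> card B = k - 1}"
      by (auto simp: card_Diff_singleton_if)
  qed auto
  then have "card {B. B \<subseteq> M \<and> p \<in> B \<and> card B = k} = card {B. B \<subseteq> M - {p} \<and> card B = k - 1}"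
    by (rule bij_betw_same_card[symmetric])
  also have "\<dots> = (card M - 1) choose (k - 1)"
    using assms by (subst n_subsets) auto
  finally show ?thesis .
qed

text \<open>Only coefficients of \<open>u\<close> of positive \<open>l\<close>-degree enter, so each
  coefficient of \<open>E\<close> is determined by those of smaller \<open>l\<close>-degree. The
  initial data range over all exponents with \<open>l m = 0\<close>, of which there can be
  infinitely many, such as the powers of \<open>s\<close>.\<close>

lemma euler_equation_unique:
  fixes E E' u :: "('v, 'a::field_char_0) mfps"
  assumes l: "\<And>a b. l (a + b) = l a + l b"
    and u: "\<And>a. l a = 0 \<Longrightarrow> mfps_coeff u a = 0"
    and E: "euler l E = u * E" "euler l E' = u * E'"
    and 0: "\<And>m. l m = 0 \<Longrightarrow> mfps_coeff E m = mfps_coeff E' m"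
  shows "E = E'"
proof (rule mfps_eqI)
  fix m
  show "mfps_coeff E m = mfps_coeff E' m"
  proof (induction "l m" arbitrary: m rule: less_induct)
    case less
    show ?case
    proof (cases "l m = 0")
      case False
      have "mfps_coeff (u * E) m = mfps_coeff (u * E') m"
        unfolding mfps_coeff_mult
      proof (intro sum.cong refl, clarify)
        fix a b assume m: "m = a + b"
        show "mfps_coeff u a * mfps_coeff E b = mfps_coeff u a * mfps_coeff E' b"
        proof (cases "l a = 0")
          case False
          then show ?thesis using less[of b] by (simp add: m l)
        qed (simp add: u)
      qed
      then have "of_nat (l m) * mfps_coeff E m = of_nat (l m) * mfps_coeff E' m"
        unfolding E[symmetric] by simp
      then show ?thesis using False by simp
    qed (rule 0)
  qed
qed

text \<open>Nonempty supports force the series to vanish at all exponents without labels, which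
  makes its exponential meaningful, and leave the empty configuration as the only one without
  labels.\<close>

locale labelled_structures =
  fixes l :: "('v \<Rightarrow>\<^sub>0 nat) \<Rightarrow> nat" and supp :: "'x \<Rightarrow> nat set" and wt :: "'x \<Rightarrow> ('v \<Rightarrow>\<^sub>0 nat)" and X :: "'x set"
  assumes l_add: "\<And>a b. l (a + b) = l a + l b"
    and labelled: "labelled l supp wt X" and supp_nonempty: "\<And>x. x \<in> X \<Longrightarrow> supp x \<noteq> {}"
begin

lemma l_0: "l 0 = 0" using l_add[of 0 0] by simp

abbreviation "cs \<equiv> csupp supp"
abbreviation "cw \<equiv> sum wt"
abbreviation "cfg \<equiv> configs supp X"

lemma finite_supp: "x \<in> X \<Longrightarrow> finite (supp x)" using labelled by (rule labelled_supp)

lemma configs_finite_csupp: "F \<in> cfg \<Longrightarrow> finite (cs F)"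
  using finite_supp by (auto simp: configs_def csupp_def)

lemma configs_weight: "F \<in> cfg \<Longrightarrow> l (cw F) = card (cs F)"
proof -
  assume F: "F \<in> cfg"
  have "l (sum wt F') = (\<Sum>x\<in>F'. l (wt x))" for F'
    by (induction F' rule: infinite_finite_induct) (auto simp: l_add l_0)
  moreover have "card (cs F) = (\<Sum>x\<in>F. card (supp x))"
    unfolding csupp_def
    by (rule card_UN_disjoint) (use F finite_supp in \<open>auto simp: configs_def disjoint_family_on_def\<close>)
  moreover have "(\<Sum>x\<in>F. l (wt x)) = (\<Sum>x\<in>F. card (supp x))"
    by (rule sum.cong) (use F labelled_wt[OF labelled] in \<open>auto simp: configs_def\<close>)
  ultimately show ?thesis by simp
qed

lemma finite_configs:
  assumes "finite M" shows "finite {F \<in> cfg. cs F = M \<and> P F}"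
proof (rule finite_subset)
  show "{F \<in> cfg. cs F = M \<and> P F} \<subseteq> Pow (\<Union>B\<in>Pow M. {x \<in> X. supp x = B})"
    by (auto simp: configs_def csupp_def)
  show "finite (Pow (\<Union>B\<in>Pow M. {x \<in> X. supp x = B}))"
    using assms labelled_fin[OF labelled] finite_subset[OF _ assms] by auto
qed

lemma configs_csupp_empty: "F \<in> cfg \<Longrightarrow> cs F = {} \<longleftrightarrow> F = {}"
  using supp_nonempty by (auto simp: configs_def csupp_def)

text \<open>By disjointness of the supports only one member contains the smallest label. Removing it
  leaves an arbitrary configuration on \<open>M - B\<close>, where \<open>B\<close> is its
  support.\<close>

lemma num_rooted:
  assumes M: "finite M" "M \<noteq> {}" and X0: "X0 \<subseteq> X"
  shows "num cs cw (rooted supp X0 X) M m =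
    (\<Sum>(a, b) \<in> {(a, b). a + b = m}. \<Sum>B \<in> {B. B \<subseteq> M \<and> Min M \<in> B}.
       num supp wt X0 B a * num cs cw cfg (M - B) b)"
proof -
  let ?P = "\<lambda>B a. {x \<in> X0. supp x = B \<and> wt x = a}"
  let ?Q = "\<lambda>B b. {F \<in> cfg. cs F = M - B \<and> cw F = b}"
  let ?I = "{B. B \<subseteq> M \<and> Min M \<in> B}"
  let ?S = "SIGMA p:{(a, b). a + b = m}. SIGMA B:?I. ?P B (fst p) \<times> ?Q B (snd p)"
  let ?R = "{F \<in> rooted supp X0 X. cs F = M \<and> cw F = m}"
  have fP: "finite (?P B a)" if "B \<in> ?I" for B a
    by (rule finite_subset[OF _ labelled_finite[OF labelled, of B "\<lambda>x. wt x = a"]])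
      (use that M X0 finite_subset in auto)
  have fQ: "finite (?Q B b)" for B b using finite_configs M by simp
  have notin: "x \<notin> F" if "B \<in> ?I" "x \<in> ?P B a" "F \<in> ?Q B b" for x B F a b
    using that by (auto simp: csupp_def)
  have "bij_betw (\<lambda>(p, B, x, F). insert x F) ?S ?R"
    unfolding bij_betw_def
  proof
    show "inj_on (\<lambda>(p, B, x, F). insert x F) ?S"
    proof (rule inj_onI, clarsimp)
      fix x F x' F'
      assume B: "supp x \<subseteq> M" "Min M \<in> supp x" "supp x' \<subseteq> M" "Min M \<in> supp x'"
        and F: "cs F = M - supp x" "cs F' = M - supp x'"
        and eq: "insert x F = insert x' F'"
      have "x' \<notin> F" using B F by (auto simp: csupp_def)
      then have "x' = x" using eq by auto
      moreover have "x \<notin> F" "x' \<notin> F'" using B F by (auto simp: csupp_def)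
      ultimately have "F = F'" using eq by auto
      with \<open>x' = x\<close> show "wt x = wt x' \<and> cw F = cw F' \<and> supp x = supp x' \<and> x = x' \<and> F = F'" by simp
    qed
    show "(\<lambda>(p, B, x, F). insert x F) ` ?S = ?R"
    proof safe
      fix a b B x F
      assume B: "supp x \<subseteq> M" "Min M \<in> supp x" and x: "x \<in> X0" "wt x = fst (a, b)"
        and F: "F \<in> cfg" "cs F = M - supp x" "cw F = snd (a, b)" and m: "m = a + b"
      have xF: "x \<notin> F" using B x F by (auto simp: csupp_def)
      have cs: "cs (insert x F) = M" using B F by (auto simp: csupp_def)
      have "disjoint_family_on supp (insert x F)"
        using F by (auto simp: configs_def disjoint_family_on_def csupp_def)
      then have "insert x F \<in> cfg" using F X0 x by (auto simp: configs_def)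
      then show "insert x F \<in> rooted supp X0 X" using B x cs by (auto simp: rooted_def)
      show "p \<in> M" if "p \<in> cs (insert x F)" for p using that cs by simp
      show "p \<in> cs (insert x F)" if "p \<in> M" for p using that cs by simp
      show "cw (insert x F) = a + b"
        using F xF x by (subst sum.insert) (auto simp: configs_def)
    next
      fix F assume F: "F \<in> rooted supp X0 X" and M_def: "M = cs F" and m_def: "m = cw F"
      from F obtain x where x: "x \<in> F" "x \<in> X0" "Min M \<in> supp x" unfolding M_def rooted_def by auto
      have F': "F \<in> cfg" using F by (simp add: rooted_def)
      have "cs (F - {x}) = M - supp x"
        unfolding M_def using F' x by (auto simp: configs_def csupp_def disjoint_family_on_def)
      moreover have "F - {x} \<in> cfg"
        using F' by (auto simp: configs_def disjoint_family_on_def)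
      moreover have "wt x + cw (F - {x}) = m"
        unfolding m_def using F' x by (subst sum.remove[of F x]) (auto simp: configs_def)
      moreover have "supp x \<subseteq> M" using x M_def by (auto simp: csupp_def)
      ultimately have "((wt x, cw (F - {x})), supp x, x, F - {x}) \<in> ?S" using x by auto
      moreover have "F = (\<lambda>(p, B, x, F). insert x F) ((wt x, cw (F - {x})), supp x, x, F - {x})" using x by auto
      ultimately show "F \<in> (\<lambda>(p, B, x, F). insert x F) ` (SIGMA p:{(a, b). a + b = cw F}.
          SIGMA B:{B. B \<subseteq> cs F \<and> Min (cs F) \<in> B}. ?P B (fst p) \<times> {F' \<in> cfg. cs F' = cs F - B \<and> cw F' = snd p})"
        unfolding M_def m_def by (rule rev_image_eqI)
    qed
  qed
  then have "num cs cw (rooted supp X0 X) M m = card ?S"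
    unfolding num_def by (rule bij_betw_same_card[symmetric])
  also have "\<dots> = (\<Sum>p \<in> {(a, b). a + b = m}. card (SIGMA B:?I. ?P B (fst p) \<times> ?Q B (snd p)))"
    by (rule card_SigmaI) (use M fP fQ in \<open>auto simp: finite_monomial_splits intro!: finite_SigmaI\<close>)
  also have "\<dots> = (\<Sum>p \<in> {(a, b). a + b = m}. \<Sum>B\<in>?I. card (?P B (fst p) \<times> ?Q B (snd p)))"
    by (intro sum.cong refl card_SigmaI) (use M fP fQ in \<open>auto intro!: finite_SigmaI\<close>)
  finally show ?thesis by (simp add: num_def card_cartesian_product case_prod_unfold)
qed

lemma configs_eq_rooted:
  assumes "finite M" "M \<noteq> {}"
  shows "num cs cw cfg M m = num cs cw (rooted supp X X) M m"
proof -
  have "{F \<in> cfg. cs F = M \<and> cw F = m} = {F \<in> rooted supp X X. cs F = M \<and> cw F = m}"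
  proof safe
    fix F assume F: "F \<in> cfg" "M = cs F"
    have "Min (cs F) \<in> cs F" using assms F(2) by simp
    then show "F \<in> rooted supp X X" using F(1) by (auto simp: rooted_def csupp_def configs_def)
  qed (auto simp: rooted_def)
  then show ?thesis by (simp add: num_def)
qed

text \<open>Invariance of the remaining configurations is a hypothesis because the formula serves
  twice: inside the induction that establishes this invariance, where \<open>M - B\<close> is
  smaller as \<open>B\<close> is nonempty, and afterwards for all \<open>M\<close>.\<close>

lemma num_rooted_binomial:
  assumes M: "finite M" "M \<noteq> {}" and X0: "X0 \<subseteq> X" "labelled l supp wt X0"
    and inv: "\<And>B b. B \<subseteq> M \<Longrightarrow> B \<noteq> {} \<Longrightarrow> num cs cw cfg (M - B) b = num cs cw cfg {1..card M - card B} b"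
  shows "num cs cw (rooted supp X0 X) M m =
    (\<Sum>(a, b) \<in> {(a, b). a + b = m}. if l a = 0 then 0 else
       (card M - 1 choose (l a - 1)) * (num supp wt X0 {1..l a} a * num cs cw cfg {1..card M - l a} b))"
proof -
  have "(\<Sum>B \<in> {B. B \<subseteq> M \<and> Min M \<in> B}. num supp wt X0 B a * num cs cw cfg (M - B) b) =
      (if l a = 0 then 0 else
       (card M - 1 choose (l a - 1)) * (num supp wt X0 {1..l a} a * num cs cw cfg {1..card M - l a} b))"
    (is "?L = ?R") for a b
  proof -
    have fin: "finite B" if "B \<subseteq> M" for B using that M finite_subset by auto
    have "?L = (\<Sum>B \<in> {B. B \<subseteq> M \<and> Min M \<in> B \<and> card B = l a}. num supp wt X0 {1..l a} a * num cs cw cfg {1..card M - l a} b)"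
    proof (rule sum.mono_neutral_cong_right)
      show "finite {B. B \<subseteq> M \<and> Min M \<in> B}" using M by simp
      show "\<forall>B\<in>{B. B \<subseteq> M \<and> Min M \<in> B} - {B. B \<subseteq> M \<and> Min M \<in> B \<and> card B = l a}.
         num supp wt X0 B a * num cs cw cfg (M - B) b = 0"
      proof
        fix B assume B: "B \<in> {B. B \<subseteq> M \<and> Min M \<in> B} - {B. B \<subseteq> M \<and> Min M \<in> B \<and> card B = l a}"
        then have "finite B" "card B \<noteq> l a" using fin by auto
        then have "num supp wt X0 B a = 0" using labelled_num[OF X0(2) \<open>finite B\<close>, of a] by (metis (full_types))
        then show "num supp wt X0 B a * num cs cw cfg (M - B) b = 0" by simp
      qed
      fix B assume B: "B \<in> {B. B \<subseteq> M \<and> Min M \<in> B \<and> card B = l a}"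
      then have "finite B" "card B = l a" "B \<noteq> {}" "B \<subseteq> M" using fin by auto
      then have "num supp wt X0 B a = num supp wt X0 {1..l a} a"
        using labelled_num[OF X0(2) \<open>finite B\<close>, of a] by (metis (full_types))
      then show "num supp wt X0 B a * num cs cw cfg (M - B) b = num supp wt X0 {1..l a} a * num cs cw cfg {1..card M - l a} b"
        using inv[OF \<open>B \<subseteq> M\<close> \<open>B \<noteq> {}\<close>, of b] \<open>card B = l a\<close> by (simp only:)
    qed auto
    also have "\<dots> = card {B. B \<subseteq> M \<and> Min M \<in> B \<and> card B = l a} * (num supp wt X0 {1..l a} a * num cs cw cfg {1..card M - l a} b)"
      by simp
    also have "\<dots> = ?R"
    proof (cases "l a = 0")
      case True
      have "{B. B \<subseteq> M \<and> Min M \<in> B \<and> card B = l a} = {}" using True fin by fastforce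
      then show ?thesis using True by (simp only: card.empty mult_0 if_True simp_thms)
    next
      case False
      then show ?thesis using card_subsets_containing[of M "Min M" "l a"] M by simp
    qed
    finally show ?thesis .
  qed
  then show ?thesis unfolding num_rooted[OF M X0(1)] by simp
qed

text \<open>Induction on the number of labels: splitting off the member with the smallest label
  expresses the count through \<open>card M\<close> and through configurations on fewer
  labels.\<close>

lemma labelled_configs: "labelled l cs cw cfg"
proof -
  have *: "num cs cw cfg M m = num cs cw cfg {1..card M} m" if "finite M" for M m
    using that
  proof (induction "card M" arbitrary: M m rule: less_induct)
    case less
    show ?case
    proof (cases "M = {}")
      case False
      let ?M = "{1..card M}"
      have M': "finite ?M" "?M \<noteq> {}" using less.prems False card_gt_0_iff[of M] by auto
      have pos: "card M > 0" using less.prems False by (simp add: card_gt_0_iff)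
      have inv: "num cs cw cfg (M' - B) b = num cs cw cfg {1..card M - card B} b"
        if M': "finite M'" "card M' = card M" and B: "B \<subseteq> M'" "B \<noteq> {}" for M' B b
      proof -
        have fB: "finite B" using M' B finite_subset by auto
        then have c: "card (M' - B) = card M - card B" using M' B by (simp add: card_Diff_subset)
        moreover have "card (M' - B) < card M"
          unfolding c using B fB pos card_gt_0_iff[of B] by simp
        ultimately show ?thesis using less.hyps[of "M' - B" b] M'(1) by (simp only: finite_Diff)
      qed
      have "num cs cw (rooted supp X X) M m = num cs cw (rooted supp X X) ?M m"
      proof -
        have c: "card ?M = card M" by simp
        let ?S = "\<Sum>(a, b) \<in> {(a, b). a + b = m}. if l a = 0 then 0 else
          (card M - 1 choose (l a - 1)) * (num supp wt X {1..l a} a * num cs cw cfg {1..card M - l a} b)"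
        have "num cs cw (rooted supp X X) M m = ?S"
          by (rule num_rooted_binomial[OF less.prems False subset_refl labelled]) (rule inv[OF less.prems refl])
        moreover have "num cs cw (rooted supp X X) ?M m = ?S"
          by (rule num_rooted_binomial[OF M' subset_refl labelled, unfolded c]) (rule inv[OF M'(1) c])
        ultimately show ?thesis by (simp only:)
      qed
      then show ?thesis
        unfolding configs_eq_rooted[OF less.prems False] configs_eq_rooted[OF M'] .
    qed (simp only: card.empty atLeastatMost_empty_iff2 finite.emptyI, simp)
  qed
  show ?thesis
  proof (rule labelledI)
    fix M M' :: "nat set" and m assume "finite M" "finite M'" "card M = card M'"
    then show "num cs cw cfg M m = num cs cw cfg M' m"
      using *[of M m] *[of M' m] by (simp only:)
  next
    fix M :: "nat set" assume "finite M"
    from finite_configs[OF this, of "\<lambda>_. True"] show "finite {F \<in> cfg. cs F = M}" by simp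
  qed (simp_all add: configs_finite_csupp configs_weight)
qed

lemma num_rooted_card:
  assumes M: "finite M" "M \<noteq> {}" and X0: "X0 \<subseteq> X" "labelled l supp wt X0"
  shows "num cs cw (rooted supp X0 X) M m =
    (\<Sum>(a, b) \<in> {(a, b). a + b = m}. if l a = 0 then 0 else
       (card M - 1 choose (l a - 1)) * (num supp wt X0 {1..l a} a * num cs cw cfg {1..card M - l a} b))"
proof (rule num_rooted_binomial[OF assms])
  fix B b assume B: "B \<subseteq> M" "B \<noteq> {}"
  then have "card (M - B) = card {1..card M - card B}" using M by (simp add: card_Diff_subset finite_subset)
  then show "num cs cw cfg (M - B) b = num cs cw cfg {1..card M - card B} b"
    using M by (intro labelled_card[OF labelled_configs]) auto
qed

lemma labelled_rooted:
  assumes X0: "X0 \<subseteq> X" "labelled l supp wt X0"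
  shows "labelled l cs cw (rooted supp X0 X)"
proof (rule labelledI)
  fix F assume "F \<in> rooted supp X0 X"
  then have "F \<in> cfg" by (simp add: rooted_def)
  then show "finite (cs F)" "l (cw F) = card (cs F)" by (simp_all add: configs_finite_csupp configs_weight)
next
  fix M :: "nat set" assume M: "finite M"
  show "finite {x \<in> rooted supp X0 X. cs x = M}"
    by (rule finite_subset[OF _ finite_configs[OF M, of "\<lambda>_. True"]]) (auto simp: rooted_def)
next
  fix M M' :: "nat set" and m assume M: "finite M"
  assume M': "finite M'" "card M = card M'"
  show "num cs cw (rooted supp X0 X) M m = num cs cw (rooted supp X0 X) M' m"
  proof (cases "M = {}")
    case True then show ?thesis using M' by simp
  next
    case False
    then have "M' \<noteq> {}" using M M' by auto
    show ?thesis
      unfolding num_rooted_card[OF M False assms] num_rooted_card[OF M'(1) \<open>M' \<noteq> {}\<close> assms] M'(2) ..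
  qed
qed

text \<open>Splitting off the member containing the smallest label accounts for a factor \<open>n\<close> in the
  \<open>n\<close>-th coefficient, which the Euler operator provides.\<close>

lemma euler_egf_rooted:
  assumes X0: "X0 \<subseteq> X" "labelled l supp wt X0"
  shows "euler l (egf l cs cw (rooted supp X0 X)) =
    euler l (egf l supp wt X0) * (egf l cs cw cfg :: ('v, 'c::field_char_0) mfps)"
proof (rule mfps_eqI)
  fix m
  define n where "n = l m"
  show "mfps_coeff (euler l (egf l cs cw (rooted supp X0 X) :: ('v, 'c) mfps)) m = mfps_coeff (euler l (egf l supp wt X0) * egf l cs cw cfg) m"
  proof (cases "n = 0")
    case True
    have "mfps_coeff (euler l (egf l supp wt X0) * egf l cs cw cfg :: ('v, 'c) mfps) m = 0"
      unfolding mfps_coeff_mult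
      by (rule sum.neutral) (use True in \<open>auto simp: n_def l_add\<close>)
    then show ?thesis using True by (simp add: n_def)
  next
    case False
    have "mfps_coeff (euler l (egf l cs cw (rooted supp X0 X))) m =
       (\<Sum>(a, b) \<in> {(a, b). a + b = m}. (of_nat n :: 'c) / fact n * of_nat (if l a = 0 then 0 else
       (n - 1 choose (l a - 1)) * (num supp wt X0 {1..l a} a * num cs cw cfg {1..n - l a} b)))"
      using num_rooted_card[of "{1..n}" X0 m, OF _ _ X0] False unfolding card_atLeastAtMost diff_Suc_1
      by (simp add: mfps_coeff_egf n_def[symmetric] sum_distrib_left sum_divide_distrib case_prod_unfold)
    also have "\<dots> = mfps_coeff (euler l (egf l supp wt X0) * egf l cs cw cfg) m"
      unfolding mfps_coeff_mult
    proof (intro sum.cong refl, clarify)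
      fix a b assume m: "m = a + b"
      have n: "n = l a + l b" by (simp add: n_def m l_add)
      show "(of_nat n :: 'c) / fact n * of_nat (if l a = 0 then 0 else
         (n - 1 choose (l a - 1)) * (num supp wt X0 {1..l a} a * num cs cw cfg {1..n - l a} b)) =
         mfps_coeff (euler l (egf l supp wt X0)) a * mfps_coeff (egf l cs cw cfg) b"
      proof (cases "l a = 0")
        case False
        \<comment> \<open>Absorption trades the factor \<open>n\<close> and the subsets through the
          smallest label for the factor \<open>l a\<close> and all subsets of size
          \<open>l a\<close>. The former comes from the Euler operator on the left, the latter from
          the one on the right.\<close>
        have "l a * (n choose l a) = n * (n - 1 choose (l a - 1))"
          using False n binomial_absorption[of "l a - 1" "n"] by simp
        then have "of_nat n * of_nat (n - 1 choose (l a - 1)) = of_nat (l a) * of_nat (n choose l a)"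
          by (simp flip: of_nat_mult)
        also have "(of_nat (n choose l a) :: 'c) = fact n / (fact (l a) * fact (l b))"
          by (subst binomial_fact) (auto simp: n)
        finally have "of_nat n / fact n * of_nat (n - 1 choose (l a - 1)) = (of_nat (l a) / (fact (l a) * fact (l b)) :: 'c)"
          by (simp add: field_simps)
        note eq = arg_cong[OF this, of "\<lambda>x. x * of_nat (num supp wt X0 {1..l a} a) * of_nat (num cs cw cfg {1..n - l a} b)"]
        show ?thesis using False eq n by (simp add: mfps_coeff_egf mult_ac)
      qed simp
    qed
    finally show ?thesis .
  qed
qed

lemma egf_low: "l m = 0 \<Longrightarrow> mfps_coeff (egf l supp wt X) m = 0"
proof -
  have "{x \<in> X. supp x = {} \<and> wt x = m} = {}" using supp_nonempty by auto
  then have "num supp wt X {} m = 0" by (simp only: num_def card.empty)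
  then show "l m = 0 \<Longrightarrow> ?thesis" by (simp add: mfps_coeff_egf)
qed

lemma egf_configs_low: "l m = 0 \<Longrightarrow> mfps_coeff (egf l cs cw cfg) m = (if m = 0 then 1 else 0)"
proof -
  have "{} \<in> cfg" by (simp add: configs_def disjoint_family_on_def)
  then have "{F \<in> cfg. cs F = {} \<and> cw F = m} = {F. F = {} \<and> m = 0}"
    by (auto simp: configs_csupp_empty) (simp add: csupp_def)
  then have "num cs cw cfg {} m = (if m = 0 then 1 else 0)"
    unfolding num_def by (simp only:) simp
  then show "l m = 0 \<Longrightarrow> ?thesis" by (simp add: mfps_coeff_egf)
qed

lemma euler_egf_configs: "euler l (egf l cs cw cfg) = euler l (egf l supp wt X) * egf l cs cw cfg"
proof -
  have "of_nat (l m) * mfps_coeff (egf l cs cw cfg) m = of_nat (l m) * mfps_coeff (egf l cs cw (rooted supp X X)) m" for m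
  proof (cases "l m = 0")
    case False
    then show ?thesis using configs_eq_rooted[of "{1..l m}" m] by (simp add: mfps_coeff_egf)
  qed simp
  then have "euler l (egf l cs cw cfg) = euler l (egf l cs cw (rooted supp X X))"
    by (intro mfps_eqI) (simp only: mfps_coeff_euler)
  then show ?thesis by (simp only: euler_egf_rooted[OF subset_refl labelled])
qed

text \<open>Both sides solve \<open>euler l E = euler l f * E\<close> for the series
  \<open>f\<close> of the structures. Among the exponents without labels both have coefficient 1 at
  exponent 0 and vanish elsewhere, because no positive power of \<open>f\<close> reaches these
  exponents.\<close>

theorem exponential_formula:
  "egf l cs cw cfg = mfps_exp (egf l supp wt X)"
proof (rule euler_equation_unique[OF l_add])
  have 0: "mfps_coeff (egf l supp wt X) 0 = 0" by (rule egf_low[OF l_0])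
  show "euler l (mfps_exp (egf l supp wt X)) = euler l (egf l supp wt X) * mfps_exp (egf l supp wt X)"
    by (rule euler_exp[OF l_add 0])
  fix m assume m: "l m = 0"
  have pw: "mfps_coeff (egf l supp wt X ^ q) m = (if q = 0 \<and> m = 0 then 1 else 0)" for q
  proof (cases q)
    case (Suc r)
    have "mfps_coeff (egf l supp wt X * egf l supp wt X ^ r) m = 0"
      unfolding mfps_coeff_mult
    proof (rule sum.neutral, clarify)
      fix a b assume "m = a + b"
      then have "l a = 0" using m by (simp add: l_add)
      then show "mfps_coeff (egf l supp wt X) a * mfps_coeff (egf l supp wt X ^ r) b = 0" by (simp add: egf_low)
    qed
    then show ?thesis by (simp add: Suc)
  qed (simp add: mfps_coeff_one)
  have "mfps_coeff (mfps_exp (egf l supp wt X)) m = (\<Sum>q<Suc (mdeg UNIV m). mfps_coeff (egf l supp wt X ^ q) m / fact q)"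
    unfolding mfps_exp_eq by (rule mfps_coeff_exp_sum) (auto intro: ord_ge_power1 0)
  also have "\<dots> = (if m = 0 then 1 else 0)"
    unfolding pw sum.lessThan_Suc_shift by simp
  finally show "mfps_coeff (egf l cs cw cfg) m = mfps_coeff (mfps_exp (egf l supp wt X)) m"
    using egf_configs_low[OF m] by (rule trans[OF _ sym, rotated])
qed (auto simp: euler_egf_configs egf_low)

text \<open>The root is drawn from a part \<open>X0\<close> whose series is that of \<open>X\<close>
  divided by \<open>g\<close>, so \<open>g\<close> times the rooted series and the series of all
  configurations have the same image under the Euler operator. They can differ only where no label
  occurs, and there the difference is the empty configuration.\<close>

theorem rooted_formula:
  assumes X0: "X0 \<subseteq> X" "labelled l supp wt X0"
    and g: "egf l supp wt X = mfps_const (g :: 'c::field_char_0) * egf l supp wt X0"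
  shows "mfps_const g * egf l cs cw (rooted supp X0 X) = mfps_exp (egf l supp wt X) - (1 :: ('v, 'c) mfps)"
proof (rule mfps_eqI)
  fix m
  let ?R = "egf l cs cw (rooted supp X0 X) :: ('v, 'c) mfps" and ?C = "egf l cs cw cfg :: ('v, 'c) mfps"
  have "euler l (mfps_const g * ?R) = mfps_const g * euler l ?R"
    by (rule mfps_eqI) simp
  also have "\<dots> = euler l (mfps_const g * egf l supp wt X0) * ?C"
    unfolding euler_egf_rooted[OF X0] mult.assoc[symmetric]
    by (rule arg_cong[of _ _ "\<lambda>x. x * ?C"], rule mfps_eqI) simp
  also have "\<dots> = euler l ?C" unfolding g[symmetric] by (rule euler_egf_configs[symmetric])
  finally have eq: "mfps_coeff (euler l (mfps_const g * ?R)) m = mfps_coeff (euler l ?C) m" by simp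
  have "mfps_coeff (mfps_const g * ?R) m = mfps_coeff (?C - 1) m"
  proof (cases "l m = 0")
    case True
    have "{F \<in> rooted supp X0 X. cs F = {} \<and> cw F = m} = {}"
      using configs_csupp_empty by (auto simp: rooted_def)
    then have "num cs cw (rooted supp X0 X) {} m = 0" by (simp only: num_def card.empty)
    then have "mfps_coeff ?R m = 0" using True by (simp add: mfps_coeff_egf)
    then show ?thesis using True by (simp add: egf_configs_low mfps_coeff_one)
  next
    case False
    then have "m \<noteq> 0" using l_0 by auto
    then show ?thesis using eq False by (simp add: mfps_coeff_one)
  qed
  then show "mfps_coeff (mfps_const g * ?R) m = mfps_coeff (mfps_exp (egf l supp wt X) - 1) m"
    by (simp add: exponential_formula)
qed

end

section \<open>Labelled trees\<close>

text \<open>An independent decoration, later the coset on an edge, is invisible to support and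
  weight and only multiplies the counts.\<close>

lemma num_Times: "num (supp \<circ> snd) (wt \<circ> snd) (A \<times> U) M m = card A * num supp wt U M m"
proof -
  have "{x \<in> A \<times> U. (supp \<circ> snd) x = M \<and> (wt \<circ> snd) x = m} = A \<times> {u \<in> U. supp u = M \<and> wt u = m}" by auto
  then show ?thesis unfolding num_def by (simp only: card_cartesian_product)
qed

lemma egf_Times:
  assumes "finite A"
  shows "egf l (supp \<circ> snd) (wt \<circ> snd) (A \<times> U) = mfps_const (of_nat (card A)) * egf l supp wt U"
  by (rule mfps_eqI) (simp add: mfps_coeff_egf num_Times)

lemma labelled_Times:
  assumes A: "finite A" and U: "labelled l supp wt U"
  shows "labelled l (supp \<circ> snd) (wt \<circ> snd) (A \<times> U)"
proof (rule labelledI)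
  fix M :: "nat set" assume M: "finite M"
  have "{x \<in> A \<times> U. (supp \<circ> snd) x = M} = A \<times> {u \<in> U. supp u = M}" by auto
  then show "finite {x \<in> A \<times> U. (supp \<circ> snd) x = M}"
    using finite_cartesian_product[OF A labelled_fin[OF U M]] by (simp only:)
next
  fix M M' :: "nat set" and m assume M: "finite M" "finite M'" "card M = card M'"
  show "num (supp \<circ> snd) (wt \<circ> snd) (A \<times> U) M m = num (supp \<circ> snd) (wt \<circ> snd) (A \<times> U) M' m"
    unfolding num_Times labelled_card[OF U M] ..
qed (auto simp: labelled_supp[OF U] labelled_wt[OF U])

section \<open>Vertices, leaves and weights of trees\<close>

lemma vertices_Leaf [simp]: "vertices (Leaf i) = {Leaf i}"
proof -
  have "\<not> has_child (Leaf i) v" for v :: "'l ltree" by (simp add: has_child_def)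
  then show ?thesis unfolding vertices_def by (auto elim: converse_rtranclpE)
qed

lemma vertices_Node: "vertices (Node K C) = insert (Node K C) (\<Union>x\<in>set_mset C. vertices (snd x))"
proof (intro equalityI subsetI)
  fix v assume "v \<in> vertices (Node K C)"
  then have "has_child\<^sup>*\<^sup>* (Node K C) v" by (simp add: vertices_def)
  then show "v \<in> insert (Node K C) (\<Union>x\<in>set_mset C. vertices (snd x))"
    by (cases rule: converse_rtranclpE) (force simp: has_child_def vertices_def)+
next
  fix v assume "v \<in> insert (Node K C) (\<Union>x\<in>set_mset C. vertices (snd x))"
  then show "v \<in> vertices (Node K C)"
  proof
    assume "v \<in> (\<Union>x\<in>set_mset C. vertices (snd x))"
    then obtain x where x: "x \<in># C" "has_child\<^sup>*\<^sup>* (snd x) v" by (auto simp: vertices_def)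
    have "has_child (Node K C) (snd x)" using x(1) by (auto simp: has_child_def intro: exI[of _ "fst x"])
    then show ?thesis using x(2) by (simp add: vertices_def converse_rtranclp_into_rtranclp)
  qed (simp add: vertices_def)
qed

lemma vertices_refl [simp]: "T \<in> vertices T"
  by (simp add: vertices_def)

text \<open>Two forms of having distinct leaf labels: the bound on counts is inherited by subtrees,
  while the form with \<open>mset_set\<close> is that of \<open>tree_on\<close> and yields
  cardinalities.\<close>

lemma count_le_1_iff: "(\<forall>i. count A i \<le> 1) \<longleftrightarrow> A = mset_set (set_mset A)"
proof
  assume *: "\<forall>i. count A i \<le> 1"
  show "A = mset_set (set_mset A)"
  proof (rule multiset_eqI)
    fix i
    show "count A i = count (mset_set (set_mset A)) i"
    proof (cases "i \<in># A")
      case True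
      then have "0 < count A i" by (simp only: count_greater_zero_iff)
      then have "count A i = 1" using spec[OF *, of i] by linarith
      then show ?thesis using True by simp
    qed (simp add: not_in_iff)
  qed
next
  assume "A = mset_set (set_mset A)"
  moreover have "count (mset_set B) i \<le> 1" for B :: "'a set" and i by (simp add: count_mset_set')
  ultimately show "\<forall>i. count A i \<le> 1" by metis
qed

lemma vertices_trans: "v \<in> vertices u \<Longrightarrow> u \<in> vertices T \<Longrightarrow> v \<in> vertices T"
  by (simp add: vertices_def)

lemma leaves_Node: "leaves (Node K C) = (\<Sum>x\<in>#C. leaves (snd x))"
  by (simp add: image_mset.compositionality comp_def)

declare leaves.simps(2) [simp del]

lemma leaf_set_Node: "leaf_set (Node K C) = (\<Union>x\<in>set_mset C. leaf_set (snd x))"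
  by (simp add: leaves_Node)

text \<open>The second argument is the label of the vertex to which the tree is attached. A leaf
  contributes the variable of that vertex, so the recursion produces functions, to which the root
  label \<open>P\<close> of the surrounding node is then passed.\<close>

primrec lweight :: "'l ltree \<Rightarrow> 'l \<Rightarrow> ('l series_var \<Rightarrow>\<^sub>0 nat)" where
  "lweight (Leaf i) = (\<lambda>K. Poly_Mapping.single (tH_var K) 1)"
| "lweight (Node P C) =
    (\<lambda>K. \<Sum>\<^sub># (image_mset (\<lambda>g. g P) (image_mset snd (image_mset (map_prod id lweight) C))))"

lemma lweight_Node: "lweight (Node P C) K = (\<Sum>x\<in>#C. lweight (snd x) P)"
  by (simp add: image_mset.compositionality comp_def)

declare lweight.simps(2) [simp del]

text \<open>Every variable but \<open>s\<close> marks leaves: \<open>t\<close> the fallen ones and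
  \<open>t_H\<close> those whose parent is labelled \<open>H\<close>. The degree in these variables
  is therefore the number of labels.\<close>

abbreviation label_degree :: "('h series_var \<Rightarrow>\<^sub>0 nat) \<Rightarrow> nat" where
  "label_degree \<equiv> mdeg (- {s_var})"

primrec relabel :: "(nat \<Rightarrow> nat) \<Rightarrow> 'l ltree \<Rightarrow> 'l ltree" where
  "relabel f (Leaf i) = Leaf (f i)"
| "relabel f (Node K C) = Node K (image_mset (map_prod id (relabel f)) C)"

lemma ltree_induct [case_names Leaf Node]:
  assumes "\<And>i. P (Leaf i)" "\<And>K C. (\<And>x. x \<in># C \<Longrightarrow> P (snd x)) \<Longrightarrow> P (Node K C)"
  shows "P T"
proof (induction T)
  case (Node K C)
  show ?case
  proof (rule assms(2))
    fix x assume "x \<in># C"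
    then show "P (snd x)" by (rule Node) (cases x, simp)
  qed
qed (rule assms(1))

lemma leaves_relabel: "leaves (relabel f T) = image_mset f (leaves T)"
proof (induction T rule: ltree_induct)
  case (Node K C)
  have "leaves (relabel f (Node K C)) = (\<Sum>x\<in>#C. leaves (relabel f (snd x)))"
    by (simp add: leaves_Node image_mset.compositionality comp_def)
  also have "\<dots> = (\<Sum>x\<in>#C. image_mset f (leaves (snd x)))"
    by (rule arg_cong[of _ _ sum_mset], rule image_mset_cong) (rule Node)
  also have "\<dots> = image_mset f (leaves (Node K C))"
    unfolding leaves_Node by (induction C) auto
  finally show ?case .
qed simp

lemma lweight_relabel: "lweight (relabel f T) K = lweight T K"
proof (induction T arbitrary: K rule: ltree_induct)
  case (Node P C)
  have "lweight (relabel f (Node P C)) K = (\<Sum>x\<in>#C. lweight (relabel f (snd x)) P)"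
    by (simp add: lweight_Node image_mset.compositionality comp_def)
  also have "\<dots> = lweight (Node P C) K"
    unfolding lweight_Node by (rule arg_cong[of _ _ sum_mset], rule image_mset_cong) (rule Node)
  finally show ?case .
qed simp

lemma relabel_relabel: "relabel g (relabel f T) = relabel (g \<circ> f) T"
proof (induction T rule: ltree_induct)
  case (Node K C)
  then show ?case
    by (auto simp: image_mset.compositionality intro!: image_mset_cong)
qed simp

lemma relabel_id: "(\<And>i. i \<in> leaf_set T \<Longrightarrow> f i = i) \<Longrightarrow> relabel f T = T"
proof (induction T rule: ltree_induct)
  case (Node K C)
  have "image_mset (map_prod id (relabel f)) C = image_mset id C"
  proof (rule image_mset_cong)
    fix x assume x: "x \<in># C"
    have "relabel f (snd x) = snd x"
      by (rule Node.IH[OF x]) (use Node.prems x in \<open>auto simp: leaf_set_Node\<close>)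
    then show "map_prod id (relabel f) x = id x" by (cases x) simp
  qed
  then show ?case by simp
qed simp

lemma vertices_relabel: "vertices (relabel f T) = relabel f ` vertices T"
proof (induction T rule: ltree_induct)
  case (Node K C)
  then show ?case by (auto simp: vertices_Node image_UN)
qed simp

lemma leaf_set_vertices: "v \<in> vertices T \<Longrightarrow> leaf_set v \<subseteq> leaf_set T"
proof (induction T rule: ltree_induct)
  case (Node K C)
  then show ?case by (auto simp: vertices_Node leaf_set_Node)
qed simp

section \<open>Increasing relabellings and valid trees\<close>

lemma Min_image_strict_mono_on:
  fixes f :: "nat \<Rightarrow> nat"
  assumes "strict_mono_on A f" "finite A" "A \<noteq> {}"
  shows "Min (f ` A) = f (Min A)"
proof (rule Min_eqI)
  fix y assume "y \<in> f ` A"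
  then obtain x where "x \<in> A" "y = f x" by auto
  then show "f (Min A) \<le> y"
    using assms by (metis Min_in Min_le le_less strict_mono_on_def)
qed (use assms in auto)

lemma ex_strict_mono_on_bij:
  fixes M M' :: "nat set"
  assumes "finite M" "finite M'" "card M = card M'"
  shows "\<exists>f. strict_mono_on M f \<and> f ` M = M'"
  using assms
proof (induction "card M" arbitrary: M M')
  case (Suc n)
  then have ne: "M \<noteq> {}" "M' \<noteq> {}" by auto
  let ?a = "Max M" and ?b = "Max M'"
  have ab: "?a \<in> M" "?b \<in> M'" using Suc.prems ne by auto
  then have "card (M - {?a}) = n" "card (M' - {?b}) = n" using Suc.hyps(2) Suc.prems by simp_all
  then obtain f where f: "strict_mono_on (M - {?a}) f" "f ` (M - {?a}) = M' - {?b}"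
    using Suc.hyps(1)[of "M - {?a}" "M' - {?b}"] Suc.prems by auto
  let ?f = "f(?a := ?b)"
  have less: "f x < ?b" if "x \<in> M" "x \<noteq> ?a" for x
  proof -
    have "f x \<in> M' - {?b}" using f(2) that by auto
    then show ?thesis using Suc.prems(2) by (metis DiffE Max_ge insertI1 order_le_imp_less_or_eq)
  qed
  have "strict_mono_on M ?f"
  proof (rule strict_mono_onI)
    fix x y assume xy: "x \<in> M" "y \<in> M" "x < y"
    then have "x \<noteq> ?a" using Max_ge[OF Suc.prems(1) xy(2)] by auto
    then show "?f x < ?f y" using xy less f(1) by (auto simp: strict_mono_on_def)
  qed
  moreover have "?f ` M = M'" 
  proof -
    have "?f ` M = insert ?b (f ` (M - {?a}))" using ab by auto
    then show ?thesis unfolding f(2) using ab by auto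
  qed
  ultimately show ?case by blast
qed (auto simp: strict_mono_on_def)

text \<open>The tree conditions made local to one vertex: containment is required of children only
  and propagates to descendants by \<open>has_child_valid\<close>. The label set \<open>S\<close>
  stays free, so that the same notion describes the trees of forests, for all proper closed
  subgroups, and the \<open>H\<close>-trees, for \<open>{H}\<close>.\<close>

definition ok_vertex :: "('g, 'm) monoid_scheme \<Rightarrow> 'g set set \<Rightarrow> 'g set ltree \<Rightarrow> bool" where
  "ok_vertex G S v \<longleftrightarrow> (\<forall>K C. v = Node K C \<longrightarrow> K \<in> S \<and> C \<noteq> {#} \<and>
     (\<forall>x\<in>#C. fst x \<in> rcosets\<^bsub>G\<^esub> K \<and> (Min (leaf_set v) \<in> leaf_set (snd x) \<longrightarrow> fst x = K #>\<^bsub>G\<^esub> \<one>\<^bsub>G\<^esub>) \<and>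
        (\<forall>P D. snd x = Node P D \<longrightarrow> P \<subseteq> K)) \<and>
     (\<forall>c P D. C = {#(c, Node P D)#} \<longrightarrow> P \<subset> K) \<and>
     (\<forall>c i. C = {#(c, Leaf i)#} \<longrightarrow> K \<noteq> {\<one>\<^bsub>G\<^esub>}))"

definition valid :: "('g, 'm) monoid_scheme \<Rightarrow> 'g set set \<Rightarrow> 'g set ltree \<Rightarrow> bool" where
  "valid G S T \<longleftrightarrow> (\<forall>i. count (leaves T) i \<le> 1) \<and> (\<forall>v\<in>vertices T. ok_vertex G S v)"

lemma ok_vertex_Leaf [simp]: "ok_vertex G S (Leaf i)"
  by (simp add: ok_vertex_def)

lemma valid_Leaf [simp]: "valid G S (Leaf i)"
  by (simp add: valid_def)

lemma leaf_set_nonempty: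
  assumes "\<And>v. v \<in> vertices T \<Longrightarrow> ok_vertex G S v"
  shows "leaf_set T \<noteq> {}"
  using assms
proof (induction T rule: ltree_induct)
  case (Node K C)
  have "C \<noteq> {#}" using Node.prems[of "Node K C"] by (auto simp: ok_vertex_def)
  then obtain x where x: "x \<in># C" by blast
  have "leaf_set (snd x) \<noteq> {}"
    by (rule Node.IH[OF x]) (use Node.prems x in \<open>auto simp: vertices_Node\<close>)
  then show ?case using x by (auto simp: leaf_set_Node)
qed simp

text \<open>An arbitrary bijection of the labels may move the smallest leaf into another subtree and
  so destroy the normalisation of the cosets. An increasing map keeps it in place, and increasing
  bijections exist between any two finite sets of the same size.\<close>

lemma ok_vertex_relabel:
  assumes v: "ok_vertex G S v" and f: "strict_mono_on (leaf_set v) f" and ne: "leaf_set v \<noteq> {}"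
  shows "ok_vertex G S (relabel f v)"
proof (cases v)
  case (Node K C)
  let ?h = "map_prod id (relabel f)"
  have inj: "inj_on f (leaf_set v)" using f by (rule strict_mono_on_imp_inj_on)
  have min: "Min (leaf_set (relabel f v)) = f (Min (leaf_set v))"
    using Min_image_strict_mono_on[OF f _ ne] by (simp add: leaves_relabel)
  have K: "K \<in> S" "C \<noteq> {#}" and x: "\<And>x. x \<in># C \<Longrightarrow> fst x \<in> rcosets\<^bsub>G\<^esub> K"
    "\<And>x. x \<in># C \<Longrightarrow> Min (leaf_set v) \<in> leaf_set (snd x) \<Longrightarrow> fst x = K #>\<^bsub>G\<^esub> \<one>\<^bsub>G\<^esub>"
    "\<And>x P D. x \<in># C \<Longrightarrow> snd x = Node P D \<Longrightarrow> P \<subseteq> K"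
    and s: "\<And>c P D. C = {#(c, Node P D)#} \<Longrightarrow> P \<subset> K" "\<And>c i. C = {#(c, Leaf i)#} \<Longrightarrow> K \<noteq> {\<one>\<^bsub>G\<^esub>}"
    using v by (auto simp: ok_vertex_def Node)
  have single: "\<exists>u. C = {#(c, u)#} \<and> w = relabel f u" if "image_mset ?h C = {#(c, w)#}" for c w
    using msed_map_invR[of ?h C "(c, w)" "{#}"] that by auto
  show ?thesis
    unfolding ok_vertex_def
  proof (intro allI impI)
    fix K' C' assume "relabel f v = Node K' C'"
    then have K': "K' = K" "C' = image_mset ?h C" by (simp_all add: Node)
    show "K' \<in> S \<and> C' \<noteq> {#} \<and>
     (\<forall>x\<in>#C'. fst x \<in> rcosets\<^bsub>G\<^esub> K' \<and> (Min (leaf_set (relabel f v)) \<in> leaf_set (snd x) \<longrightarrow> fst x = K' #>\<^bsub>G\<^esub> \<one>\<^bsub>G\<^esub>) \<and>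
        (\<forall>P D. snd x = Node P D \<longrightarrow> P \<subseteq> K')) \<and>
     (\<forall>c P D. C' = {#(c, Node P D)#} \<longrightarrow> P \<subset> K') \<and>
     (\<forall>c i. C' = {#(c, Leaf i)#} \<longrightarrow> K' \<noteq> {\<one>\<^bsub>G\<^esub>})"
      unfolding K'
    proof (intro conjI ballI allI impI)
      fix y assume "y \<in># image_mset ?h C"
      then obtain z where z: "z \<in># C" "y = ?h z" by auto
      show "fst y \<in> rcosets\<^bsub>G\<^esub> K" using x(1)[OF z(1)] z(2) by simp
      show "fst y = K #>\<^bsub>G\<^esub> \<one>\<^bsub>G\<^esub>" if "Min (leaf_set (relabel f v)) \<in> leaf_set (snd y)"
      proof -
        have "f (Min (leaf_set v)) \<in> f ` leaf_set (snd z)" using that unfolding min by (simp add: z(2) leaves_relabel)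
        moreover have "leaf_set (snd z) \<subseteq> leaf_set v" using z(1) by (auto simp: Node leaf_set_Node)
        moreover have "Min (leaf_set v) \<in> leaf_set v" using ne by (intro Min_in) auto
        ultimately have "Min (leaf_set v) \<in> leaf_set (snd z)" using inj by (meson inj_on_image_mem_iff)
        then show ?thesis using x(2)[OF z(1)] z(2) by simp
      qed
      show "P \<subseteq> K" if "snd y = Node P D" for P D
        using that x(3)[OF z(1)] z(2) by (cases "snd z") auto
    next
      fix c P D assume "image_mset ?h C = {#(c, Node P D)#}"
      then obtain u where u: "C = {#(c, u)#}" "Node P D = relabel f u" using single by blast
      then show "P \<subset> K" using s(1) by (cases u) auto
    next
      fix c i assume "image_mset ?h C = {#(c, Leaf i)#}"
      then obtain u where u: "C = {#(c, u)#}" "Leaf i = relabel f u" using single by blast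
      then show "K \<noteq> {\<one>\<^bsub>G\<^esub>}" using s(2) by (cases u) auto
    qed (use K in auto)
  qed
qed simp

lemma valid_relabel:
  assumes T: "valid G S T" and f: "strict_mono_on (leaf_set T) f"
  shows "valid G S (relabel f T)"
  unfolding valid_def
proof
  have inj: "inj_on f (leaf_set T)" using f by (rule strict_mono_on_imp_inj_on)
  have "leaves T = mset_set (leaf_set T)" using T by (simp add: valid_def count_le_1_iff[symmetric])
  then have "leaves (relabel f T) = mset_set (f ` leaf_set T)"
    unfolding leaves_relabel using image_mset_mset_set[OF inj] by (rule subst[of _ _ "\<lambda>A. image_mset f A = _", OF sym])
  then show "\<forall>i. count (leaves (relabel f T)) i \<le> 1" by (simp add: count_mset_set')
  show "\<forall>v\<in>vertices (relabel f T). ok_vertex G S v"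
  proof
    fix w assume "w \<in> vertices (relabel f T)"
    then obtain v where v: "v \<in> vertices T" "w = relabel f v" by (auto simp: vertices_relabel)
    have "strict_mono_on (leaf_set v) f"
      using f leaf_set_vertices[OF v(1)] by (auto simp: strict_mono_on_def)
    moreover have "leaf_set v \<noteq> {}"
      by (rule leaf_set_nonempty[of v G S]) (use T vertices_trans[OF _ v(1)] in \<open>auto simp: valid_def\<close>)
    ultimately show "ok_vertex G S w" using T v by (auto simp: valid_def intro: ok_vertex_relabel)
  qed
qed

lemma valid_child:
  assumes "valid G S (Node K C)" "x \<in># C" shows "valid G S (snd x)"
proof -
  obtain C' where C: "C = add_mset x C'" using assms(2) by (meson mset_add)
  have "count (leaves (snd x)) i \<le> 1" for i
  proof -
    have "count (leaves (snd x)) i \<le> count (leaves (Node K C)) i" by (simp add: C leaves_Node)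
    also have "\<dots> \<le> 1" using assms(1) by (simp only: valid_def)
    finally show ?thesis .
  qed
  then show ?thesis using assms by (auto simp: valid_def vertices_Node)
qed

lemma valid_leaf_set: "valid G S T \<Longrightarrow> leaf_set T \<noteq> {}"
  by (rule leaf_set_nonempty) (auto simp: valid_def)

text \<open>Subtrees of valid trees have leaves, so a repeated child, or two children with a common
  leaf, would repeat a leaf label. Hence the multiset of children is a set with disjoint supports
  and the counting of configurations applies to it.\<close>

lemma valid_children:
  assumes V: "valid G S (Node K C)"
  shows "C = mset_set (set_mset C)" "disjoint_family_on (leaf_set \<circ> snd) (set_mset C)"
proof -
  have le1: "count (leaves (Node K C)) i \<le> 1" for i
    using V by (simp only: valid_def)
  have disj: "leaf_set (snd x) \<inter> leaf_set (snd y) = {}" if xy: "{#x, y#} \<subseteq># C" for x y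
  proof (rule ccontr)
    assume "leaf_set (snd x) \<inter> leaf_set (snd y) \<noteq> {}"
    then obtain i where i: "i \<in># leaves (snd x)" "i \<in># leaves (snd y)" by auto
    obtain C' where "C = {#x, y#} + C'" using xy by (meson mset_subset_eq_exists_conv)
    then have "count (leaves (snd x)) i + count (leaves (snd y)) i \<le> 1"
      using le1[of i] by (simp add: leaves_Node)
    moreover have "count (leaves (snd x)) i > 0" "count (leaves (snd y)) i > 0" using i by simp_all
    ultimately show False by simp
  qed
  show "C = mset_set (set_mset C)"
  proof (rule multiset_eqI)
    fix x
    show "count C x = count (mset_set (set_mset C)) x"
    proof (cases "x \<in># C")
      case True
      have "count C x \<le> 1"
      proof (rule ccontr)
        assume "\<not> count C x \<le> 1"
        then have "{#x, x#} \<subseteq># C" by (auto simp: subseteq_mset_def)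
        then show False using disj[of x x] valid_leaf_set[OF valid_child[OF V True]] by simp
      qed
      moreover have "count C x > 0" using True by simp
      ultimately have "count C x = 1" by linarith
      then show ?thesis using True by simp
    qed (simp add: not_in_iff)
  qed
  show "disjoint_family_on (leaf_set \<circ> snd) (set_mset C)"
    unfolding disjoint_family_on_def
  proof (intro ballI impI)
    fix x y assume "x \<in># C" "y \<in># C" "x \<noteq> y"
    then have "{#x, y#} \<subseteq># C" by (auto simp: subseteq_mset_def)
    then show "(leaf_set \<circ> snd) x \<inter> (leaf_set \<circ> snd) y = {}" using disj by simp
  qed
qed

lemma leaves_mset_set:
  assumes "finite F" "disjoint_family_on (leaf_set \<circ> snd) F" "\<And>x. x \<in> F \<Longrightarrow> leaves (snd x) = mset_set (leaf_set (snd x))"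
  shows "(\<Sum>x\<in>#mset_set F. leaves (snd x)) = mset_set (csupp (leaf_set \<circ> snd) F)"
  using assms
proof (induction F rule: finite_induct)
  case (insert x F)
  have disj: "leaf_set (snd x) \<inter> csupp (leaf_set \<circ> snd) F = {}"
    using insert.prems(1) insert.hyps by (auto simp: disjoint_family_on_def csupp_def)
  have fin: "finite (csupp (leaf_set \<circ> snd) F)" using insert.hyps by (auto simp: csupp_def)
  have ins: "csupp (leaf_set \<circ> snd) (insert x F) = leaf_set (snd x) \<union> csupp (leaf_set \<circ> snd) F" by (auto simp: csupp_def)
  have IH: "(\<Sum>x\<in>#mset_set F. leaves (snd x)) = mset_set (csupp (leaf_set \<circ> snd) F)"
    by (rule insert.IH) (use insert.prems in \<open>auto simp: disjoint_family_on_def\<close>)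
  have "(\<Sum>x\<in>#mset_set (insert x F). leaves (snd x)) = leaves (snd x) + (\<Sum>x\<in>#mset_set F. leaves (snd x))"
    using insert.hyps by simp
  also have "\<dots> = mset_set (leaf_set (snd x)) + mset_set (csupp (leaf_set \<circ> snd) F)"
    unfolding IH by (rule arg_cong[where f = "\<lambda>A. A + mset_set (csupp (leaf_set \<circ> snd) F)"], rule insert.prems(2)) simp
  also have "\<dots> = mset_set (csupp (leaf_set \<circ> snd) (insert x F))"
    unfolding ins by (rule mset_set_Union[symmetric]) (use disj fin in simp_all)
  finally show ?case .
qed (simp add: csupp_def)

lemma leaf_set_Node_mset_set:
  "finite F \<Longrightarrow> leaf_set (Node K (mset_set F)) = csupp (leaf_set \<circ> snd) F"
  by (simp add: leaf_set_Node csupp_def)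

lemma lweight_Node_mset_set: "lweight (Node K (mset_set F)) P = (\<Sum>x\<in>F. lweight (snd x) K)"
  by (simp add: lweight_Node sum_unfold_sum_mset)

section \<open>Removal of the root\<close>

definition trees :: "('g, 'm) monoid_scheme \<Rightarrow> 'g set set \<Rightarrow> 'g set \<Rightarrow> 'g set ltree set" where
  "trees G S K = {T. valid G S T \<and> (\<exists>C. T = Node K C)}"

text \<open>The second argument of the weight is irrelevant for trees with an internal root.\<close>

definition tree_series :: "('g, 'm) monoid_scheme \<Rightarrow> 'g set set \<Rightarrow> 'g set \<Rightarrow> 'g set series" where
  "tree_series G S K = egf label_degree leaf_set (\<lambda>u. lweight u K) (trees G S K)"

definition children :: "('g, 'm) monoid_scheme \<Rightarrow> 'g set set \<Rightarrow> 'g set \<Rightarrow> 'g set ltree set" where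
  "children G S K = {u. valid G S u \<and> (\<forall>P D. u = Node P D \<longrightarrow> P \<subseteq> K)}"

abbreviation pair_supp :: "'l \<times> 'l ltree \<Rightarrow> nat set" where
  "pair_supp \<equiv> leaf_set \<circ> snd"

abbreviation base :: "('g, 'm) monoid_scheme \<Rightarrow> 'g set \<Rightarrow> 'g set" where
  "base G K \<equiv> K #>\<^bsub>G\<^esub> \<one>\<^bsub>G\<^esub>"

definition child_sets :: "('g, 'm) monoid_scheme \<Rightarrow> 'g set set \<Rightarrow> 'g set \<Rightarrow> ('g set \<times> 'g set ltree) set set" where
  "child_sets G S K = rooted pair_supp ({base G K} \<times> children G S K) ((rcosets\<^bsub>G\<^esub> K) \<times> children G S K)"

text \<open>Inside \<open>child_sets\<close> every child label satisfies
  \<open>P \<subseteq> K\<close>, so \<open>\<not> P \<subset> K\<close> there means that the only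
  child repeats the label \<open>K\<close>.\<close>

definition excluded :: "('g, 'm) monoid_scheme \<Rightarrow> 'g set \<Rightarrow> ('g set \<times> 'g set ltree) set \<Rightarrow> bool" where
  "excluded G K F \<longleftrightarrow> (\<exists>c P D. F = {(c, Node P D)} \<and> \<not> P \<subset> K) \<or> (\<exists>c i. F = {(c, Leaf i)} \<and> K = {\<one>\<^bsub>G\<^esub>})"

lemma valid_Node_child_sets:
  assumes V: "valid G S (Node K C)"
  shows "K \<in> S" "C = mset_set (set_mset C)" "set_mset C \<in> child_sets G S K" "\<not> excluded G K (set_mset C)"
proof -
  let ?F = "set_mset C"
  have ok: "ok_vertex G S (Node K C)" using V by (simp add: valid_def)
  show "K \<in> S" using ok by (simp add: ok_vertex_def)
  show C: "C = mset_set ?F" by (rule valid_children(1)[OF V])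
  have F: "?F \<noteq> {}" using ok by (simp add: ok_vertex_def)
  have x: "fst x \<in> rcosets\<^bsub>G\<^esub> K" "Min (leaf_set (Node K C)) \<in> leaf_set (snd x) \<Longrightarrow> fst x = base G K"
    "snd x \<in> children G S K" if "x \<in> ?F" for x
    using ok that valid_child[OF V] by (auto simp: ok_vertex_def children_def)
  have ls: "leaf_set (Node K C) = csupp pair_supp ?F" by (simp add: leaf_set_Node csupp_def)
  have "leaf_set (Node K C) \<noteq> {}" by (rule valid_leaf_set[OF V])
  then have "Min (leaf_set (Node K C)) \<in> leaf_set (Node K C)" by (intro Min_in) auto
  then obtain y where y: "y \<in> ?F" "Min (leaf_set (Node K C)) \<in> leaf_set (snd y)" unfolding ls by (auto simp: csupp_def)
  have yb: "y \<in> {base G K} \<times> children G S K" using x[OF y(1)] y(2) by (auto simp: mem_Times_iff)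
  have "?F \<subseteq> (rcosets\<^bsub>G\<^esub> K) \<times> children G S K" using x by (auto simp: mem_Times_iff)
  then have "?F \<in> configs pair_supp ((rcosets\<^bsub>G\<^esub> K) \<times> children G S K)"
    using valid_children(2)[OF V] by (simp add: configs_def)
  then show "?F \<in> child_sets G S K"
    using y yb unfolding child_sets_def rooted_def ls by (auto intro!: bexI[of _ y])
  show "\<not> excluded G K ?F"
  proof
    assume "excluded G K ?F"
    then consider c P D where "?F = {(c, Node P D)}" "\<not> P \<subset> K" | c i where "?F = {(c, Leaf i)}" "K = {\<one>\<^bsub>G\<^esub>}"
      by (auto simp: excluded_def)
    then show False
    proof cases
      case 1
      then have "C = {#(c, Node P D)#}" using arg_cong[OF 1(1), of mset_set] C by simp
      then show False using ok 1(2) by (simp add: ok_vertex_def)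
    next
      case 2
      then have "C = {#(c, Leaf i)#}" using arg_cong[OF 2(1), of mset_set] C by simp
      then show False using ok 2(2) by (simp add: ok_vertex_def)
    qed
  qed
qed

lemma valid_NodeI:
  assumes K: "K \<in> S" and F: "F \<in> child_sets G S K" and ex: "\<not> excluded G K F"
  shows "valid G S (Node K (mset_set F))"
proof -
  have conf: "F \<in> configs pair_supp ((rcosets\<^bsub>G\<^esub> K) \<times> children G S K)"
    using F by (simp add: child_sets_def rooted_def)
  then have fin: "finite F" and disj: "disjoint_family_on pair_supp F"
    and sub: "F \<subseteq> (rcosets\<^bsub>G\<^esub> K) \<times> children G S K" by (auto simp: configs_def)
  obtain y where y: "y \<in> F" "fst y = base G K" "Min (csupp pair_supp F) \<in> pair_supp y"
    using F by (auto simp: child_sets_def rooted_def)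
  have v: "valid G S (snd x)" if "x \<in> F" for x using sub that by (auto simp: children_def)
  have "leaves (Node K (mset_set F)) = mset_set (csupp pair_supp F)"
    unfolding leaves_Node
    by (rule leaves_mset_set[OF fin disj], rule iffD1[OF count_le_1_iff]) (use v in \<open>simp add: valid_def\<close>)
  then have "count (leaves (Node K (mset_set F))) i \<le> 1" for i by (simp add: count_mset_set')
  moreover have "ok_vertex G S (Node K (mset_set F))"
  proof -
    have "fst x = base G K" if x: "x \<in> F" "Min (csupp pair_supp F) \<in> pair_supp x" for x
    proof -
      have "x = y" using disj x y by (auto simp: disjoint_family_on_def)
      then show ?thesis using y by simp
    qed
    moreover have "F = {x}" if "mset_set F = {#x#}" for x
      using arg_cong[OF that, of set_mset] fin by simp
    moreover have "F \<noteq> {}" using y by auto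
    ultimately have b: "\<And>x. x \<in> F \<Longrightarrow> Min (csupp pair_supp F) \<in> pair_supp x \<Longrightarrow> fst x = base G K"
      and single: "\<And>x. mset_set F = {#x#} \<Longrightarrow> F = {x}" and ne: "F \<noteq> {}" by blast+
    show ?thesis
      unfolding ok_vertex_def
    proof (intro allI impI)
      fix K' C assume "Node K (mset_set F) = Node K' C"
      then have K': "K' = K" and C: "C = mset_set F" by simp_all
      have "\<forall>x\<in>#mset_set F. fst x \<in> rcosets\<^bsub>G\<^esub> K \<and>
         (Min (leaf_set (Node K (mset_set F))) \<in> leaf_set (snd x) \<longrightarrow> fst x = base G K) \<and> (\<forall>P D. snd x = Node P D \<longrightarrow> P \<subseteq> K)"
        unfolding leaf_set_Node_mset_set[OF fin]
      proof
        fix x assume "x \<in># mset_set F"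
        then have x: "x \<in> F" using fin by simp
        then show "fst x \<in> rcosets\<^bsub>G\<^esub> K \<and>
         (Min (csupp pair_supp F) \<in> leaf_set (snd x) \<longrightarrow> fst x = base G K) \<and> (\<forall>P D. snd x = Node P D \<longrightarrow> P \<subseteq> K)"
          using subsetD[OF sub x] b[OF x] by (auto simp: children_def mem_Times_iff)
      qed
      moreover have "P \<subset> K" if "mset_set F = {#(c, Node P D)#}" for c P D
        using ex single[OF that] unfolding excluded_def by blast
      moreover have "K \<noteq> {\<one>\<^bsub>G\<^esub>}" if "mset_set F = {#(c, Leaf i)#}" for c i
        using ex single[OF that] unfolding excluded_def by blast
      ultimately show "K' \<in> S \<and> C \<noteq> {#} \<and>
         (\<forall>x\<in>#C. fst x \<in> rcosets\<^bsub>G\<^esub> K' \<and> (Min (leaf_set (Node K (mset_set F))) \<in> leaf_set (snd x) \<longrightarrow> fst x = base G K') \<and>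
            (\<forall>P D. snd x = Node P D \<longrightarrow> P \<subseteq> K')) \<and>
         (\<forall>c P D. C = {#(c, Node P D)#} \<longrightarrow> P \<subset> K') \<and> (\<forall>c i. C = {#(c, Leaf i)#} \<longrightarrow> K' \<noteq> {\<one>\<^bsub>G\<^esub>})"
        unfolding K' C using K ne mset_set_empty_iff[of F] fin by blast
    qed
  qed
  ultimately show ?thesis
    using v fin by (auto simp: valid_def vertices_Node)
qed

lemma bij_betw_trees:
  assumes "K \<in> S"
  shows "bij_betw (\<lambda>F. Node K (mset_set F)) {F \<in> child_sets G S K. \<not> excluded G K F} (trees G S K)"
proof (rule bij_betw_byWitness[where f' = "\<lambda>T. case T of Leaf i \<Rightarrow> {} | Node P C \<Rightarrow> set_mset C"])
  have fin: "finite F" if "F \<in> child_sets G S K" for F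
    using that by (simp add: child_sets_def rooted_def configs_def)
  show "\<forall>F\<in>{F \<in> child_sets G S K. \<not> excluded G K F}.
      (case Node K (mset_set F) of Leaf i \<Rightarrow> {} | Node P C \<Rightarrow> set_mset C) = F"
    using fin by simp
  have trees: "\<exists>C. T = Node K C \<and> Node K (mset_set (set_mset C)) = T \<and> set_mset C \<in> child_sets G S K \<and> \<not> excluded G K (set_mset C)"
    if T: "T \<in> trees G S K" for T
  proof -
    obtain C where C: "T = Node K C" "valid G S (Node K C)" using T by (auto simp: trees_def)
    have "Node K (mset_set (set_mset C)) = T"
      unfolding C(1) by (rule arg_cong[of _ _ "Node K"]) (rule valid_Node_child_sets(2)[OF C(2), symmetric])
    then show ?thesis using C(1) valid_Node_child_sets(3,4)[OF C(2)] by blast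
  qed
  show "\<forall>T\<in>trees G S K. Node K (mset_set (case T of Leaf i \<Rightarrow> {} | Node P C \<Rightarrow> set_mset C)) = T"
    using trees by fastforce
  show "(\<lambda>F. Node K (mset_set F)) ` {F \<in> child_sets G S K. \<not> excluded G K F} \<subseteq> trees G S K"
    using valid_NodeI[OF assms] by (auto simp: trees_def)
  show "(\<lambda>T. case T of Leaf i \<Rightarrow> {} | Node P C \<Rightarrow> set_mset C) ` trees G S K \<subseteq> {F \<in> child_sets G S K. \<not> excluded G K F}"
    using trees by fastforce
qed

lemma label_degree_lweight: "label_degree (lweight u K) = size (leaves u)"
proof (induction u arbitrary: K rule: ltree_induct)
  case (Node P C)
  have "label_degree (\<Sum>x\<in>#C. lweight (snd x) P) = (\<Sum>x\<in>#C. label_degree (lweight (snd x) P))"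
    by (induction C) (auto simp: mdeg_add)
  also have "\<dots> = (\<Sum>x\<in>#C. size (leaves (snd x)))"
    by (rule arg_cong[of _ _ sum_mset], rule image_mset_cong) (rule Node)
  also have "\<dots> = size (\<Sum>x\<in>#C. leaves (snd x))" by (induction C) auto
  finally show ?case by (simp add: lweight_Node leaves_Node)
qed simp

lemma valid_size:
  assumes "valid G S u" shows "size (leaves u) = card (leaf_set u)"
proof -
  have "leaves u = mset_set (leaf_set u)"
    by (rule iffD1[OF count_le_1_iff]) (use assms in \<open>simp add: valid_def\<close>)
  then have "size (leaves u) = size (mset_set (leaf_set u))" by (rule arg_cong)
  then show ?thesis by (simp only: size_mset_set)
qed

lemma num_Leaf:
  assumes wt: "\<And>i. wt (Leaf i :: 'l ltree) = w"
  shows "num leaf_set wt (range Leaf) M m = (if card M = 1 \<and> m = w then 1 else 0)"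
proof (cases "card M = 1")
  case True
  then obtain i where M: "M = {i}" by (meson card_1_singletonE)
  have "{u \<in> range Leaf. leaf_set u = M \<and> wt u = m} = {u. u = Leaf i \<and> m = w}"
    unfolding M
  proof (rule Collect_cong)
    fix u
    show "(u \<in> range Leaf \<and> leaf_set u = {i} \<and> wt u = m) = (u = Leaf i \<and> m = w)"
      by (cases u) (simp_all add: image_iff wt eq_commute[of m])
  qed
  then have "num leaf_set wt (range Leaf) M m = card {u :: 'l ltree. u = Leaf i \<and> m = w}"
    by (simp only: num_def)
  also have "\<dots> = (if m = w then 1 else 0)"
    by (cases "m = w") (simp_all only: simp_thms Collect_const if_False if_True card.empty, simp)
  finally show ?thesis using True by simp
next
  case False
  have "{u \<in> range Leaf. leaf_set u = M \<and> wt u = m} = {}"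
  proof (rule equals0I)
    fix u assume "u \<in> {u \<in> range Leaf. leaf_set u = M \<and> wt u = m}"
    then have "card M = 1" by (cases u) force+
    with False show False by simp
  qed
  then have "num leaf_set wt (range Leaf) M m = 0"
    by (simp only: num_def card.empty)
  then show ?thesis using False by simp
qed

lemma labelled_Leaf:
  assumes wt: "\<And>i. wt (Leaf i :: 'l ltree) = w" and "l w = 1"
  shows "labelled l leaf_set wt (range Leaf)"
proof (rule labelledI)
  fix M :: "nat set"
  have "{u \<in> range Leaf. leaf_set u = M} \<subseteq> Leaf ` M" by auto
  moreover assume "finite M"
  ultimately show "finite {u \<in> (range Leaf :: 'l ltree set). leaf_set u = M}" using finite_subset by blast
qed (use assms in \<open>auto simp: num_Leaf[of wt w, OF wt]\<close>)

lemma egf_Leaf: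
  assumes wt: "\<And>i. wt (Leaf i :: 'l ltree) = w" and "l w = 1"
  shows "egf l leaf_set wt (range Leaf) = mfps_monom 1 w"
  by (rule mfps_eqI) (use assms(2) in \<open>simp add: mfps_coeff_egf num_Leaf[of wt w, OF wt]\<close>)

lemma labelled_Leaf_lweight: "labelled label_degree leaf_set (\<lambda>u. lweight u K) (range Leaf)"
  by (rule labelled_Leaf[where w = "Poly_Mapping.single (tH_var K) 1"]) simp_all

lemma egf_Leaf_lweight:
  "egf label_degree leaf_set (\<lambda>u. lweight u K) (range Leaf) = mfps_var (tH_var K)"
  unfolding mfps_var_eq_monom by (rule egf_Leaf) simp_all

text \<open>The coefficients refer to the standard supports only, so neither part has to be
  invariant under relabelling.\<close>

lemma egf_split:
  assumes X: "labelled l supp wt X"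
  shows "egf l supp wt X = egf l supp wt {x \<in> X. P x} + egf l supp wt {x \<in> X. \<not> P x}"
proof (rule mfps_eqI)
  fix m
  have "num supp wt X M m = num supp wt {x \<in> X. P x} M m + num supp wt {x \<in> X. \<not> P x} M m" if M: "finite M" for M
  proof -
    have fin: "finite {x \<in> {x \<in> X. Q x}. supp x = M \<and> wt x = m}" for Q
      by (rule finite_subset[OF _ labelled_fin[OF X M]]) auto
    have "{x \<in> X. supp x = M \<and> wt x = m} =
        {x \<in> {x \<in> X. P x}. supp x = M \<and> wt x = m} \<union> {x \<in> {x \<in> X. \<not> P x}. supp x = M \<and> wt x = m}" by auto
    then have "num supp wt X M m = card ({x \<in> {x \<in> X. P x}. supp x = M \<and> wt x = m} \<union> {x \<in> {x \<in> X. \<not> P x}. supp x = M \<and> wt x = m})"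
      by (simp only: num_def)
    also have "\<dots> = num supp wt {x \<in> X. P x} M m + num supp wt {x \<in> X. \<not> P x} M m"
      unfolding num_def by (rule card_Un_disjoint[OF fin fin]) auto
    finally show ?thesis .
  qed
  then show "mfps_coeff (egf l supp wt X) m = mfps_coeff (egf l supp wt {x \<in> X. P x} + egf l supp wt {x \<in> X. \<not> P x}) m"
    by (simp add: mfps_coeff_egf add_divide_distrib)
qed

definition leaf_excluded :: "('g, 'm) monoid_scheme \<Rightarrow> 'g set \<Rightarrow> 'g set series" where
  "leaf_excluded G K = (if K = {\<one>\<^bsub>G\<^esub>} then mfps_var (tH_var K) else 0)"

locale tree_labels = group G for G :: "('g, 'm) monoid_scheme" (structure) +
  fixes S :: "'g set set"
  assumes finite_carrier: "finite (carrier G)" and subgroups: "\<And>K. K \<in> S \<Longrightarrow> subgroup K G"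
begin

lemma finite_S: "finite S"
proof (rule finite_subset)
  show "S \<subseteq> Pow (carrier G)" using subgroup.subset[OF subgroups] by blast
qed (simp add: finite_carrier)

lemma finite_label: "K \<in> S \<Longrightarrow> finite K"
  by (rule finite_subset[OF subgroup.subset[OF subgroups] finite_carrier])

lemma finite_rcosets: "finite (rcosets K)"
  unfolding RCOSETS_def using finite_carrier by simp

lemma base_in_rcosets: "base G K \<in> rcosets K"
  unfolding RCOSETS_def by blast

text \<open>A vertex with several children has fewer leaves below each of them, whereas along a
  chain of only children the labels strictly decrease. Hence the nested induction on the number of
  leaves and on the size of the root label.\<close>

lemma finite_trees:
  assumes "finite M"
  shows "finite {T. valid G S T \<and> leaf_set T = M}"
  using assms
proof (induction "card M" arbitrary: M rule: less_induct)
  case less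
  note M = \<open>finite M\<close> and IH = less.hyps
  have fin: "finite {T \<in> trees G S K. leaf_set T = M}" if "K \<in> S" for K
    using that
  proof (induction "card K" arbitrary: K rule: less_induct)
    case (less K)
    \<comment> \<open>Everything that may hang directly below a root labelled \<open>K\<close>:
      leaves, trees on fewer leaves, and trees on all of \<open>M\<close> with a smaller root
      label.\<close>
    let ?U = "Leaf ` M \<union> (\<Union>B\<in>{B. B \<subset> M}. {T. valid G S T \<and> leaf_set T = B}) \<union>
       (\<Union>P\<in>{P \<in> S. card P < card K}. {T \<in> trees G S P. leaf_set T = M})"
    have U: "finite ?U"
    proof (intro finite_UnI finite_UN_I)
      show "finite (Leaf ` M)" "finite {P \<in> S. card P < card K}" using M finite_S by simp_all
      show "finite {B. B \<subset> M}" by (rule finite_subset[of _ "Pow M"]) (use M in auto)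
      show "finite {T. valid G S T \<and> leaf_set T = B}" if "B \<in> {B. B \<subset> M}" for B
        using that M finite_subset[of B M] by (intro IH psubset_card_mono) blast+
      show "finite {T \<in> trees G S P. leaf_set T = M}" if "P \<in> {P \<in> S. card P < card K}" for P
        using that by (intro less.hyps) simp_all
    qed
    have "{T \<in> trees G S K. leaf_set T = M} \<subseteq> (\<lambda>F. Node K (mset_set F)) ` Pow ((rcosets K) \<times> ?U)"
    proof
      fix T assume "T \<in> {T \<in> trees G S K. leaf_set T = M}"
      then obtain C where T: "T = Node K C" "valid G S (Node K C)" and M: "leaf_set (Node K C) = M"
        by (auto simp: trees_def)
      let ?F = "set_mset C"
      note F = valid_Node_child_sets[OF T(2)]
      have conf: "?F \<in> configs pair_supp ((rcosets K) \<times> children G S K)"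
        using F(3) by (simp add: child_sets_def rooted_def)
      have snd: "snd x \<in> ?U" if x: "x \<in> ?F" for x
      proof -
        have vx: "valid G S (snd x)" by (rule valid_child[OF T(2) x])
        have sub: "leaf_set (snd x) \<subseteq> M" using x M by (auto simp: leaf_set_Node)
        show ?thesis
        proof (cases "leaf_set (snd x) = M")
          case False
          then have "leaf_set (snd x) \<in> {B. B \<subset> M}" using sub by blast
          then show ?thesis using vx by blast
        next
          case True
          have "y = x" if y: "y \<in> ?F" for y
          proof (rule ccontr)
            assume "y \<noteq> x"
            then have "leaf_set (snd x) \<inter> leaf_set (snd y) = {}"
              using conf x y disjoint_family_onD[of pair_supp ?F x y] by (simp add: configs_def)
            moreover have "leaf_set (snd y) \<subseteq> M" using y M by (auto simp: leaf_set_Node)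
            moreover have "leaf_set (snd y) \<noteq> {}" by (rule valid_leaf_set[OF valid_child[OF T(2) y]])
            ultimately show False using True by blast
          qed
          then have Fx: "?F = {x}" using x by blast
          show ?thesis
          proof (cases "snd x")
            case (Leaf i)
            then have "i \<in> M" using sub by simp
            then show ?thesis using Leaf by blast
          next
            case (Node P D)
            then have "?F = {(fst x, Node P D)}" using Fx by (metis prod.collapse)
            then have "P \<subset> K" using F(4) unfolding excluded_def by blast
            moreover have "P \<in> S" by (rule valid_Node_child_sets(1)[of G S P D]) (use vx Node in simp)
            ultimately have "P \<in> {P \<in> S. card P < card K}"
              using psubset_card_mono[OF finite_label[OF F(1)]] by blast
            moreover have "snd x \<in> {T \<in> trees G S P. leaf_set T = M}" using True vx Node unfolding trees_def by blast
            ultimately show ?thesis by blast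
          qed
        qed
      qed
      have "?F \<in> Pow ((rcosets K) \<times> ?U)"
      proof (intro PowI subsetI)
        fix x assume x: "x \<in> ?F"
        then have "fst x \<in> rcosets K" using conf by (auto simp: configs_def)
        with snd[OF x] show "x \<in> (rcosets K) \<times> ?U" unfolding mem_Times_iff by (rule conjI[rotated])
      qed
      then show "T \<in> (\<lambda>F. Node K (mset_set F)) ` Pow ((rcosets K) \<times> ?U)"
        by (rule rev_image_eqI) (simp only: T(1) F(2)[symmetric])
    qed
    then show ?case
      by (rule finite_subset) (intro finite_imageI iffD2[OF finite_Pow_iff] finite_cartesian_product finite_rcosets U)
  qed
  have "{T. valid G S T \<and> leaf_set T = M} \<subseteq> Leaf ` M \<union> (\<Union>K\<in>S. {T \<in> trees G S K. leaf_set T = M})"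
  proof
    fix T assume T: "T \<in> {T. valid G S T \<and> leaf_set T = M}"
    show "T \<in> Leaf ` M \<union> (\<Union>K\<in>S. {T \<in> trees G S K. leaf_set T = M})"
    proof (cases T)
      case (Node K C)
      then have "K \<in> S" using T valid_Node_child_sets(1) by blast
      then show ?thesis using T Node by (auto simp: trees_def)
    qed (use T in auto)
  qed
  then show ?case 
    by (rule finite_subset) (intro finite_UnI finite_imageI finite_UN_I fin finite_S M)
qed

text \<open>Relabelling along the increasing bijection of two supports is injective, since
  relabelling by the inverse map undoes it. Exchanging the supports gives the opposite
  inequality.\<close>

lemma labelled_relabel_closed:
  assumes U: "\<And>u. u \<in> U \<Longrightarrow> valid G S u"
    and closed: "\<And>u f. u \<in> U \<Longrightarrow> valid G S (relabel f u) \<Longrightarrow> relabel f u \<in> U"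
  shows "labelled label_degree leaf_set (\<lambda>u. lweight u K) U"
proof (rule labelledI)
  fix M :: "nat set" assume "finite M"
  from finite_trees[OF this] show "finite {u \<in> U. leaf_set u = M}"
    by (rule finite_subset[rotated]) (use U in auto)
next
  fix M M' :: "nat set" and m assume M: "finite M" "finite M'" "card M = card M'"
  let ?A = "\<lambda>M. {u \<in> U. leaf_set u = M \<and> lweight u K = m}"
  have "card (?A M) \<le> card (?A M')" if M: "finite M" "finite M'" "card M = card M'" for M M'
  proof -
    obtain f where f: "strict_mono_on M f" "f ` M = M'" using ex_strict_mono_on_bij[OF M] by blast
    have inj: "inj_on f M" using f(1) by (rule strict_mono_on_imp_inj_on)
    show ?thesis
    proof (rule card_inj_on_le[of "relabel f"])
      show "inj_on (relabel f) (?A M)"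
      proof (rule inj_on_inverseI[of _ "relabel (inv_into M f)"])
        fix u assume u: "u \<in> ?A M"
        show "relabel (inv_into M f) (relabel f u) = u"
          unfolding relabel_relabel by (rule relabel_id) (use u inj in auto)
      qed
      show "relabel f ` ?A M \<subseteq> ?A M'"
      proof (rule image_subsetI)
        fix u assume u: "u \<in> ?A M"
        then have "valid G S (relabel f u)" using f(1) U by (intro valid_relabel) auto
        then show "relabel f u \<in> ?A M'" using u closed f(2) by (auto simp: leaves_relabel lweight_relabel)
      qed
      show "finite (?A M')"
        by (rule finite_subset[OF _ finite_trees[OF M(2)]]) (use U in auto)
    qed
  qed
  from this[OF M] this[OF M(2) M(1) M(3)[symmetric]]
  show "num leaf_set (\<lambda>u. lweight u K) U M m = num leaf_set (\<lambda>u. lweight u K) U M' m"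
    unfolding num_def by (rule antisym)
qed (use U valid_size in \<open>auto simp: label_degree_lweight\<close>)

lemma labelled_trees: "labelled label_degree leaf_set (\<lambda>u. lweight u K) (trees G S P)"
  by (rule labelled_relabel_closed) (auto simp: trees_def)

lemma labelled_children: "labelled label_degree leaf_set (\<lambda>u. lweight u K) (children G S P)"
proof (rule labelled_relabel_closed)
  fix u f assume u: "u \<in> children G S P" "valid G S (relabel f u)"
  then show "relabel f u \<in> children G S P" by (cases u) (auto simp: children_def)
qed (simp add: children_def)

lemma lweight_trees: "u \<in> trees G S P \<Longrightarrow> lweight u K = lweight u K'"
  by (auto simp: trees_def lweight_Node)

lemma tree_series_weight: "egf label_degree leaf_set (\<lambda>u. lweight u K) (trees G S P) = tree_series G S P"
  unfolding tree_series_def by (rule egf_bij[where h = id]) (auto intro: lweight_trees)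

lemma egf_children:
  "egf label_degree leaf_set (\<lambda>u. lweight u K) (children G S K) =
    mfps_var (tH_var K) + (\<Sum>P\<in>{P \<in> S. P \<subseteq> K}. tree_series G S P)"
proof -
  let ?I = "{P \<in> S. P \<subseteq> K}"
  have eq: "children G S K = range Leaf \<union> (\<Union>P\<in>?I. trees G S P)"
  proof (intro equalityI subsetI)
    fix u assume u: "u \<in> children G S K"
    show "u \<in> range Leaf \<union> (\<Union>P\<in>?I. trees G S P)"
    proof (cases u)
      case (Node P D)
      then have "P \<in> S" using u valid_Node_child_sets(1) by (auto simp: children_def)
      then show ?thesis using u Node by (auto simp: children_def trees_def)
    qed auto
  qed (auto simp: children_def trees_def)
  have fin: "finite ?I" using finite_S by simp
  have disj: "disjoint_family_on (trees G S) ?I" by (auto simp: disjoint_family_on_def trees_def)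
  have "range Leaf \<inter> (\<Union>P\<in>?I. trees G S P) = {}" by (auto simp: trees_def)
  then show ?thesis
    unfolding eq
    by (subst egf_Un[OF labelled_Leaf_lweight labelled_UN[OF fin labelled_trees disj]])
      (simp_all add: egf_Leaf_lweight egf_UN[OF fin labelled_trees disj] tree_series_weight)
qed

text \<open>All normalised sets of children are counted by \<open>rooted_formula\<close>. The
  admissible ones correspond to the trees with root label \<open>K\<close>; the excluded ones are
  singletons formed from such a tree again, or from a leaf if \<open>K\<close> is trivial. This is
  the origin of the coefficient 2.\<close>

theorem tree_series_equation:
  assumes K: "K \<in> S"
  defines "g \<equiv> of_nat (card (rcosets K)) :: rat"
  shows "mfps_exp (mfps_const g * (mfps_var (tH_var K) + (\<Sum>P\<in>{P \<in> S. P \<subseteq> K}. tree_series G S P))) - 1 =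
    mfps_const g * (2 * tree_series G S K + leaf_excluded G K)"
proof -
  let ?w = "(\<lambda>u. lweight u K) \<circ> snd" and ?U = "children G S K"
  let ?Triv = "{base G K} \<times> ?U" and ?All = "(rcosets K) \<times> ?U"
  have lX: "labelled label_degree pair_supp ?w ?All"
    by (rule labelled_Times[OF finite_rcosets labelled_children])
  have lX0: "labelled label_degree pair_supp ?w ?Triv"
    by (rule labelled_Times[OF _ labelled_children]) simp
  have X0: "?Triv \<subseteq> ?All" using base_in_rcosets by auto
  interpret labelled_structures label_degree pair_supp ?w ?All
  proof
    fix x assume "x \<in> ?All"
    then have "valid G S (snd x)" by (auto simp: children_def)
    then show "pair_supp x \<noteq> {}" using valid_leaf_set[of G S "snd x"] by simp
  qed (auto simp: mdeg_add lX)
  have e0: "egf label_degree pair_supp ?w ?Triv = egf label_degree leaf_set (\<lambda>u. lweight u K) ?U"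
    by (subst egf_Times) simp_all
  have e1: "egf label_degree pair_supp ?w ?All = mfps_const g * egf label_degree leaf_set (\<lambda>u. lweight u K) ?U"
    unfolding g_def by (rule egf_Times[OF finite_rcosets])
  have R: "mfps_const g * egf label_degree cs cw (child_sets G S K) =
      mfps_exp (mfps_const g * (mfps_var (tH_var K) + (\<Sum>P\<in>{P \<in> S. P \<subseteq> K}. tree_series G S P))) - 1"
    unfolding child_sets_def
    by (subst rooted_formula[OF X0 lX0, of g]) (simp_all only: e0 e1 egf_children)
  have lR: "labelled label_degree cs cw (child_sets G S K)"
    unfolding child_sets_def by (rule labelled_rooted[OF X0 lX0])
  let ?good = "{F \<in> child_sets G S K. \<not> excluded G K F}" and ?bad = "{F \<in> child_sets G S K. excluded G K F}"
  have fin: "finite F" if "F \<in> child_sets G S K" for F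
    using that by (simp add: child_sets_def rooted_def configs_def)
  have good: "egf label_degree leaf_set (\<lambda>u. lweight u K) (trees G S K) = egf label_degree cs cw ?good"
    by (rule egf_bij[OF bij_betw_trees[OF K]])
      (simp_all add: fin leaf_set_Node_mset_set lweight_Node_mset_set)
  let ?L = "if K = {\<one>} then range Leaf else {}"
  let ?B = "trees G S K \<union> ?L"
  have B: "?B \<subseteq> ?U" by (auto simp: trees_def children_def)
  \<comment> \<open>An only child contains the smallest leaf, so its coset is forced to be trivial
    and an excluded set is determined by its subtree.\<close>
  have "?bad = (\<lambda>u. {(base G K, u)}) ` ?B"
  proof (intro equalityI subsetI)
    fix F assume F: "F \<in> ?bad"
    then obtain x where x: "F = {x}" by (auto simp: excluded_def)
    then have x': "fst x = base G K" "snd x \<in> ?U" using F by (auto simp: child_sets_def rooted_def configs_def)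
    have "snd x \<in> ?B" 
    proof (cases "snd x")
      case (Leaf i)
      then have "K = {\<one>}" using F x unfolding excluded_def by auto
      then show ?thesis using Leaf by auto
    next
      case (Node P D)
      then have "\<not> P \<subset> K" "P \<subseteq> K" using F x x'(2) unfolding excluded_def children_def by auto
      then have "P = K" by auto
      then show ?thesis using x'(2) Node by (auto simp: trees_def children_def)
    qed
    moreover have "F = {(base G K, snd x)}" using x x' by (metis prod.collapse)
    ultimately show "F \<in> (\<lambda>u. {(base G K, u)}) ` ?B" by blast
  next
    fix F assume "F \<in> (\<lambda>u. {(base G K, u)}) ` ?B"
    then obtain u where u: "u \<in> ?B" "F = {(base G K, u)}" by blast
    have uU: "u \<in> ?U" using u B by blast
    then have "leaf_set u \<noteq> {}" using valid_leaf_set[of G S u] by (simp add: children_def)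
    then have "Min (leaf_set u) \<in> leaf_set u" by (intro Min_in) auto
    then have "F \<in> child_sets G S K"
      using uU base_in_rcosets unfolding u(2)
      by (simp add: child_sets_def rooted_def configs_def csupp_def disjoint_family_on_def)
    moreover have "excluded G K F" using u by (auto simp: excluded_def trees_def split: if_splits)
    ultimately show "F \<in> ?bad" by simp
  qed
  then have "bij_betw (\<lambda>u. {(base G K, u)}) ?B ?bad"
    by (simp add: bij_betw_def inj_on_def)
  then have "(egf label_degree cs cw ?bad :: 'g set series) = egf label_degree leaf_set (\<lambda>u. lweight u K) ?B"
    by (rule egf_bij) (simp_all add: csupp_def)
  also have "\<dots> = egf label_degree leaf_set (\<lambda>u. lweight u K) (trees G S K) + egf label_degree leaf_set (\<lambda>u. lweight u K) ?L"
  proof (rule egf_Un[OF labelled_trees])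
    show "labelled label_degree leaf_set (\<lambda>u. lweight u K) ?L" by (simp add: labelled_Leaf_lweight labelled_empty)
    show "trees G S K \<inter> ?L = {}" by (auto simp: trees_def)
  qed
  also have "egf label_degree leaf_set (\<lambda>u. lweight u K) ?L = leaf_excluded G K"
    by (simp add: egf_Leaf_lweight egf_empty leaf_excluded_def)
  finally have bad: "egf label_degree cs cw ?bad = tree_series G S K + leaf_excluded G K"
    unfolding tree_series_weight .
  have "(egf label_degree cs cw (child_sets G S K) :: 'g set series) =
      egf label_degree cs cw ?bad + egf label_degree cs cw ?good"
    by (rule egf_split[OF lR])
  also have "\<dots> = 2 * tree_series G S K + leaf_excluded G K"
    unfolding bad good[symmetric] tree_series_weight by simp
  finally show ?thesis using R by simp
qed

end

section \<open>The series of H-trees\<close>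

lemma lweight_single_label:
  assumes "valid G {H} u"
  shows "lweight u H = Poly_Mapping.single (tH_var H) (size (leaves u))"
  using assms
proof (induction u rule: ltree_induct)
  case (Node K C)
  have K: "K = H" using valid_Node_child_sets(1)[OF Node.prems] by simp
  have "lweight (Node K C) H = (\<Sum>x\<in>#C. Poly_Mapping.single (tH_var H) (size (leaves (snd x))))"
    unfolding lweight_Node K
    by (rule arg_cong[of _ _ sum_mset], rule image_mset_cong) (rule Node.IH, assumption, rule valid_child[OF Node.prems])
  also have "\<dots> = Poly_Mapping.single (tH_var H) (size (leaves (Node K C)))"
    unfolding leaves_Node by (induction C) (auto simp: single_add)
  finally show ?case .
qed simp

lemma Node_vertices: "Node K C \<in> vertices T \<Longrightarrow> x \<in># C \<Longrightarrow> snd x \<in> vertices T"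
proof -
  assume "x \<in># C"
  then have "snd x \<in> vertices (Node K C)" unfolding vertices_Node using vertices_refl by blast
  then show "Node K C \<in> vertices T \<Longrightarrow> snd x \<in> vertices T" by (rule vertices_trans)
qed

lemma ok_vertex_Node:
  "ok_vertex G S (Node K C) \<longleftrightarrow> K \<in> S \<and> C \<noteq> {#} \<and>
     (\<forall>x\<in>#C. fst x \<in> rcosets\<^bsub>G\<^esub> K \<and> (Min (leaf_set (Node K C)) \<in> leaf_set (snd x) \<longrightarrow> fst x = base G K) \<and>
        (\<forall>P D. snd x = Node P D \<longrightarrow> P \<subseteq> K)) \<and>
     (\<forall>c P D. C = {#(c, Node P D)#} \<longrightarrow> P \<subset> K) \<and>
     (\<forall>c i. C = {#(c, Leaf i)#} \<longrightarrow> K \<noteq> {\<one>\<^bsub>G\<^esub>})"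
  unfolding ok_vertex_def by simp

text \<open>With the single label \<open>H\<close> the condition \<open>P \<subset> H\<close> cannot
  be met, so an only child has to be a leaf; for trivial \<open>H\<close> this is forbidden too,
  which leaves at least two children everywhere.\<close>

lemma H_trees_eq: "H_trees G H i = {T \<in> trees G {H} H. leaf_set T = {1..i}}"
proof (intro equalityI subsetI)
  fix T assume T: "T \<in> H_trees G H i"
  have on: "tree_on {1..i} T" and ex: "\<exists>K C. Node K C \<in> vertices T" and lab: "\<And>K C. Node K C \<in> vertices T \<Longrightarrow> K = H"
    and cos: "coset_edges G T" and one: "\<And>K c u. Node K {#(c, u)#} \<in> vertices T \<Longrightarrow> \<exists>l. u = Leaf l"
    and two: "\<And>K C. H = {\<one>\<^bsub>G\<^esub>} \<Longrightarrow> Node K C \<in> vertices T \<Longrightarrow> size C \<ge> 2"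
    using T unfolding H_trees_def by blast+
  have leaves: "leaves T = mset_set {1..i}" using on by (simp add: tree_on_def)
  have "ok_vertex G {H} v" if v: "v \<in> vertices T" for v
    unfolding ok_vertex_def
  proof (intro allI impI)
    fix K C assume vK: "v = Node K C"
    have K: "K = H" using lab v vK by simp
    have 1: "C \<noteq> {#}" using on v vK unfolding tree_on_def by blast
    have 2: "\<forall>x\<in>#C. fst x \<in> rcosets\<^bsub>G\<^esub> K \<and> (Min (leaf_set v) \<in> leaf_set (snd x) \<longrightarrow> fst x = base G K) \<and>
        (\<forall>P D. snd x = Node P D \<longrightarrow> P \<subseteq> K)"
    proof
      fix x assume x: "x \<in># C"
      have "fst x \<in> rcosets\<^bsub>G\<^esub> K \<and> (Min (leaf_set v) \<in> leaf_set (snd x) \<longrightarrow> fst x = base G K)"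
      proof -
        obtain c u where cu: "x = (c, u)" by (cases x)
        show ?thesis
          using cos[unfolded coset_edges_def, rule_format, OF v[unfolded vK] x[unfolded cu]] unfolding vK cu by simp
      qed
      moreover have "P \<subseteq> K" if "snd x = Node P D" for P D
        using lab[of P D] Node_vertices[of K C T x] v x that K vK by simp
      ultimately show "fst x \<in> rcosets\<^bsub>G\<^esub> K \<and> (Min (leaf_set v) \<in> leaf_set (snd x) \<longrightarrow> fst x = base G K) \<and>
        (\<forall>P D. snd x = Node P D \<longrightarrow> P \<subseteq> K)" by blast
    qed
    have 3: "P \<subset> K" if "C = {#(c, Node P D)#}" for c P D
      using one[of K c "Node P D"] v unfolding vK that by simp
    have 4: "K \<noteq> {\<one>\<^bsub>G\<^esub>}" if "C = {#(c, Leaf i)#}" for c i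
    proof
      assume "K = {\<one>\<^bsub>G\<^esub>}"
      then have "size C \<ge> 2" using two[of K C] v vK K by simp
      then show False using that by simp
    qed
    show "K \<in> {H} \<and> C \<noteq> {#} \<and>
     (\<forall>x\<in>#C. fst x \<in> rcosets\<^bsub>G\<^esub> K \<and> (Min (leaf_set v) \<in> leaf_set (snd x) \<longrightarrow> fst x = base G K) \<and>
        (\<forall>P D. snd x = Node P D \<longrightarrow> P \<subseteq> K)) \<and>
     (\<forall>c P D. C = {#(c, Node P D)#} \<longrightarrow> P \<subset> K) \<and> (\<forall>c i. C = {#(c, Leaf i)#} \<longrightarrow> K \<noteq> {\<one>\<^bsub>G\<^esub>})"
      using K 1 2 3 4 by (intro conjI) (simp, assumption, assumption, blast, blast)
  qed
  moreover have "\<forall>i. count (leaves T) i \<le> 1" by (simp add: leaves count_mset_set')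
  ultimately have "valid G {H} T" unfolding valid_def by blast
  moreover have "\<exists>C. T = Node H C"
  proof (cases T)
    case (Node K C)
    then show ?thesis using lab[of K C] by simp
  qed (use ex in auto)
  ultimately show "T \<in> {T \<in> trees G {H} H. leaf_set T = {1..i}}" by (simp add: trees_def leaves)
next
  fix T assume "T \<in> {T \<in> trees G {H} H. leaf_set T = {1..i}}"
  then obtain C0 where V: "valid G {H} T" and T: "T = Node H C0" and ls: "leaf_set T = {1..i}"
    by (auto simp: trees_def)
  have ok: "ok_vertex G {H} v" if "v \<in> vertices T" for v using V that by (simp add: valid_def)
  have okN: "K = H" "C \<noteq> {#}"
     "\<And>x. x \<in># C \<Longrightarrow> fst x \<in> rcosets\<^bsub>G\<^esub> K"
     "\<And>x. x \<in># C \<Longrightarrow> Min (leaf_set (Node K C)) \<in> leaf_set (snd x) \<Longrightarrow> fst x = base G K"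
     "\<And>c P D. C = {#(c, Node P D)#} \<Longrightarrow> P \<subset> K" "\<And>c i. C = {#(c, Leaf i)#} \<Longrightarrow> K \<noteq> {\<one>\<^bsub>G\<^esub>}"
    if "Node K C \<in> vertices T" for K C
    using ok[OF that] unfolding ok_vertex_Node by blast+
  have one: "\<exists>l. u = Leaf l" if v: "Node K {#(c, u)#} \<in> vertices T" for K c u
  proof (cases u)
    case (Node P D)
    have "u \<in> vertices T" using Node_vertices[OF v, of "(c, u)"] by simp
    then have "P = H" "K = H" using okN(1) Node v by blast+
    then show ?thesis using okN(5)[OF v] Node by blast
  qed simp
  have "leaves T = mset_set {1..i}"
    unfolding ls[symmetric] by (rule iffD1[OF count_le_1_iff]) (use V in \<open>simp add: valid_def\<close>)
  moreover have root: "\<exists>K C. Node K C \<in> vertices T" using vertices_refl[of T] unfolding T by blast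
  ultimately have "tree_on {1..i} T" using okN(2) by (simp add: tree_on_def)
  moreover have "coset_edges G T" unfolding coset_edges_def
  proof (intro allI impI)
    fix K C assume v: "Node K C \<in> vertices T"
    show "\<forall>(c, u)\<in>#C. c \<in> rcosets\<^bsub>G\<^esub> K \<and> (Min (leaf_set (Node K C)) \<in> leaf_set u \<longrightarrow> c = base G K)"
      using okN(3,4)[OF v] by auto
  qed
  moreover have "size C \<ge> 2" if H: "H = {\<one>\<^bsub>G\<^esub>}" and v: "Node K C \<in> vertices T" for K C
  proof (rule ccontr)
    assume "\<not> size C \<ge> 2"
    moreover have "size C \<noteq> 0" using okN(2)[OF v] by simp
    ultimately have "size C = 1" by linarith
    then obtain x where x: "C = {#x#}" by (meson size_1_singleton_mset)
    obtain c u where cu: "x = (c, u)" by (cases x)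
    obtain l where "u = Leaf l" using one v x cu by blast
    then show False using okN(1,6)[OF v] H x cu by blast
  qed
  ultimately show "T \<in> H_trees G H i"
    unfolding H_trees_def mem_Collect_eq using one okN(1) root by (intro conjI) blast+
qed

lemma inj_on_single: "inj_on (Poly_Mapping.single x) A"
  by (rule inj_onI) (metis lookup_single_eq)

lemma lambda_series_monoms: "lambda_series G H = mfps_sum
    (\<lambda>i. mfps_monom (of_nat (card (H_trees G H i)) / fact i) (Poly_Mapping.single (tH_var H) i)) {1..}"
  unfolding lambda_series_def mfps_var_power mfps_const_eq_monom mfps_monom_mult by simp

text \<open>With a single label the weight of a tree is the power of \<open>t_H\<close> given by its
  number of leaves. Exponent 0 is missing on both sides because every tree has a leaf.\<close>

lemma lambda_series_eq: "lambda_series G H = tree_series G {H} H"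
proof (rule mfps_eqI)
  fix m
  let ?c = "\<lambda>i. rat_of_nat (card (H_trees G H i)) / fact i" and ?\<mu> = "\<lambda>i. Poly_Mapping.single (tH_var H) i"
  note co = mfps_coeff_sum_monom[OF inj_on_single[of "tH_var H" "{1..}"], of _ ?c, unfolded lambda_series_monoms[symmetric]]
  have co': "mfps_coeff (tree_series G {H} H) m =
      of_nat (card {T \<in> trees G {H} H. leaf_set T = {1..label_degree m} \<and> lweight T H = m}) / fact (label_degree m)"
    by (simp add: tree_series_def mfps_coeff_egf num_def)
  have w: "lweight T H = ?\<mu> (card (leaf_set T))" "leaf_set T \<noteq> {}" if "T \<in> trees G {H} H" for T
  proof -
    have V: "valid G {H} T" using that by (simp add: trees_def)
    show "lweight T H = ?\<mu> (card (leaf_set T))" using lweight_single_label[OF V] valid_size[OF V] by (simp only:)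
    show "leaf_set T \<noteq> {}" by (rule valid_leaf_set[OF V])
  qed
  show "mfps_coeff (lambda_series G H) m = mfps_coeff (tree_series G {H} H) m"
  proof (cases "m \<in> ?\<mu> ` {1..}")
    case True
    then obtain i where i: "i \<ge> 1" "m = ?\<mu> i" by auto
    have "{T \<in> trees G {H} H. leaf_set T = {1..i} \<and> lweight T H = ?\<mu> i} = {T \<in> trees G {H} H. leaf_set T = {1..i}}"
      using w(1) by auto
    then have "{T \<in> trees G {H} H. leaf_set T = {1..i} \<and> lweight T H = ?\<mu> i} = H_trees G H i"
      by (simp only: H_trees_eq)
    then have "mfps_coeff (tree_series G {H} H) m = ?c i"
      by (subst co') (simp add: i(2))
    then show ?thesis using co(1)[of i] i by simp
  next
    case False
    have "{T \<in> trees G {H} H. leaf_set T = {1..label_degree m} \<and> lweight T H = m} = {}"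
    proof (rule equals0I)
      fix T assume "T \<in> {T \<in> trees G {H} H. leaf_set T = {1..label_degree m} \<and> lweight T H = m}"
      then have T: "T \<in> trees G {H} H" "m = ?\<mu> (card (leaf_set T))" using w(1) by auto
      have "card (leaf_set T) > 0"
        by (rule iffD2[OF card_gt_0_iff]) (rule conjI[OF w(2)[OF T(1)] finite_set_mset])
      then have "card (leaf_set T) \<in> {1..}" by simp
      then show False using False T(2) by blast
    qed
    then have "mfps_coeff (tree_series G {H} H) m = 0" unfolding co' by (simp only: card.empty of_nat_0 div_0)
    then show ?thesis using co(2)[OF False] by simp
  qed
qed

lemma lambda_series_coeff:
  assumes "mfps_coeff (lambda_series G H) m \<noteq> 0"
  shows "\<exists>i\<ge>1. m = Poly_Mapping.single (tH_var H) i"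
proof -
  have "m \<in> Poly_Mapping.single (tH_var H) ` {1..}"
    by (rule ccontr) (use assms in \<open>simp add: lambda_series_monoms mfps_coeff_sum_monom(2)[OF inj_on_single]\<close>)
  then show ?thesis by auto
qed

section \<open>Solutions of the tree equations\<close>

text \<open>The vanishing constant terms belong to the notion of a solution: the exponential and the
  uniqueness argument both depend on them.\<close>

definition solves :: "('g, 'm) monoid_scheme \<Rightarrow> 'g set set \<Rightarrow> ('g set \<Rightarrow> 'g set series) \<Rightarrow> bool" where
  "solves G S T \<longleftrightarrow> (\<forall>K\<in>S. mfps_coeff (T K) 0 = 0 \<and>
     (let g = mfps_const (of_nat (card (rcosets\<^bsub>G\<^esub> K))) in
      mfps_exp (g * (mfps_var (tH_var K) + (\<Sum>P\<in>{P \<in> S. P \<subseteq> K}. T P))) - 1 = g * (2 * T K + leaf_excluded G K)))"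

context tree_labels begin

lemma tree_series_coeff_0: "mfps_coeff (tree_series G S K) 0 = 0"
proof -
  have "{T \<in> trees G S K. leaf_set T = {} \<and> lweight T K = 0} = {}"
    using valid_leaf_set by (fastforce simp: trees_def)
  then have "num leaf_set (\<lambda>u. lweight u K) (trees G S K) {} 0 = 0" by (simp only: num_def card.empty)
  then show ?thesis by (simp add: tree_series_def mfps_coeff_egf)
qed

lemma tree_series_solves: "solves G S (tree_series G S)"
  unfolding solves_def Let_def using tree_series_coeff_0 tree_series_equation by blast

lemma card_rcosets_pos: "card (rcosets K) > 0"
  using finite_rcosets base_in_rcosets by (auto simp: card_gt_0_iff)

text \<open>The equation of \<open>K\<close> involves only labels contained in \<open>K\<close>. By
  induction on the size of \<open>K\<close> those strictly inside are determined, and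
  \<open>tree_equation_unique\<close> settles the remaining unknown.\<close>

lemma solves_unique:
  assumes T: "solves G S T" and T': "solves G S T'" and K: "K \<in> S"
  shows "T K = T' K"
  using K
proof (induction "card K" arbitrary: K rule: less_induct)
  case (less K)
  let ?Y = "mfps_var (tH_var K) + (\<Sum>P\<in>{P \<in> S. P \<subset> K}. T P)"
  have eq: "{P \<in> S. P \<subseteq> K} = insert K {P \<in> S. P \<subset> K}" using less.prems by auto
  have sum: "mfps_var (tH_var K) + (\<Sum>P\<in>{P \<in> S. P \<subseteq> K}. U P) = mfps_var (tH_var K) + (\<Sum>P\<in>{P \<in> S. P \<subset> K}. U P) + U K" for U :: "'g set \<Rightarrow> 'g set series"
    unfolding eq using finite_S by (subst sum.insert) (auto simp: algebra_simps)
  have Y: "(\<Sum>P\<in>{P \<in> S. P \<subset> K}. T' P) = (\<Sum>P\<in>{P \<in> S. P \<subset> K}. T P)"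
  proof (rule sum.cong)
    fix P assume P: "P \<in> {P \<in> S. P \<subset> K}"
    then have "card P < card K" using finite_label[OF less.prems] by (simp add: psubset_card_mono)
    then show "T' P = T P" using less.hyps P by simp
  qed simp
  show ?case
  proof (rule tree_equation_unique[where g = "of_nat (card (rcosets K))" and Y = ?Y and c = "leaf_excluded G K"])
    show "rat_of_nat (card (rcosets K)) \<noteq> 0" using card_rcosets_pos[of K] by simp
    show "mfps_coeff ?Y 0 = 0" using T by (simp add: solves_def)
    show "mfps_coeff (T K) 0 = 0" "mfps_coeff (T' K) 0 = 0" using T T' less.prems by (simp_all add: solves_def)
    show "mfps_exp (mfps_const (of_nat (card (rcosets K))) * (?Y + T K)) - 1 =
        mfps_const (of_nat (card (rcosets K))) * (2 * T K + leaf_excluded G K)"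
      using bspec[OF T[unfolded solves_def Let_def] less.prems] unfolding sum by blast
    show "mfps_exp (mfps_const (of_nat (card (rcosets K))) * (?Y + T' K)) - 1 =
        mfps_const (of_nat (card (rcosets K))) * (2 * T' K + leaf_excluded G K)"
      using bspec[OF T'[unfolded solves_def Let_def] less.prems] unfolding sum Y by blast
  qed
qed

end

section \<open>The operator product\<close>

lemma lambda_series_coeff_0: "mfps_coeff (lambda_series G H) 0 = 0"
proof (rule ccontr)
  assume "mfps_coeff (lambda_series G H) 0 \<noteq> 0"
  then obtain i :: nat where "i \<ge> 1" "0 = Poly_Mapping.single (tH_var H) i"
    using lambda_series_coeff[of G H 0] by blast
  from this(1) arg_cong[OF this(2), of "\<lambda>p. Poly_Mapping.lookup p (tH_var H)"] show False by simp
qed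

text \<open>As \<open>\<lambda>_H\<close> involves no variable but \<open>t_H\<close>, it is killed
  by the derivation in \<open>s_H\<close>, which differentiates only in the \<open>t_K\<close> with
  \<open>H \<subset> K\<close>. This is the hypothesis \<open>d l = 0\<close> of the
  substitution.\<close>

lemma mfps_deriv_lambda_series:
  assumes "K \<noteq> H" shows "mfps_deriv (tH_var K) (lambda_series G H) = 0"
proof (rule mfps_eqI)
  fix m
  have "mfps_coeff (lambda_series G H) (m + Poly_Mapping.single (tH_var K) 1) = 0"
  proof (rule ccontr)
    assume "mfps_coeff (lambda_series G H) (m + Poly_Mapping.single (tH_var K) 1) \<noteq> 0"
    then obtain i where "m + Poly_Mapping.single (tH_var K) 1 = Poly_Mapping.single (tH_var H) i"
      using lambda_series_coeff by blast
    from arg_cong[OF this, of "\<lambda>p. Poly_Mapping.lookup p (tH_var K)"] assms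
    show False by (simp add: lookup_add lookup_single)
  qed
  then show "mfps_coeff (mfps_deriv (tH_var K) (lambda_series G H)) m = mfps_coeff 0 m"
    by (simp add: mfps_coeff_deriv)
qed

text \<open>Induction along the enumeration from its end. The family is claimed only to solve the
  system, since this property survives the substitution; its combinatorial meaning is recovered by a
  single appeal to uniqueness, for the full label set.\<close>

lemma foldr_exp_op:
  fixes G :: "('g, 'm) monoid_scheme"
  assumes "group G" "finite (carrier G)"
    and sg: "\<And>K. K \<in> proper_closed G \<rho> \<Longrightarrow> subgroup K G"
    and "distinct Hs" "set Hs \<subseteq> proper_closed G \<rho>" "sorted_wrt (\<lambda>A B. \<not> B \<subset> A) Hs"
  shows "\<exists>T. solves G (set Hs) T \<and>
    foldr (exp_op G \<rho>) Hs 1 = mfps_exp (mfps_var s_var * (\<Sum>K\<in>set Hs. T K))"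
  using assms(4-6)
proof (induction Hs)
  case Nil
  show ?case by (simp add: solves_def)
next
  case (Cons H Hs)
  let ?S = "set Hs"
  obtain T where T: "solves G ?S T"
    and prod: "foldr (exp_op G \<rho>) Hs 1 = mfps_exp (mfps_var s_var * (\<Sum>K\<in>?S. T K))"
    using Cons.IH Cons.prems by auto
  have H: "H \<in> proper_closed G \<rho>" "H \<notin> ?S" using Cons.prems by auto
  have S: "\<And>K. K \<in> ?S \<Longrightarrow> K \<in> proper_closed G \<rho>" "\<And>K. K \<in> ?S \<Longrightarrow> \<not> K \<subset> H"
    using Cons.prems by auto
  let ?J = "{K \<in> proper_closed G \<rho>. H \<subset> K}"
  have fin: "finite (proper_closed G \<rho>)"
  proof (rule finite_subset)
    show "proper_closed G \<rho> \<subseteq> Pow (carrier G)" using subgroup.subset[OF sg] by blast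
  qed (simp add: assms(2))
  define d where "d = (\<lambda>f :: 'g set series. \<Sum>K\<in>?J. mfps_deriv (tH_var K) f)"
  define l where "l = lambda_series G H"
  have d_var: "d (mfps_var (tH_var K)) = (if K \<in> ?J then 1 else 0)" for K
    unfolding d_def mfps_deriv_var using fin by (simp add: sum.delta)
  have d_s: "d (mfps_var s_var) = 0" unfolding d_def mfps_deriv_var by simp
  interpret taylor_shift d l
  proof
    show "is_derivation d" unfolding d_def by (rule is_derivation_sum) (rule is_derivation_mfps_deriv)
    show "mfps_coeff l 0 = 0" unfolding l_def by (rule lambda_series_coeff_0)
    show "d l = 0" unfolding d_def l_def by (rule sum.neutral) (auto intro: mfps_deriv_lambda_series)
  qed
  interpret single: tree_labels G "{H}"
    using assms(1,2) sg[OF H(1)] by (simp add: tree_labels_def tree_labels_axioms_def)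
  \<comment> \<open>The solution for the enlarged label set: the substitution applied to the old
    solution, and at \<open>H\<close> the one-label series, which the substitution fixes.\<close>
  define T' where "T' = (\<lambda>K. if K = H then l else shift (T K))"
  have T'_S: "sum T' A = (\<Sum>K\<in>A. shift (T K))" if "A \<subseteq> ?S" for A
    by (rule sum.cong) (use that H(2) in \<open>auto simp: T'_def\<close>)
  have T0: "mfps_coeff (T K) 0 = 0"
    and eq: "mfps_exp (mfps_const (of_nat (card (rcosets\<^bsub>G\<^esub> K))) * (mfps_var (tH_var K) + (\<Sum>P\<in>{P \<in> ?S. P \<subseteq> K}. T P))) - 1 =
      mfps_const (of_nat (card (rcosets\<^bsub>G\<^esub> K))) * (2 * T K + leaf_excluded G K)" if "K \<in> ?S" for K
    using bspec[OF T[unfolded solves_def Let_def] that] by blast+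
  have shift_tH: "shift (mfps_var (tH_var K)) = mfps_var (tH_var K) + (if K \<in> ?J then l else 0)" for K
  proof (cases "K \<in> ?J")
    case True
    then have "d (mfps_var (tH_var K)) = 1" unfolding d_var by simp
    from shift_var[OF this] show ?thesis using True by simp
  next
    case False
    then have "d (mfps_var (tH_var K)) = 0" unfolding d_var by (simp only: if_False)
    from shift_fixed[OF this] show ?thesis unfolding if_not_P[OF False] by simp
  qed
  have "solves G (set (H # Hs)) T'"
    unfolding solves_def Let_def
  proof
    fix K assume "K \<in> set (H # Hs)"
    then consider "K = H" | "K \<in> ?S" "K \<noteq> H" using H(2) by auto
    then show "mfps_coeff (T' K) 0 = 0 \<and>
      mfps_exp (mfps_const (of_nat (card (rcosets\<^bsub>G\<^esub> K))) * (mfps_var (tH_var K) + (\<Sum>P\<in>{P \<in> set (H # Hs). P \<subseteq> K}. T' P))) - 1 =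
      mfps_const (of_nat (card (rcosets\<^bsub>G\<^esub> K))) * (2 * T' K + leaf_excluded G K)"
    proof cases
      case 1
      have TH: "T' H = tree_series G {H} H" by (simp only: T'_def l_def lambda_series_eq if_True simp_thms)
      \<comment> \<open>No label of the tail lies strictly below \<open>H\<close>, so the equation
        of \<open>H\<close> is the one-label equation.\<close>
      have "{P \<in> set (H # Hs). P \<subseteq> H} = {H}" using S(2) H(2) by auto
      then have s1: "(\<Sum>P\<in>{P \<in> set (H # Hs). P \<subseteq> H}. T' P) = tree_series G {H} H" by (simp add: TH)
      have "{P \<in> {H}. P \<subseteq> H} = {H}" by auto
      then have s2: "(\<Sum>P\<in>{P \<in> {H}. P \<subseteq> H}. tree_series G {H} P) = tree_series G {H} H" by simp
      show ?thesis
        unfolding 1 s1 TH using single.tree_series_equation[OF singletonI] single.tree_series_coeff_0 unfolding s2 by blast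
    next
      case 2
      let ?g = "mfps_const (of_nat (card (rcosets\<^bsub>G\<^esub> K))) :: 'g set series"
      let ?Y = "mfps_var (tH_var K) + (\<Sum>P\<in>{P \<in> ?S. P \<subseteq> K}. T P)"
      have J: "K \<in> ?J \<longleftrightarrow> H \<subseteq> K" using 2 S(1) by auto
      have "(\<Sum>P\<in>{P \<in> set (H # Hs). P \<subseteq> K}. T' P) = (if H \<subseteq> K then l else 0) + (\<Sum>P\<in>{P \<in> ?S. P \<subseteq> K}. shift (T P))"
      proof (cases "H \<subseteq> K")
        case True
        then have "{P \<in> set (H # Hs). P \<subseteq> K} = insert H {P \<in> ?S. P \<subseteq> K}" by auto
        then show ?thesis using True H(2) T'_S[of "{P \<in> ?S. P \<subseteq> K}"] by (simp add: T'_def)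
      next
        case False
        then have "{P \<in> set (H # Hs). P \<subseteq> K} = {P \<in> ?S. P \<subseteq> K}" by auto
        then show ?thesis using False T'_S[of "{P \<in> ?S. P \<subseteq> K}"] by simp
      qed
      \<comment> \<open>The substitution adds \<open>l\<close> to \<open>t_K\<close> exactly when
        \<open>H \<subseteq> K\<close>, that is, when \<open>T' H\<close> joins the sum; the whole
        argument of the exponential is thus a shifted one.\<close>
      then have Y: "mfps_var (tH_var K) + (\<Sum>P\<in>{P \<in> set (H # Hs). P \<subseteq> K}. T' P) = shift ?Y"
        unfolding shift_add shift_sum shift_tH J by (simp add: add.assoc)
      have "mfps_coeff (?g * ?Y) 0 = 0" using T0 by simp
      then have E1: "shift (mfps_exp (?g * ?Y) - 1) = mfps_exp (?g * shift ?Y) - 1"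
        by (simp only: shift_diff shift_1 shift_exp shift_mult shift_const)
      have E2: "shift (?g * (2 * T K + leaf_excluded G K)) = ?g * (2 * shift (T K) + leaf_excluded G K)"
      proof -
        \<comment> \<open>The extra term is nonzero only for trivial \<open>K\<close>, and the
          trivial subgroup contains no label properly, so its variable is not shifted.\<close>
        have "d (leaf_excluded G K) = 0"
        proof (cases "K = {\<one>\<^bsub>G\<^esub>}")
          case True
          have "\<one>\<^bsub>G\<^esub> \<in> H" using sg[OF H(1)] by (rule subgroup.one_closed)
          then have "K \<notin> ?J" unfolding True by blast
          then have "d (mfps_var (tH_var K)) = 0" unfolding d_var by (rule if_not_P)
          then show ?thesis using True by (simp add: leaf_excluded_def)
        qed (simp add: leaf_excluded_def d_0)
        then have "shift (leaf_excluded G K) = leaf_excluded G K" by (rule shift_fixed)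
        moreover have "shift 2 = 2" by (simp only: one_add_one[symmetric] shift_add shift_1)
        ultimately show ?thesis by (simp only: shift_mult shift_const shift_add)
      qed
      have "T' K = shift (T K)" using 2(2) by (simp add: T'_def)
      moreover have "mfps_exp (?g * shift ?Y) - 1 = ?g * (2 * shift (T K) + leaf_excluded G K)"
        unfolding E1[symmetric] E2[symmetric] by (rule arg_cong[OF eq[OF 2(1)]])
      ultimately show ?thesis
        unfolding Y using shift_coeff_0[OF T0[OF 2(1)]] by (simp only: simp_thms)
    qed
  qed
  moreover have "foldr (exp_op G \<rho>) (H # Hs) 1 = mfps_exp (mfps_var s_var * (\<Sum>K\<in>set (H # Hs). T' K))"
  proof -
    have "exp_op G \<rho> H f = exp_sum (\<lambda>q. l ^ q * ((\<lambda>f. mfps_var s_var * f + d f) ^^ q) f)" for f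
    proof -
      have "s_op G \<rho> H = (\<lambda>f. mfps_var s_var * f + d f)" by (rule ext) (simp add: s_op_def d_def)
      then show ?thesis by (simp add: exp_op_def exp_sum_def l_def)
    qed
    then have "foldr (exp_op G \<rho>) (H # Hs) 1 = mfps_exp (mfps_var s_var * l) * shift (mfps_exp (mfps_var s_var * (\<Sum>K\<in>?S. T K)))"
      using exp_shifted_derivation[OF d_s] prod by simp
    also have "shift (mfps_exp (mfps_var s_var * (\<Sum>K\<in>?S. T K))) = mfps_exp (mfps_var s_var * (\<Sum>K\<in>?S. shift (T K)))"
      by (subst shift_exp) (simp_all add: shift_mult shift_sum shift_fixed[OF d_s])
    also have "mfps_exp (mfps_var s_var * l) * \<dots> = mfps_exp (mfps_var s_var * l + mfps_var s_var * (\<Sum>K\<in>?S. shift (T K)))"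
      by (rule mfps_exp_add[symmetric]) simp_all
    also have "\<dots> = mfps_exp (mfps_var s_var * (\<Sum>K\<in>set (H # Hs). T' K))"
      using H(2) T'_S[OF subset_refl] by (simp add: T'_def distrib_left)
    finally show ?thesis .
  qed
  ultimately show ?case by blast
qed

section \<open>Forests\<close>

definition type_monomial :: "'h set \<Rightarrow> nat \<Rightarrow> nat \<Rightarrow> ('h \<Rightarrow> nat) \<Rightarrow> ('h series_var \<Rightarrow>\<^sub>0 nat)" where
  "type_monomial S j h a = Poly_Mapping.single s_var j + Poly_Mapping.single t_var h +
     (\<Sum>H\<in>S. Poly_Mapping.single (tH_var H) (a H))"

lemma lookup_type_monomial:
  assumes "finite S"
  shows "Poly_Mapping.lookup (type_monomial S j h a) s_var = j"
    "Poly_Mapping.lookup (type_monomial S j h a) t_var = h"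
    "Poly_Mapping.lookup (type_monomial S j h a) (tH_var H) = (if H \<in> S then a H else 0)"
proof -
  have "(\<Sum>K\<in>S. if H = K then a K else 0) = (if H \<in> S then a H else 0)"
    using assms by (rule sum.delta')
  then show "Poly_Mapping.lookup (type_monomial S j h a) (tH_var H) = (if H \<in> S then a H else 0)"
    by (simp add: type_monomial_def lookup_add lookup_sum lookup_single when_def eq_commute)
qed (simp_all add: type_monomial_def lookup_add lookup_sum lookup_single)

lemma type_monomial_eq_iff:
  assumes "finite S"
  shows "type_monomial S j h a = type_monomial S j' h' a' \<longleftrightarrow> j = j' \<and> h = h' \<and> (\<forall>H\<in>S. a H = a' H)"
proof
  assume eq: "type_monomial S j h a = type_monomial S j' h' a'"
  have "a H = a' H" if "H \<in> S" for H
    using arg_cong[OF eq, of "\<lambda>m. Poly_Mapping.lookup m (tH_var H)"] that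
    by (simp add: lookup_type_monomial[OF assms])
  moreover have "j = j'"
    using arg_cong[OF eq, of "\<lambda>m. Poly_Mapping.lookup m s_var"] by (simp add: lookup_type_monomial[OF assms])
  moreover have "h = h'"
    using arg_cong[OF eq, of "\<lambda>m. Poly_Mapping.lookup m t_var"] by (simp add: lookup_type_monomial[OF assms])
  ultimately show "j = j' \<and> h = h' \<and> (\<forall>H\<in>S. a H = a' H)" by blast
qed (simp add: type_monomial_def)

lemma label_degree_type_monomial: "label_degree (type_monomial S j h a) = h + (\<Sum>H\<in>S. a H)"
  by (simp add: type_monomial_def mdeg_add mdeg_sum)

lemma prod_vars:
  assumes "finite S"
  shows "(\<Prod>H\<in>S. mfps_var (tH_var H) ^ a H) =
    (mfps_monom 1 (\<Sum>H\<in>S. Poly_Mapping.single (tH_var H) (a H)) :: ('h series_var, 'a::comm_ring_1) mfps)"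
  using assms by (induction S rule: finite_induct) (simp_all add: one_eq_monom mfps_var_power mfps_monom_mult)

lemma type_monomial_term:
  assumes "finite S"
  shows "mfps_const c * mfps_var s_var ^ j * (mfps_var t_var ^ h * (\<Prod>H\<in>S. mfps_var (tH_var H) ^ a H)) =
    (mfps_monom c (type_monomial S j h a) :: 'h series)"
  unfolding prod_vars[OF assms] unfolding mfps_var_power mfps_const_eq_monom mfps_monom_mult type_monomial_def
  by (simp add: add.assoc)

section \<open>Leaves by the label of their parent\<close>

definition leaves_of :: "'l ltree \<Rightarrow> 'l \<Rightarrow> nat set" where
  "leaves_of T H = {i. \<exists>C c. Node H C \<in> vertices T \<and> (c, Leaf i) \<in># C}"

text \<open>Counterpart of \<open>lweight\<close>: a leaf is credited to the label \<open>K\<close>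
  of the vertex above it, so that the contributions of the children form the disjoint union
  \<open>leaves_of\<close> of the parent.\<close>

definition child_leaves :: "'l ltree \<Rightarrow> 'l \<Rightarrow> 'l \<Rightarrow> nat set" where
  "child_leaves u K H = (case u of Leaf i \<Rightarrow> if K = H then {i} else {} | Node P D \<Rightarrow> leaves_of u H)"

lemma leaves_below_eq: "leaves_below F H = (\<Union>T\<in>F. leaves_of T H)"
  by (auto simp: leaves_below_def leaves_of_def)

lemma leaves_of_Leaf [simp]: "leaves_of (Leaf i) H = {}"
  by (simp add: leaves_of_def)

lemma leaves_of_subset: "leaves_of T H \<subseteq> leaf_set T"
proof
  fix i assume "i \<in> leaves_of T H"
  then obtain C c where C: "Node H C \<in> vertices T" "(c, Leaf i) \<in># C" by (auto simp: leaves_of_def)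
  have "i \<in> leaf_set (Node H C)" unfolding leaf_set_Node using C(2) by force
  then show "i \<in> leaf_set T" using leaf_set_vertices[OF C(1)] by blast
qed

lemma child_leaves_subset: "child_leaves u K H \<subseteq> leaf_set u"
  by (cases u) (simp_all only: child_leaves_def ltree.case leaves_of_subset, simp)

lemma finite_leaves_of: "finite (leaves_of T H)"
  by (rule finite_subset[OF leaves_of_subset]) simp

lemma finite_child_leaves: "finite (child_leaves u K H)"
  by (rule finite_subset[OF child_leaves_subset]) simp

lemma leaves_of_Node: "leaves_of (Node P C) H = (\<Union>x\<in>set_mset C. child_leaves (snd x) P H)"
proof (intro equalityI subsetI)
  fix i assume "i \<in> leaves_of (Node P C) H"
  then obtain C' c where C': "Node H C' \<in> vertices (Node P C)" "(c, Leaf i) \<in># C'" by (auto simp: leaves_of_def)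
  then consider "H = P" "C' = C" | x where "x \<in># C" "Node H C' \<in> vertices (snd x)" by (auto simp: vertices_Node)
  then show "i \<in> (\<Union>x\<in>set_mset C. child_leaves (snd x) P H)"
  proof cases
    case 1
    then show ?thesis using C'(2) by (intro UN_I[of "(c, Leaf i)"]) (simp_all add: child_leaves_def)
  next
    case 2
    then have "i \<in> leaves_of (snd x) H" using C'(2) by (auto simp: leaves_of_def)
    moreover have "\<exists>Q D. snd x = Node Q D" using 2(2) by (cases "snd x") simp_all
    ultimately have "i \<in> child_leaves (snd x) P H" by (auto simp: child_leaves_def)
    then show ?thesis using 2(1) by blast
  qed
next
  fix i assume "i \<in> (\<Union>x\<in>set_mset C. child_leaves (snd x) P H)"
  then obtain x where x: "x \<in># C" "i \<in> child_leaves (snd x) P H" by blast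
  show "i \<in> leaves_of (Node P C) H"
  proof (cases "snd x")
    case (Leaf k)
    then have "P = H" "k = i" using x(2) by (auto simp: child_leaves_def split: if_splits)
    then have "(fst x, Leaf i) \<in># C" using x(1) Leaf by (metis prod.collapse)
    then show ?thesis using \<open>P = H\<close> vertices_refl[of "Node P C"] unfolding leaves_of_def by blast
  next
    case (Node Q D)
    then have "i \<in> leaves_of (snd x) H" using x(2) by (simp add: child_leaves_def)
    then obtain C' c where "Node H C' \<in> vertices (snd x)" "(c, Leaf i) \<in># C'" by (auto simp: leaves_of_def)
    moreover then have "Node H C' \<in> vertices (Node P C)" using x(1) unfolding vertices_Node by blast
    ultimately show ?thesis unfolding leaves_of_def by blast
  qed
qed

lemma lookup_lweight_st:
  assumes "v = s_var \<or> v = t_var"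
  shows "Poly_Mapping.lookup (lweight u K) v = 0"
proof (induction u arbitrary: K rule: ltree_induct)
  case (Node P C)
  then have "Poly_Mapping.lookup (\<Sum>x\<in>#C. lweight (snd x) P) v = 0"
    by (induction C) (simp_all add: lookup_add)
  then show ?case by (simp only: lweight_Node)
qed (use assms in \<open>auto simp: lookup_single\<close>)

lemma lookup_lweight:
  assumes "valid G S u"
  shows "Poly_Mapping.lookup (lweight u K) (tH_var H) = card (child_leaves u K H)"
  using assms
proof (induction u arbitrary: K rule: ltree_induct)
  case (Leaf i)
  then show ?case by (simp add: child_leaves_def lookup_single)
next
  case (Node P C)
  let ?F = "set_mset C"
  have C: "C = mset_set ?F" by (rule valid_children(1)[OF Node.prems])
  have disj: "disjoint_family_on pair_supp ?F" by (rule valid_children(2)[OF Node.prems])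
  have "lweight (Node P C) K = lweight (Node P (mset_set ?F)) K" by (rule arg_cong[OF C])
  then have "Poly_Mapping.lookup (lweight (Node P C) K) (tH_var H) = (\<Sum>x\<in>?F. Poly_Mapping.lookup (lweight (snd x) P) (tH_var H))"
    by (simp only: lweight_Node_mset_set lookup_sum)
  also have "\<dots> = (\<Sum>x\<in>?F. card (child_leaves (snd x) P H))"
    by (rule sum.cong) (auto intro: Node.IH valid_child[OF Node.prems])
  also have "\<dots> = card (\<Union>x\<in>?F. child_leaves (snd x) P H)"
  proof (rule card_UN_disjoint[symmetric])
    show "\<forall>x\<in>?F. finite (child_leaves (snd x) P H)"
      by (simp add: finite_child_leaves)
    show "\<forall>x\<in>?F. \<forall>y\<in>?F. x \<noteq> y \<longrightarrow> child_leaves (snd x) P H \<inter> child_leaves (snd y) P H = {}"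
    proof (intro ballI impI)
      fix x y assume "x \<in># C" "y \<in># C" "x \<noteq> y"
      then have "leaf_set (snd x) \<inter> leaf_set (snd y) = {}"
        using disjoint_family_onD[OF disj] by simp
      then show "child_leaves (snd x) P H \<inter> child_leaves (snd y) P H = {}"
        using child_leaves_subset[of "snd x" P H] child_leaves_subset[of "snd y" P H] by blast
    qed
  qed simp
  finally show ?case by (simp only: leaves_of_Node child_leaves_def ltree.case)
qed

text \<open>A fallen leaf has no parent and is therefore marked by \<open>t\<close> instead of some
  \<open>t_H\<close>. Each tree carries one \<open>s\<close>, which has label degree 0.\<close>

definition forest_weight :: "'l ltree \<Rightarrow> ('l series_var \<Rightarrow>\<^sub>0 nat)" where
  "forest_weight u = Poly_Mapping.single s_var 1 +
     (case u of Leaf i \<Rightarrow> Poly_Mapping.single t_var 1 | Node K C \<Rightarrow> lweight u K)"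

lemma lookup_forest_weight:
  "Poly_Mapping.lookup (forest_weight u) s_var = 1"
  "Poly_Mapping.lookup (forest_weight u) t_var = (if \<exists>i. u = Leaf i then 1 else 0)"
  "valid G S u \<Longrightarrow> Poly_Mapping.lookup (forest_weight u) (tH_var H) = card (leaves_of u H)"
proof -
  show "Poly_Mapping.lookup (forest_weight u) s_var = 1"
    by (cases u) (simp_all add: forest_weight_def lookup_add lookup_single lookup_lweight_st)
  show "Poly_Mapping.lookup (forest_weight u) t_var = (if \<exists>i. u = Leaf i then 1 else 0)"
    by (cases u) (simp_all add: forest_weight_def lookup_add lookup_single lookup_lweight_st)
  assume V: "valid G S u"
  show "Poly_Mapping.lookup (forest_weight u) (tH_var H) = card (leaves_of u H)"
  proof (cases u)
    case (Node K C)
    have "Poly_Mapping.lookup (forest_weight u) (tH_var H) = Poly_Mapping.lookup (lweight u K) (tH_var H)"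
      unfolding Node by (simp add: forest_weight_def lookup_add lookup_single)
    also have "\<dots> = card (leaves_of u H)" unfolding lookup_lweight[OF V] by (simp add: Node child_leaves_def)
    finally show ?thesis .
  qed (simp add: forest_weight_def lookup_add lookup_single)
qed

definition nodes :: "('g, 'm) monoid_scheme \<Rightarrow> 'g set set \<Rightarrow> 'g set ltree set" where
  "nodes G S = (\<Union>K\<in>S. trees G S K)"

lemma nodes_iff: "T \<in> nodes G S \<longleftrightarrow> valid G S T \<and> (\<exists>K C. T = Node K C)"
  using valid_Node_child_sets(1) by (fastforce simp: nodes_def trees_def)

lemma valid_eq_nodes: "{T. valid G S T} = range Leaf \<union> nodes G S"
proof (intro equalityI subsetI)
  fix T assume "T \<in> {T. valid G S T}"
  then show "T \<in> range Leaf \<union> nodes G S" by (cases T) (simp_all add: nodes_iff)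
qed (auto simp: nodes_iff)

text \<open>Containment is transitive along paths, so the condition on descendants follows from the
  one on children in \<open>ok_vertex\<close>.\<close>

lemma has_child_valid:
  assumes V: "valid G S T" and v: "v \<in> vertices T" "has_child\<^sup>+\<^sup>+ v w"
    and Node: "v = Node Q C" "w = Node P D"
  shows "P \<subseteq> Q"
proof -
  have child: "P \<subseteq> R" if R: "Node R E \<in> vertices T" and c: "has_child (Node R E) (Node P D)" for R E P D
  proof -
    have "ok_vertex G S (Node R E)" using V R by (simp add: valid_def)
    moreover obtain c where "(c, Node P D) \<in># E" using c by (auto simp: has_child_def)
    ultimately show ?thesis unfolding ok_vertex_Node by fastforce
  qed
  have "w \<in> vertices T \<and> (\<forall>Q C P D. v = Node Q C \<longrightarrow> w = Node P D \<longrightarrow> P \<subseteq> Q)"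
    using v(2)
  proof (induction rule: tranclp_induct)
    case (base w)
    have "w \<in> vertices T" using base v(1) by (simp add: vertices_def)
    then show ?case using child v(1) base by blast
  next
    case (step y z)
    have z: "z \<in> vertices T"
      using step.IH step.hyps(2) by (auto simp: vertices_def intro: rtranclp.rtrancl_into_rtrancl)
    have "P \<subseteq> Q" if "v = Node Q C" "z = Node P D" for Q C P D
    proof -
      obtain R E where y: "y = Node R E" using step.hyps(2) by (auto simp: has_child_def)
      have "P \<subseteq> R" by (rule child[of R E P D]) (use step.IH step.hyps(2) y that(2) in simp_all)
      moreover have "R \<subseteq> Q" using step.IH y that(1) by blast
      ultimately show ?thesis by (rule subset_trans)
    qed
    then show ?case using z by blast
  qed
  then show ?thesis using Node by blast
qed

section \<open>Series of single trees in a forest and weights of forests\<close>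

context tree_labels begin

lemma forest_weight_trees: "u \<in> trees G S P \<Longrightarrow> forest_weight u = Poly_Mapping.single s_var 1 + lweight u P"
  by (auto simp: trees_def forest_weight_def)

lemma labelled_forest_trees: "labelled label_degree leaf_set forest_weight (trees G S P)"
proof (rule labelled_bij[where h = id])
  show "labelled label_degree leaf_set (\<lambda>u. Poly_Mapping.single s_var 1 + lweight u P) (trees G S P)"
    by (rule labelled_shift_weight[OF mdeg_add _ labelled_trees]) simp
qed (simp_all add: forest_weight_trees)

lemma egf_forest_trees: "egf label_degree leaf_set forest_weight (trees G S P) = mfps_var s_var * tree_series G S P"
proof -
  have "(egf label_degree leaf_set forest_weight (trees G S P) :: 'g set series) =
      egf label_degree leaf_set (\<lambda>u. Poly_Mapping.single s_var 1 + lweight u P) (trees G S P)"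
    by (rule egf_bij[where h = id]) (simp_all add: forest_weight_trees)
  also have "\<dots> = mfps_monom 1 (Poly_Mapping.single s_var 1) * tree_series G S P"
    unfolding tree_series_def by (rule egf_shift_weight[OF mdeg_add]) simp
  finally show ?thesis by (simp only: mfps_var_eq_monom)
qed

lemma disjoint_trees: "disjoint_family_on (trees G S) S"
  by (auto simp: disjoint_family_on_def trees_def)

lemma labelled_nodes: "labelled label_degree leaf_set forest_weight (nodes G S)"
  unfolding nodes_def by (rule labelled_UN[OF finite_S labelled_forest_trees disjoint_trees])

lemma egf_nodes: "egf label_degree leaf_set forest_weight (nodes G S) = mfps_var s_var * (\<Sum>K\<in>S. tree_series G S K)"
  unfolding nodes_def sum_distrib_left egf_UN[OF finite_S labelled_forest_trees disjoint_trees] egf_forest_trees ..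

lemma labelled_fallen: "labelled label_degree leaf_set forest_weight (range Leaf :: 'g set ltree set)"
  by (rule labelled_Leaf[where w = "Poly_Mapping.single s_var 1 + Poly_Mapping.single t_var 1"])
    (simp_all add: forest_weight_def mdeg_add)

lemma egf_fallen:
  "egf label_degree leaf_set forest_weight (range Leaf :: 'g set ltree set) = (mfps_var s_var * mfps_var t_var :: 'g set series)"
proof -
  have "(egf label_degree leaf_set forest_weight (range Leaf :: 'g set ltree set) :: 'g set series) =
      mfps_monom 1 (Poly_Mapping.single s_var 1 + Poly_Mapping.single t_var 1)"
    by (rule egf_Leaf) (simp_all add: forest_weight_def mdeg_add)
  then show ?thesis unfolding mfps_var_eq_monom mfps_monom_mult mult_1 .
qed

lemma Leaf_nodes_disjoint: "range Leaf \<inter> nodes G S = {}"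
  by (auto simp: nodes_iff)

lemma labelled_valid: "labelled label_degree leaf_set forest_weight {T. valid G S T}"
  unfolding valid_eq_nodes by (rule labelled_Un[OF labelled_fallen labelled_nodes Leaf_nodes_disjoint])

lemma egf_valid: "egf label_degree leaf_set forest_weight {T. valid G S T} =
    mfps_var s_var * mfps_var t_var + mfps_var s_var * (\<Sum>K\<in>S. tree_series G S K)"
  unfolding valid_eq_nodes egf_Un[OF labelled_fallen labelled_nodes Leaf_nodes_disjoint] egf_fallen egf_nodes ..

lemma leaves_of_label: "valid G S T \<Longrightarrow> H \<notin> S \<Longrightarrow> leaves_of T H = {}"
proof -
  assume "valid G S T" "H \<notin> S"
  then have "Node H C \<notin> vertices T" for C by (auto simp: valid_def ok_vertex_Node)
  then show ?thesis by (simp add: leaves_of_def)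
qed

text \<open>Disjoint leaf sets let cardinalities add up as the weights do. The exponent of a forest
  thus records exactly the parameters by which \<open>gamma''\<close> and \<open>gamma'\<close>
  count.\<close>

lemma sum_forest_weight:
  assumes F: "F \<in> configs leaf_set {T. valid G S T}"
  shows "sum forest_weight F = type_monomial S (card F) (card (fallen_leaves F)) (\<lambda>H. card (leaves_below F H))"
proof (rule poly_mapping_eqI)
  fix v
  have fin: "finite F" and V: "\<And>T. T \<in> F \<Longrightarrow> valid G S T" and disj: "disjoint_family_on leaf_set F"
    using F by (auto simp: configs_def)
  show "Poly_Mapping.lookup (sum forest_weight F) v =
      Poly_Mapping.lookup (type_monomial S (card F) (card (fallen_leaves F)) (\<lambda>H. card (leaves_below F H))) v"
  proof (cases v)
    case s_var
    then show ?thesis by (simp add: lookup_sum lookup_forest_weight(1) lookup_type_monomial[OF finite_S])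
  next
    case t_var
    have "(\<Sum>T\<in>F. if \<exists>i. T = Leaf i then 1 else 0) = card (fallen_leaves F)"
      unfolding fallen_leaves_def using fin by (simp add: sum.inter_filter[symmetric])
    then show ?thesis using t_var by (simp add: lookup_sum lookup_forest_weight(2) lookup_type_monomial[OF finite_S])
  next
    case (tH_var H)
    have "(\<Sum>T\<in>F. Poly_Mapping.lookup (forest_weight T) (tH_var H)) = (\<Sum>T\<in>F. card (leaves_of T H))"
      by (rule sum.cong) (auto intro: lookup_forest_weight(3) V)
    also have "\<dots> = card (leaves_below F H)"
      unfolding leaves_below_eq
    proof (rule card_UN_disjoint[symmetric, OF fin])
      show "\<forall>T\<in>F. finite (leaves_of T H)" by (simp add: finite_leaves_of)
      show "\<forall>T\<in>F. \<forall>T'\<in>F. T \<noteq> T' \<longrightarrow> leaves_of T H \<inter> leaves_of T' H = {}"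
      proof (intro ballI impI)
        fix T T' assume "T \<in> F" "T' \<in> F" "T \<noteq> T'"
        then have "leaf_set T \<inter> leaf_set T' = {}" using disjoint_family_onD[OF disj] by blast
        then show "leaves_of T H \<inter> leaves_of T' H = {}" using leaves_of_subset[of T H] leaves_of_subset[of T' H] by blast
      qed
    qed
    also have "\<dots> = (if H \<in> S then card (leaves_below F H) else 0)"
    proof (cases "H \<in> S")
      case False
      have "leaves_below F H = {}" unfolding leaves_below_eq using leaves_of_label[OF V False] by blast
      then show ?thesis using False by simp
    qed simp
    finally show ?thesis unfolding tH_var by (simp only: lookup_sum lookup_type_monomial[OF finite_S])
  qed
qed

end

section \<open>Forests as configurations of valid trees\<close>

lemma vertices_Node_iff: "(\<exists>K C. Node K C \<in> vertices T) \<longleftrightarrow> (\<exists>K C. T = Node K C)"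
proof (cases T)
  case (Node K C)
  then show ?thesis using vertices_refl[of T] by blast
qed simp

lemma valid_of_forest:
  fixes G :: "('g, 'm) monoid_scheme"
  assumes on: "tree_on (leaf_set T) T"
    and lab: "\<And>K C. Node K C \<in> vertices T \<Longrightarrow> K \<in> S"
    and desc: "\<And>Q C P D. Node Q C \<in> vertices T \<Longrightarrow> has_child\<^sup>+\<^sup>+ (Node Q C) (Node P D) \<Longrightarrow> P \<subseteq> Q"
    and one: "\<And>Q c P D. Node Q {#(c, Node P D)#} \<in> vertices T \<Longrightarrow> P \<subset> Q"
    and one': "\<And>Q c i. Node Q {#(c, Leaf i)#} \<in> vertices T \<Longrightarrow> Q \<noteq> {\<one>\<^bsub>G\<^esub>}"
    and cos: "coset_edges G T"
  shows "valid G S T"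
proof -
  have "leaves T = mset_set (leaf_set T)" using on unfolding tree_on_def by blast
  then have "\<forall>i. count (leaves T) i \<le> 1" by (rule iffD2[OF count_le_1_iff])
  moreover have "ok_vertex G S v" if v: "v \<in> vertices T" for v
  proof (cases v)
    case (Node K C)
    have vK: "Node K C \<in> vertices T" using v Node by simp
    show ?thesis
      unfolding Node ok_vertex_Node
    proof (intro conjI ballI allI impI)
      show "K \<in> S" by (rule lab[OF vK])
      show "C \<noteq> {#}" using on vK unfolding tree_on_def by blast
      fix x assume x: "x \<in># C"
      obtain c u where cu: "x = (c, u)" by (cases x)
      note co = cos[unfolded coset_edges_def, rule_format, OF vK x[unfolded cu]]
      show "fst x \<in> rcosets\<^bsub>G\<^esub> K" using co unfolding cu by simp
      show "fst x = base G K" if "Min (leaf_set (Node K C)) \<in> leaf_set (snd x)" using co that unfolding cu by simp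
      show "P \<subseteq> K" if "snd x = Node P D" for P D
      proof (rule desc[OF vK])
        have "has_child (Node K C) (Node P D)" using x cu that by (auto simp: has_child_def)
        then show "has_child\<^sup>+\<^sup>+ (Node K C) (Node P D)" by (rule tranclp.r_into_trancl)
      qed
    next
      fix c P D assume "C = {#(c, Node P D)#}"
      then show "P \<subset> K" using one vK by blast
    next
      fix c i assume "C = {#(c, Leaf i)#}"
      then show "K \<noteq> {\<one>\<^bsub>G\<^esub>}" using one' vK by blast
    qed
  qed simp
  ultimately show ?thesis unfolding valid_def by blast
qed

lemma valid_forest:
  fixes G :: "('g, 'm) monoid_scheme"
  assumes V: "valid G S T"
  shows "tree_on (leaf_set T) T" "Node K C \<in> vertices T \<Longrightarrow> K \<in> S"
    "Node Q {#(c, Node P D)#} \<in> vertices T \<Longrightarrow> P \<subset> Q"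
    "Node Q {#(c, Leaf i)#} \<in> vertices T \<Longrightarrow> Q \<noteq> {\<one>\<^bsub>G\<^esub>}"
    "coset_edges G T"
proof -
  have ok: "ok_vertex G S (Node K C)" if "Node K C \<in> vertices T" for K C using V that by (simp add: valid_def)
  have "leaves T = mset_set (leaf_set T)"
    by (rule iffD1[OF count_le_1_iff]) (use V in \<open>simp add: valid_def\<close>)
  moreover have "C \<noteq> {#}" if "Node K C \<in> vertices T" for K C using ok[OF that] unfolding ok_vertex_Node by blast
  ultimately show "tree_on (leaf_set T) T" unfolding tree_on_def by blast
  show "Node K C \<in> vertices T \<Longrightarrow> K \<in> S" using ok unfolding ok_vertex_Node by blast
  show "Node Q {#(c, Node P D)#} \<in> vertices T \<Longrightarrow> P \<subset> Q" using ok unfolding ok_vertex_Node by blast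
  show "Node Q {#(c, Leaf i)#} \<in> vertices T \<Longrightarrow> Q \<noteq> {\<one>\<^bsub>G\<^esub>}" using ok unfolding ok_vertex_Node by blast
  show "coset_edges G T"
    unfolding coset_edges_def
  proof (intro allI impI)
    fix K C assume "Node K C \<in> vertices T"
    from ok[OF this]
    have "\<forall>x\<in>#C. fst x \<in> rcosets\<^bsub>G\<^esub> K \<and> (Min (leaf_set (Node K C)) \<in> leaf_set (snd x) \<longrightarrow> fst x = base G K)"
      unfolding ok_vertex_Node by blast
    then show "\<forall>(c, u)\<in>#C. c \<in> rcosets\<^bsub>G\<^esub> K \<and> (Min (leaf_set (Node K C)) \<in> leaf_set u \<longrightarrow> c = base G K)"
      by auto
  qed
qed

text \<open>Without vertices labelled \<open>G\<close> the two conditions on that label are vacuous,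
  and apart from the existence of an internal vertex the others concern single trees or say that the
  leaf sets partition the labels. As leaf sets of valid trees are nonempty, disjointness yields both
  the partition and the injectivity of \<open>leaf_set\<close>.\<close>

lemma forests'_eq:
  fixes G :: "('g, 'm) monoid_scheme" and \<rho> :: "'g \<Rightarrow> 'v \<Rightarrow> 'v"
  defines "S \<equiv> proper_closed G \<rho>"
  shows "forests' G \<rho> n = {F \<in> configs leaf_set {T. valid G S T}. csupp leaf_set F = {1..n} \<and> (\<exists>T\<in>F. T \<in> nodes G S)}"
proof (intro equalityI subsetI)
  fix F assume "F \<in> forests' G \<rho> n"
  then have "F \<in> forests G \<rho> n" and proper: "\<And>T C. T \<in> F \<Longrightarrow> Node (carrier G) C \<notin> vertices T"
    unfolding forests'_def by simp_all
  note c = this(1)[unfolded forests_def mem_Collect_eq]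
  \<comment> \<open>The conjuncts are selected by position; the two about the label \<open>G\<close>
    are passed over.\<close>
  note part = c[THEN conjunct1] and inj = c[THEN conjunct2, THEN conjunct1]
    and on = c[THEN conjunct2, THEN conjunct2, THEN conjunct1]
    and lab = c[THEN conjunct2, THEN conjunct2, THEN conjunct2, THEN conjunct1]
    and desc = c[THEN conjunct2, THEN conjunct2, THEN conjunct2, THEN conjunct2, THEN conjunct1]
    and one = c[THEN conjunct2, THEN conjunct2, THEN conjunct2, THEN conjunct2, THEN conjunct2, THEN conjunct1]
    and one' = c[THEN conjunct2, THEN conjunct2, THEN conjunct2, THEN conjunct2, THEN conjunct2, THEN conjunct2, THEN conjunct1]
    and cos = c[THEN conjunct2, THEN conjunct2, THEN conjunct2, THEN conjunct2, THEN conjunct2, THEN conjunct2, THEN conjunct2, THEN conjunct2, THEN conjunct2, THEN conjunct1]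
    and ex = c[THEN conjunct2, THEN conjunct2, THEN conjunct2, THEN conjunct2, THEN conjunct2, THEN conjunct2, THEN conjunct2, THEN conjunct2, THEN conjunct2, THEN conjunct2]
  have V: "valid G S T" if T: "T \<in> F" for T
  proof (rule valid_of_forest)
    show "K \<in> S" if "Node K C \<in> vertices T" for K C
      using lab[rule_format, OF T that] proper[OF T, of C] that unfolding S_def proper_closed_def by blast
    show "tree_on (leaf_set T) T" "coset_edges G T" using on cos T by blast+
    show "P \<subseteq> Q" if "Node Q C \<in> vertices T" "has_child\<^sup>+\<^sup>+ (Node Q C) (Node P D)" for Q C P D
      by (rule desc[rule_format, OF T conjI[OF that]])
    show "P \<subset> Q" if "Node Q {#(c, Node P D)#} \<in> vertices T" for Q c P D
      by (rule one[rule_format, OF T that])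
    show "Q \<noteq> {\<one>\<^bsub>G\<^esub>}" if "Node Q {#(c, Leaf i)#} \<in> vertices T" for Q c i
      by (rule one'[rule_format, OF T that])
  qed
  have "finite (leaf_set ` F)" by (rule finite_subset[of _ "Pow {1..n}"]) (use part in \<open>auto simp: partition_on_def\<close>)
  then have "finite F" using inj by (rule finite_imageD)
  moreover have "disjoint_family_on leaf_set F"
    unfolding disjoint_family_on_def
  proof (intro ballI impI)
    fix T T' assume T: "T \<in> F" "T' \<in> F" "T \<noteq> T'"
    then have "leaf_set T \<noteq> leaf_set T'" using inj_on_eq_iff[OF inj T(1,2)] by blast
    moreover have "disjoint (leaf_set ` F)" using part unfolding partition_on_def by blast
    ultimately show "leaf_set T \<inter> leaf_set T' = {}" using T disjointD by blast
  qed
  moreover have "csupp leaf_set F = {1..n}" using part by (simp add: partition_on_def csupp_def)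
  moreover have "\<exists>T\<in>F. T \<in> nodes G S" using ex V unfolding nodes_iff vertices_Node_iff by blast
  ultimately show "F \<in> {F \<in> configs leaf_set {T. valid G S T}. csupp leaf_set F = {1..n} \<and> (\<exists>T\<in>F. T \<in> nodes G S)}"
    using V unfolding configs_def by blast
next
  fix F assume F: "F \<in> {F \<in> configs leaf_set {T. valid G S T}. csupp leaf_set F = {1..n} \<and> (\<exists>T\<in>F. T \<in> nodes G S)}"
  then have V: "\<And>T. T \<in> F \<Longrightarrow> valid G S T" and disj: "disjoint_family_on leaf_set F" and cs: "csupp leaf_set F = {1..n}"
    unfolding configs_def by blast+
  have ne: "leaf_set T \<noteq> {}" if "T \<in> F" for T by (rule valid_leaf_set[OF V[OF that]])
  have inj: "inj_on leaf_set F"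
  proof (rule inj_onI, rule ccontr)
    fix T T' assume T: "T \<in> F" "T' \<in> F" "leaf_set T = leaf_set T'" "T \<noteq> T'"
    then show False using disjoint_family_onD[OF disj T(1,2,4)] ne[OF T(1)] by simp
  qed
  have part: "partition_on {1..n} (leaf_set ` F)"
    unfolding partition_on_def
  proof (intro conjI)
    show "\<Union> (leaf_set ` F) = {1..n}" using cs by (simp add: csupp_def)
    show "disjoint (leaf_set ` F)"
    proof (rule disjointI)
      fix A B assume A: "A \<in> leaf_set ` F" "B \<in> leaf_set ` F" "A \<noteq> B"
      then obtain T T' where T: "T \<in> F" "T' \<in> F" "A = leaf_set T" "B = leaf_set T'" by blast
      then have "T \<noteq> T'" using A(3) by blast
      then show "A \<inter> B = {}" unfolding T(3,4) by (rule disjoint_family_onD[OF disj T(1,2)])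
    qed
    show "{} \<notin> leaf_set ` F"
    proof
      assume "{} \<in> leaf_set ` F"
      then obtain T where "T \<in> F" "{} = leaf_set T" by (rule imageE)
      then show False using ne by blast
    qed
  qed
  note S = valid_forest(2)[OF V, unfolded S_def proper_closed_def]
  have ex: "\<exists>T \<in> F. \<exists>K C. Node K C \<in> vertices T" using F unfolding vertices_Node_iff nodes_iff by blast
  have nocar: "Node (carrier G) C \<notin> vertices T" if "T \<in> F" for T C using S[OF that] by blast
  show "F \<in> forests' G \<rho> n"
    unfolding forests'_def forests_def mem_Collect_eq
  proof (intro conjI ballI allI impI)
    show "P \<subseteq> Q" if "T \<in> F" "Node Q C \<in> vertices T \<and> has_child\<^sup>+\<^sup>+ (Node Q C) (Node P D)" for T Q C P D
      using that(2) by (intro has_child_valid[OF V[OF that(1)]]) blast+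
    show "K \<in> closed_subgroups G \<rho>" if "T \<in> F" "Node K C \<in> vertices T" for T K C
      using S[OF that] by blast
    show "P \<subset> Q" if "T \<in> F" "Node Q {#(c, Node P D)#} \<in> vertices T" for T Q c P D
      by (rule valid_forest(3)[OF V[OF that(1)] that(2)])
    show "Q \<noteq> {\<one>\<^bsub>G\<^esub>}" if "T \<in> F" "Node Q {#(c, Leaf i)#} \<in> vertices T" for T Q c i
      by (rule valid_forest(4)[OF V[OF that(1)] that(2)])
    show "T = T'" if "T \<in> F" "T' \<in> F" "Node (carrier G) C \<in> vertices T \<and> Node (carrier G) C' \<in> vertices T'" for T T' C C'
      using nocar[OF that(1)] that(3) by blast
    show "size (filter_mset (\<lambda>(c, u). \<exists>D. u = Node (carrier G) D) C) \<le> 1" if "T \<in> F" "Node (carrier G) C \<in> vertices T" for T C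
      using nocar[OF that(1)] that(2) by blast
  qed (rule part inj ex valid_forest(1)[OF V] valid_forest(5)[OF V] nocar; assumption?)+
qed

text \<open>If no leaf is fallen, every tree has an internal vertex, and the demand for at least one
  such vertex becomes nonemptiness of the forest.\<close>

lemma forests''_eq:
  fixes G :: "('g, 'm) monoid_scheme" and \<rho> :: "'g \<Rightarrow> 'v \<Rightarrow> 'v"
  defines "S \<equiv> proper_closed G \<rho>"
  shows "forests'' G \<rho> n = {F \<in> configs leaf_set (nodes G S). csupp leaf_set F = {1..n} \<and> F \<noteq> {}}"
proof -
  have "fallen_leaves F = {} \<and> F \<subseteq> {T. valid G S T} \<longleftrightarrow> F \<subseteq> nodes G S" for F
  proof
    assume F: "fallen_leaves F = {} \<and> F \<subseteq> {T. valid G S T}"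
    show "F \<subseteq> nodes G S"
    proof
      fix T assume T: "T \<in> F"
      then have "\<not> (\<exists>i. T = Leaf i)" using F unfolding fallen_leaves_def by blast
      then show "T \<in> nodes G S" using F T unfolding nodes_iff by (cases T) blast+
    qed
  qed (auto simp: fallen_leaves_def nodes_iff)
  then show ?thesis
    unfolding forests''_def forests'_eq S_def[symmetric] configs_def by blast
qed

lemma inj_on_type_monomial:
  assumes S: "finite S"
  shows "inj_on (\<lambda>(j, a). type_monomial S j 0 a) {(j, a). a \<in> S \<rightarrow>\<^sub>E UNIV \<and> P a}"
    "inj_on (\<lambda>(j, h, a). type_monomial S j h a) {(j, h, a). Q j h \<and> a \<in> S \<rightarrow>\<^sub>E UNIV \<and> P a}"
proof -
  have a: "a = a'" if "a \<in> S \<rightarrow>\<^sub>E UNIV" "a' \<in> S \<rightarrow>\<^sub>E UNIV" "\<forall>H\<in>S. a H = a' H" for a a' :: "_ \<Rightarrow> nat"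
    using that by (intro PiE_ext) auto
  show "inj_on (\<lambda>(j, a). type_monomial S j 0 a) {(j, a). a \<in> S \<rightarrow>\<^sub>E UNIV \<and> P a}"
    by (rule inj_onI) (use a in \<open>clarsimp simp: type_monomial_eq_iff[OF S]\<close>)
  show "inj_on (\<lambda>(j, h, a). type_monomial S j h a) {(j, h, a). Q j h \<and> a \<in> S \<rightarrow>\<^sub>E UNIV \<and> P a}"
    by (rule inj_onI) (use a in \<open>clarsimp simp: type_monomial_eq_iff[OF S]\<close>)
qed

lemma type_monomial_restrict: "type_monomial S j h (restrict a S) = type_monomial S j h a"
  unfolding type_monomial_def by (rule arg_cong[of _ _ "\<lambda>x. _ + x"]) (rule sum.cong, simp_all)

section \<open>The two generating series of forests\<close>

context tree_labels begin

lemma nodes_subset: "nodes G S \<subseteq> {T. valid G S T}"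
  unfolding nodes_iff[abs_def] nodes_def trees_def by blast

lemma configs_nodes: "F \<in> configs leaf_set (nodes G S) \<longleftrightarrow> F \<in> configs leaf_set {T. valid G S T} \<and> fallen_leaves F = {}"
proof
  assume F: "F \<in> configs leaf_set (nodes G S)"
  then have "F \<in> configs leaf_set {T. valid G S T}" using nodes_subset unfolding configs_def by blast
  moreover have "fallen_leaves F = {}"
    using F Leaf_nodes_disjoint unfolding configs_def fallen_leaves_def by blast
  ultimately show "F \<in> configs leaf_set {T. valid G S T} \<and> fallen_leaves F = {}" ..
next
  assume F: "F \<in> configs leaf_set {T. valid G S T} \<and> fallen_leaves F = {}"
  have "F \<subseteq> nodes G S"
  proof
    fix T assume T: "T \<in> F"
    then have "T \<in> range Leaf \<union> nodes G S" using F unfolding valid_eq_nodes[symmetric] configs_def by blast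
    moreover have "T \<notin> range Leaf" using F T unfolding fallen_leaves_def by blast
    ultimately show "T \<in> nodes G S" by blast
  qed
  then show "F \<in> configs leaf_set (nodes G S)" using F unfolding configs_def by blast
qed

lemma valid_structures: "labelled_structures label_degree leaf_set forest_weight {T. valid G S T}"
  by unfold_locales (simp_all only: mdeg_add labelled_valid mem_Collect_eq valid_leaf_set not_False_eq_True)

lemma nodes_structures: "labelled_structures label_degree leaf_set forest_weight (nodes G S)"
proof
  fix T assume "T \<in> nodes G S"
  then show "leaf_set T \<noteq> {}" using nodes_subset valid_leaf_set by blast
qed (simp_all only: mdeg_add labelled_nodes)

lemma fallen_structures: "labelled_structures label_degree leaf_set forest_weight (range Leaf :: 'g set ltree set)"
proof
  fix T :: "'g set ltree" assume "T \<in> range Leaf"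
  then show "leaf_set T \<noteq> {}" by auto
qed (simp_all only: mdeg_add labelled_fallen)

text \<open>The summand 1 of \<open>Gamma_tilde\<close> is the empty forest, which
  \<open>forests''\<close> leaves out. With it the forests are all configurations of trees with
  internal root, as the exponential formula requires.\<close>

theorem Gamma_tilde_eq:
  assumes S: "S = proper_closed G \<rho>"
  shows "Gamma_tilde G \<rho> = mfps_exp (mfps_var s_var * (\<Sum>K\<in>S. tree_series G S K))"
proof -
  interpret labelled_structures label_degree leaf_set forest_weight "nodes G S" by (rule nodes_structures)
  define I where "I = {(j :: nat, a). a \<in> S \<rightarrow>\<^sub>E UNIV \<and> (\<Sum>H\<in>S. a H) \<ge> (1 :: nat)}"
  define \<mu> where "\<mu> = (\<lambda>(j, a). type_monomial S j 0 a)"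
  define c where "c = (\<lambda>(j, a). rat_of_nat (gamma'' G \<rho> j a) / fact (\<Sum>H\<in>S. a H))"
  have inj: "inj_on \<mu> I" unfolding \<mu>_def I_def by (rule inj_on_type_monomial(1)[OF finite_S])
  have trm: "mfps_const k * mfps_var s_var ^ j * (\<Prod>H\<in>S. mfps_var (tH_var H) ^ a H) = mfps_monom k (type_monomial S j 0 a)" for k :: rat and j a
    using type_monomial_term[OF finite_S, of k j 0 a] by (simp only: power_0 mult_1_left)
  have Gt: "Gamma_tilde G \<rho> = 1 + mfps_sum (\<lambda>p. mfps_monom (c p) (\<mu> p)) I"
    unfolding Gamma_tilde_def Let_def S[symmetric] trm I_def c_def \<mu>_def by (simp only: case_prod_unfold)
  have ch: "sum forest_weight F = type_monomial S (card F) 0 (\<lambda>H. card (leaves_below F H))" if "F \<in> cfg" for F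
    using sum_forest_weight[of F] that unfolding configs_nodes by simp
  have "Gamma_tilde G \<rho> = egf label_degree cs cw cfg"
  proof (rule mfps_eqI)
    fix m :: "'g set series_var \<Rightarrow>\<^sub>0 nat"
    show "mfps_coeff (Gamma_tilde G \<rho>) m = mfps_coeff (egf label_degree cs cw cfg) m"
    proof (cases "m \<in> \<mu> ` I")
      case True
      then obtain j a where ja: "(j, a) \<in> I" and m: "m = type_monomial S j 0 a" by (auto simp: \<mu>_def)
      then have a: "(\<Sum>H\<in>S. a H) \<ge> 1" by (simp add: I_def)
      have deg: "label_degree m = (\<Sum>H\<in>S. a H)" unfolding m label_degree_type_monomial by simp
      have "m \<noteq> 0" using a deg by (metis mdeg_0 not_one_le_zero)
      have "{F \<in> forests'' G \<rho> (\<Sum>H\<in>S. a H). card F = j \<and> (\<forall>H\<in>S. card (leaves_below F H) = a H)} =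
          {F \<in> cfg. cs F = {1..\<Sum>H\<in>S. a H} \<and> cw F = m}"
        unfolding forests''_eq S[symmetric]
      proof (rule Collect_cong)
        fix F
        have "cs F \<noteq> {}" if "cs F = {1..\<Sum>H\<in>S. a H}" using a that by simp
        then have "cs F = {1..\<Sum>H\<in>S. a H} \<longrightarrow> F \<noteq> {}" by (auto simp: csupp_def)
        moreover have "F \<in> cfg \<longrightarrow> (cw F = m) = (card F = j \<and> (\<forall>H\<in>S. card (leaves_below F H) = a H))"
          using ch[of F] unfolding m by (simp add: type_monomial_eq_iff[OF finite_S])
        ultimately show "(F \<in> {F \<in> cfg. cs F = {1..\<Sum>H\<in>S. a H} \<and> F \<noteq> {}} \<and> card F = j \<and> (\<forall>H\<in>S. card (leaves_below F H) = a H)) =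
            (F \<in> cfg \<and> cs F = {1..\<Sum>H\<in>S. a H} \<and> cw F = m)"
          by blast
      qed
      then have "gamma'' G \<rho> j a = num cs cw cfg {1..label_degree m} m"
        unfolding gamma''_def num_def S[symmetric] deg by (rule arg_cong)
      moreover have "mfps_coeff (mfps_sum (\<lambda>p. mfps_monom (c p) (\<mu> p)) I) m = c (j, a)"
        using mfps_coeff_sum_monom(1)[OF inj ja, of c] by (simp add: m \<mu>_def)
      ultimately show ?thesis
        unfolding Gt mfps_coeff_egf using \<open>m \<noteq> 0\<close> deg by (simp add: c_def mfps_coeff_one)
    next
      case False
      have Gm: "mfps_coeff (Gamma_tilde G \<rho>) m = (if m = 0 then 1 else 0)"
        unfolding Gt using mfps_coeff_sum_monom(2)[OF inj False, of c] by (simp add: mfps_coeff_one)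
      show ?thesis
      \<comment> \<open>For exponents outside the index set: without labels only the empty forest
        counts, and with labels any configuration of weight \<open>m\<close> would put
        \<open>m\<close> into the index set.\<close>
      proof (cases "label_degree m = 0")
        case True
        show ?thesis unfolding Gm egf_configs_low[OF True] ..
      next
        case deg: False
        have "{F \<in> cfg. cs F = {1..label_degree m} \<and> cw F = m} = {}"
        proof (rule equals0I)
          fix F assume F: "F \<in> {F \<in> cfg. cs F = {1..label_degree m} \<and> cw F = m}"
          let ?a = "restrict (\<lambda>H. card (leaves_below F H)) S"
          have m: "m = type_monomial S (card F) 0 ?a" using F ch[of F] by (simp only: type_monomial_restrict mem_Collect_eq)
          have "label_degree m = (\<Sum>H\<in>S. ?a H)" by (subst m) (simp only: label_degree_type_monomial add_0)
          then have "(card F, ?a) \<in> I" using deg unfolding I_def by simp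
          then have "m \<in> \<mu> ` I" using m unfolding \<mu>_def by (intro image_eqI[of _ _ "(card F, ?a)"]) simp_all
          with False show False ..
        qed
        then have "num cs cw cfg {1..label_degree m} m = 0" by (simp only: num_def card.empty)
        moreover have "m \<noteq> 0" using deg by auto
        ultimately show ?thesis unfolding Gm mfps_coeff_egf by simp
      qed
    qed
  qed
  also have "\<dots> = mfps_exp (mfps_var s_var * (\<Sum>K\<in>S. tree_series G S K))"
    unfolding exponential_formula egf_nodes ..
  finally show ?thesis .
qed

text \<open>The summation range of \<open>Gamma_bar\<close> misses no forest: a tree with an
  internal vertex is not fallen, and its leaves all have a parent.\<close>

lemma configs_with_node:
  assumes F: "F \<in> configs leaf_set {T. valid G S T}" and T: "T \<in> F" "T \<in> nodes G S"
  shows "card (fallen_leaves F) < card F" "(\<Sum>H\<in>S. card (leaves_below F H)) \<ge> 1"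
proof -
  have fin: "finite F" using F by (simp add: configs_def)
  have "T \<notin> fallen_leaves F" using T(2) unfolding fallen_leaves_def nodes_iff by fastforce
  then have "fallen_leaves F \<subset> F" using T(1) unfolding fallen_leaves_def by blast
  then show "card (fallen_leaves F) < card F" by (rule psubset_card_mono[OF fin])
  have T1: "{T} \<in> configs leaf_set (nodes G S)" using T(2) by (simp add: configs_def disjoint_family_on_def)
  interpret labelled_structures label_degree leaf_set forest_weight "nodes G S" by (rule nodes_structures)
  have "label_degree (cw {T}) = card (cs {T})" by (rule configs_weight[OF T1])
  moreover have "cs {T} = leaf_set T" by (simp add: csupp_def)
  moreover have "card (leaf_set T) > 0"
    using valid_leaf_set[of G S T] T(2) by (simp only: nodes_iff card_gt_0_iff finite_set_mset simp_thms not_False_eq_True)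
  moreover have "cw {T} = type_monomial S 1 0 (\<lambda>H. card (leaves_below {T} H))"
    using sum_forest_weight[of "{T}"] T1 unfolding configs_nodes by simp
  ultimately have "(\<Sum>H\<in>S. card (leaves_below {T} H)) \<ge> 1" by (simp add: label_degree_type_monomial)
  also have "(\<Sum>H\<in>S. card (leaves_below {T} H)) \<le> (\<Sum>H\<in>S. card (leaves_below F H))"
  proof (rule sum_mono, rule card_mono)
    fix H
    show "finite (leaves_below F H)" unfolding leaves_below_eq by (intro finite_UN_I fin finite_leaves_of)
    show "leaves_below {T} H \<subseteq> leaves_below F H" unfolding leaves_below_eq using T(1) by blast
  qed
  finally show "(\<Sum>H\<in>S. card (leaves_below F H)) \<ge> 1" .
qed

text \<open>The existence of an internal vertex is treated by complement: all configurations of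
  valid trees, fallen leaves included, minus those consisting of fallen leaves only. Each of the two
  classes obeys the exponential formula.\<close>

theorem Gamma_bar_eq:
  assumes S: "S = proper_closed G \<rho>"
  shows "Gamma_bar G \<rho> = mfps_exp (mfps_var s_var * mfps_var t_var + mfps_var s_var * (\<Sum>K\<in>S. tree_series G S K)) -
    mfps_exp (mfps_var s_var * mfps_var t_var)"
proof -
  let ?V = "{T. valid G S T}" and ?L = "range Leaf :: 'g set ltree set"
  let ?cs = "csupp leaf_set :: 'g set ltree set \<Rightarrow> nat set" and ?cw = "sum forest_weight :: 'g set ltree set \<Rightarrow> _"
  interpret V: labelled_structures label_degree leaf_set forest_weight ?V by (rule valid_structures)
  interpret L: labelled_structures label_degree leaf_set forest_weight ?L by (rule fallen_structures)
  define I where "I = {(j :: nat, h, a). h < j \<and> a \<in> S \<rightarrow>\<^sub>E UNIV \<and> (\<Sum>H\<in>S. a H) \<ge> (1 :: nat)}"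
  define \<mu> where "\<mu> = (\<lambda>(j, h, a). type_monomial S j h a)"
  define c where "c = (\<lambda>(j, h, a). rat_of_nat (gamma' G \<rho> h j a) / fact (h + (\<Sum>H\<in>S. a H)))"
  have inj: "inj_on \<mu> I" unfolding \<mu>_def I_def by (rule inj_on_type_monomial(2)[OF finite_S])
  have Gb: "Gamma_bar G \<rho> = mfps_sum (\<lambda>p. mfps_monom (c p) (\<mu> p)) I"
    unfolding Gamma_bar_def Let_def S[symmetric] type_monomial_term[OF finite_S] I_def c_def \<mu>_def
    by (simp only: case_prod_unfold)
  let ?N = "\<lambda>m. {F \<in> configs leaf_set ?V. (?cs F = {1..label_degree m} \<and> ?cw F = m) \<and> (\<exists>T\<in>F. T \<in> nodes G S)}"
  have split: "num ?cs ?cw (configs leaf_set ?V) {1..label_degree m} m =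
      card (?N m) + num ?cs ?cw (configs leaf_set ?L) {1..label_degree m} m" for m
  proof -
    let ?A = "{F \<in> configs leaf_set ?V. ?cs F = {1..label_degree m} \<and> ?cw F = m}"
    let ?B = "{F \<in> configs leaf_set ?L. ?cs F = {1..label_degree m} \<and> ?cw F = m}"
    have fin: "finite ?A" by (rule V.finite_configs) simp
    have L: "F \<in> configs leaf_set ?L \<longleftrightarrow> F \<in> configs leaf_set ?V \<and> \<not> (\<exists>T\<in>F. T \<in> nodes G S)" for F
    proof -
      have "F \<subseteq> ?L \<longleftrightarrow> F \<subseteq> ?L \<union> nodes G S \<and> \<not> (\<exists>T\<in>F. T \<in> nodes G S)"
        using Leaf_nodes_disjoint by blast
      then show ?thesis unfolding configs_def valid_eq_nodes by blast
    qed
    have B: "?B = {F \<in> configs leaf_set ?V. (?cs F = {1..label_degree m} \<and> ?cw F = m) \<and> \<not> (\<exists>T\<in>F. T \<in> nodes G S)}"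
      unfolding L by blast
    have "?A = ?N m \<union> ?B" unfolding B by blast
    moreover have "card (?N m \<union> ?B) = card (?N m) + card ?B"
    proof (rule card_Un_disjoint)
      show "finite (?N m)" by (rule finite_subset[OF _ fin]) blast
      show "finite ?B" unfolding B by (rule finite_subset[OF _ fin]) blast
      show "?N m \<inter> ?B = {}" unfolding B by blast
    qed
    ultimately show ?thesis unfolding num_def by (simp only:)
  qed
  have "Gamma_bar G \<rho> = egf label_degree ?cs ?cw (configs leaf_set ?V) - egf label_degree ?cs ?cw (configs leaf_set ?L)"
  proof (rule mfps_eqI)
    fix m :: "'g set series_var \<Rightarrow>\<^sub>0 nat"
    have rhs: "mfps_coeff (egf label_degree ?cs ?cw (configs leaf_set ?V) - egf label_degree ?cs ?cw (configs leaf_set ?L)) m =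
        rat_of_nat (card (?N m)) / fact (label_degree m)"
      unfolding mfps_coeff_simps mfps_coeff_egf split by (simp add: add_divide_distrib)
    show "mfps_coeff (Gamma_bar G \<rho>) m = mfps_coeff (egf label_degree ?cs ?cw (configs leaf_set ?V) - egf label_degree ?cs ?cw (configs leaf_set ?L)) m"
      unfolding rhs
    proof (cases "m \<in> \<mu> ` I")
      case True
      then obtain j h a where jha: "(j, h, a) \<in> I" and m: "m = type_monomial S j h a" by (auto simp: \<mu>_def)
      have deg: "label_degree m = h + (\<Sum>H\<in>S. a H)" unfolding m label_degree_type_monomial by simp
      have "{F \<in> forests' G \<rho> (h + (\<Sum>H\<in>S. a H)). card (fallen_leaves F) = h \<and> card F = j \<and> (\<forall>H\<in>S. card (leaves_below F H) = a H)} = ?N m"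
        unfolding forests'_eq S[symmetric] deg
      proof (rule Collect_cong)
        fix F
        have "F \<in> configs leaf_set ?V \<longrightarrow> (?cw F = m) = (card (fallen_leaves F) = h \<and> card F = j \<and> (\<forall>H\<in>S. card (leaves_below F H) = a H))"
          using sum_forest_weight[of F] unfolding m by (auto simp: type_monomial_eq_iff[OF finite_S])
        then show "(F \<in> {F \<in> configs leaf_set ?V. ?cs F = {1..h + (\<Sum>H\<in>S. a H)} \<and> (\<exists>T\<in>F. T \<in> nodes G S)} \<and>
            card (fallen_leaves F) = h \<and> card F = j \<and> (\<forall>H\<in>S. card (leaves_below F H) = a H)) =
            (F \<in> configs leaf_set ?V \<and> (?cs F = {1..h + (\<Sum>H\<in>S. a H)} \<and> ?cw F = m) \<and> (\<exists>T\<in>F. T \<in> nodes G S))"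
          by blast
      qed
      then have "gamma' G \<rho> h j a = card (?N m)"
        unfolding gamma'_def S[symmetric] by (rule arg_cong)
      moreover have "mfps_coeff (mfps_sum (\<lambda>p. mfps_monom (c p) (\<mu> p)) I) m = c (j, h, a)"
        using mfps_coeff_sum_monom(1)[OF inj jha, of c] by (simp add: m \<mu>_def)
      ultimately show "mfps_coeff (Gamma_bar G \<rho>) m = rat_of_nat (card (?N m)) / fact (label_degree m)"
        unfolding Gb deg by (simp only: c_def case_prod_conv)
    next
      case False
      have "?N m = {}"
      proof (rule equals0I)
        fix F assume F: "F \<in> ?N m"
        then obtain T where T: "T \<in> F" "T \<in> nodes G S" by blast
        have FV: "F \<in> configs leaf_set ?V" using F by blast
        let ?a = "restrict (\<lambda>H. card (leaves_below F H)) S"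
        have m: "m = type_monomial S (card F) (card (fallen_leaves F)) ?a"
          using F sum_forest_weight[OF FV] by (simp only: type_monomial_restrict mem_Collect_eq)
        have "(\<Sum>H\<in>S. ?a H) = (\<Sum>H\<in>S. card (leaves_below F H))" by (rule sum.cong) simp_all
        then have "(card F, card (fallen_leaves F), ?a) \<in> I"
          using configs_with_node[OF FV T] unfolding I_def by simp
        then have "m \<in> \<mu> ` I" using m unfolding \<mu>_def
          by (intro image_eqI[of _ _ "(card F, card (fallen_leaves F), ?a)"]) simp_all
        with False show False ..
      qed
      then have "card (?N m) = 0" by (simp only: card.empty)
      then show "mfps_coeff (Gamma_bar G \<rho>) m = rat_of_nat (card (?N m)) / fact (label_degree m)"
        unfolding Gb mfps_coeff_sum_monom(2)[OF inj False, of c] by (simp only: of_nat_0 div_0)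
    qed
  qed
  then show ?thesis unfolding V.exponential_formula L.exponential_formula egf_valid egf_fallen .
qed

end

theorem theorem6p1:
  fixes G :: "('g, 'm) monoid_scheme"
    and scale :: "complex \<Rightarrow> 'v::ab_group_add \<Rightarrow> 'v"
    and B :: "'v set"
    and \<rho> :: "'g \<Rightarrow> 'v \<Rightarrow> 'v"
  assumes "comm_group G" and "finite (carrier G)"
    and "finite_dimensional_vector_space scale B"
    and "\<rho> \<in> hom G (GL scale)" and "inj_on \<rho> (carrier G)"
    and "\<not> contains_trivial_rep scale G \<rho>"
  shows "(\<forall>Hs. increasing_enumeration (proper_closed G \<rho>) Hs \<longrightarrow>
            Gamma_tilde G \<rho> = foldr (exp_op G \<rho>) Hs 1) \<and>
         Gamma_bar G \<rho> = mfps_exp (mfps_var s_var * mfps_var t_var) * (Gamma_tilde G \<rho> - 1)"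
proof -
  let ?S = "proper_closed G \<rho>"
  have sg: "subgroup K G" if "K \<in> ?S" for K
    using that by (simp add: proper_closed_def closed_subgroups_def)
  interpret comm_group G by (rule assms(1))
  interpret tree_labels G ?S
    by (intro tree_labels.intro tree_labels_axioms.intro is_group assms(2) sg)
  let ?T = "\<Sum>K\<in>?S. tree_series G ?S K"
  have "Gamma_tilde G \<rho> = foldr (exp_op G \<rho>) Hs 1" if Hs: "increasing_enumeration ?S Hs" for Hs
  proof -
    have d: "distinct Hs" and set: "set Hs = ?S"
      and ord: "\<And>a b. a < length Hs \<Longrightarrow> b < length Hs \<Longrightarrow> Hs ! a \<subset> Hs ! b \<Longrightarrow> a < b"
      using Hs by (simp_all add: increasing_enumeration_def)
    have "sorted_wrt (\<lambda>A B. \<not> B \<subset> A) Hs"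
      unfolding sorted_wrt_iff_nth_less
    proof (intro allI impI notI)
      fix i j assume "i < j" "j < length Hs" "Hs ! j \<subset> Hs ! i"
      then show False using ord[of j i] by simp
    qed
    then obtain T where T: "solves G ?S T" "foldr (exp_op G \<rho>) Hs 1 = mfps_exp (mfps_var s_var * (\<Sum>K\<in>?S. T K))"
      using foldr_exp_op[OF is_group assms(2) sg d] set by (metis subset_refl)
    \<comment> \<open>The operator product supplies only some solution of the system; uniqueness
      identifies it with the tree series.\<close>
    have "(\<Sum>K\<in>?S. T K) = ?T"
      by (rule sum.cong[OF refl]) (rule solves_unique[OF T(1) tree_series_solves])
    then show ?thesis unfolding T(2) Gamma_tilde_eq[OF refl] by (simp only:)
  qed
  \<comment> \<open>The exponential of the sum factors, so the series of the fallen leaves can be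
    taken out of the difference.\<close>
  moreover have "Gamma_bar G \<rho> = mfps_exp (mfps_var s_var * mfps_var t_var) * (Gamma_tilde G \<rho> - 1)"
    unfolding Gamma_bar_eq[OF refl] Gamma_tilde_eq[OF refl]
    by (subst mfps_exp_add) (simp_all add: algebra_simps)
  ultimately show ?thesis by blast
qed

end
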